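(* Let $(b,\mathcal{D},\mathcal{C})$ be a canonical Hadamard triple. Let (P) be the assertion: there are infinitely many primitively spectral integer eigenvalues $t\in\mathbb{N}$ of $(\mu_{b,\mathcal{D}},\Lambda(b,\mathcal{C}))$. Then the following hold. (i) If Artin's conjecture holds and $b$ is not a perfect square, then (P) is true. (ii) If Artin's conjecture holds and $2^k\#\mathcal{C}\le b=\alpha^{2^k}$ for some integer $k\ge 0$ and some integer $\alpha>1$ that is not a perfect square, then (P) is true. (iii) If $b-1\notin\mathcal{C}+\mathcal{C}$, then (P) is true. (iv) If $p^{\ell_b(p)}$ is a spectral eigenvalue of $(\mu_{b,\mathcal{D}},\Lambda(b,\mathcal{C}))$ for some prime $p$ with $\gcd(p,b)=1$ and $p>(b-1)(b-\#\mathcal{C})$, then (P) is true.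
   Context: $\mathbb{N}=\{1,2,\ldots\}$. For an integer $b>2$ and finite sets $\mathcal{D},\mathcal{C}\subset\mathbb{Z}$ with $\#\mathcal{D}=\#\mathcal{C}$ and $0\in\mathcal{C}$, $(b,\mathcal{D},\mathcal{C})$ is an integral Hadamard triple if the matrix $\frac{1}{\sqrt{\#\mathcal{D}}}\left[e^{-2\pi i cd/b}\right]_{d\in\mathcal{D},c\in\mathcal{C}}$ is unitary. It is a canonical Hadamard triple if moreover $b>\#\mathcal{D}$, $0\in\mathcal{D}$, $\gcd(\mathcal{D})=1$ and $0\in\mathcal{C}\subset\{0,1,\ldots,b-2\}$. $\mu_{b,\mathcal{D}}$ is the unique Borel probability measure on $\mathbb{R}$ with $\mu_{b,\mathcal{D}}(E)=\frac{1}{\#\mathcal{D}}\sum_{d\in\mathcal{D}}\mu_{b,\mathcal{D}}(\phi_d^{-1}(E))$ for all Borel $E$, where $\phi_d(x)=\frac{1}{b}(x+d)$. $\Lambda(b,\mathcal{C})=\bigcup_{k=1}^\infty(\mathcal{C}+b\mathcal{C}+\cdots+b^{k-1}\mathcal{C})$. A countable set $\Lambda\subset\mathbb{R}$ is a spectrum of $\mu$ if $\{e^{-2\pi i\lambda x}:\lambda\in\Lambda\}$ is an orthonormal basis of $L^2(\mu)$. $t\in\mathbb{N}$ is a spectral (integer) eigenvalue of $(\mu_{b,\mathcal{D}},\Lambda(b,\mathcal{C}))$ if $t\Lambda(b,\mathcal{C})$ is a spectrum of $\mu_{b,\mathcal{D}}$; it is a primitively spectral integer eigenvalue if it is a spectral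 eigenvalue and $\gcd(t,b)=1$. For $t\in\mathbb{N}$ with $\gcd(t,b)=1$: $O_b(t)=\min\{k\ge1: b^k\equiv1\pmod t\}$ and $\ell_b(t)=\max\{k\ge1: t^k\mid(b^{O_b(t)}-1)\}$. Artin's conjecture is the statement: for every integer $a>1$ that is not a perfect square there are infinitely many primes $p$ for which $a$ is a primitive root, i.e. $O_a(p)=p-1$. $\mathcal{C}+\mathcal{C}=\{c+c':c,c'\in\mathcal{C}\}$. *)

theory Defs
  imports
    "HOL-Probability.Probability"
    "HOL-Number_Theory.Number_Theory"
    "HOL-Computational_Algebra.Nth_Powers"
    "HOL-Library.Set_Algebras"
begin

definition unitary_matrix :: "'i set \<Rightarrow> 'j set \<Rightarrow> ('i \<Rightarrow> 'j \<Rightarrow> complex) \<Rightarrow> bool" where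
  "unitary_matrix I J H \<longleftrightarrow>
     (\<forall>j\<in>J. \<forall>j'\<in>J. (\<Sum>i\<in>I. cnj (H i j) * H i j') = of_bool (j = j')) \<and>
     (\<forall>i\<in>I. \<forall>i'\<in>I. (\<Sum>j\<in>J. H i j * cnj (H i' j)) = of_bool (i = i'))"

definition integral_hadamard_triple :: "nat \<Rightarrow> int set \<Rightarrow> int set \<Rightarrow> bool" where
  "integral_hadamard_triple b D C \<longleftrightarrow>
     b > 2 \<and> finite D \<and> finite C \<and> card D = card C \<and> 0 \<in> C \<and>
     unitary_matrix D C
       (\<lambda>d c. 1 / complex_of_real (sqrt (card D)) *
              exp (- 2 * complex_of_real pi * \<i> * of_int (c * d) / of_nat b))"

definition canonical_hadamard_triple :: "nat \<Rightarrow> int set \<Rightarrow> int set \<Rightarrow> bool" where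
  "canonical_hadamard_triple b D C \<longleftrightarrow>
     integral_hadamard_triple b D C \<and> b > card D \<and> 0 \<in> D \<and> Gcd D = 1 \<and>
     0 \<in> C \<and> C \<subseteq> {0..int b - 2}"

definition ifs_map :: "nat \<Rightarrow> int \<Rightarrow> real \<Rightarrow> real" where
  "ifs_map b d x = (x + of_int d) / of_nat b"

text \<open>
  The invariance equation has exactly one Borel probability solution whenever \<open>b > 1\<close> and \<open>D\<close>
  is finite and nonempty (Hutchinson), so the description below is proper for Hadamard triples.
\<close>

definition self_similar_measure :: "nat \<Rightarrow> int set \<Rightarrow> real measure" where
  "self_similar_measure b D =
     (THE \<mu>. prob_space \<mu> \<and> sets \<mu> = sets borel \<and>
        (\<forall>E\<in>sets borel.
           measure \<mu> E = 1 / real (card D) * (\<Sum>d\<in>D. measure \<mu> (ifs_map b d -` E))))"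

definition Lambda :: "nat \<Rightarrow> int set \<Rightarrow> int set" where
  "Lambda b C = (\<Union>k\<in>{1..}. \<Sum>j<k. (int b ^ j) *o C)"

text \<open>
  The complex Hilbert space \<open>L\<^sup>2(M)\<close> is represented by square-integrable functions, without
  passing to the quotient by almost-everywhere equality.
\<close>

definition square_integrable :: "'a measure \<Rightarrow> ('a \<Rightarrow> complex) \<Rightarrow> bool" where
  "square_integrable M f \<longleftrightarrow>
     f \<in> borel_measurable M \<and> integrable M (\<lambda>x. (norm (f x))\<^sup>2)"

definition L2_inner :: "'a measure \<Rightarrow> ('a \<Rightarrow> complex) \<Rightarrow> ('a \<Rightarrow> complex) \<Rightarrow> complex" where
  "L2_inner M f g = (\<integral>x. f x * cnj (g x) \<partial>M)"

definition L2_norm :: "'a measure \<Rightarrow> ('a \<Rightarrow> complex) \<Rightarrow> real" where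
  "L2_norm M f = sqrt (\<integral>x. (norm (f x))\<^sup>2 \<partial>M)"

text \<open>
  An orthonormal basis is an orthonormal family whose finite linear combinations are dense.
\<close>

definition L2_orthonormal_basis :: "'a measure \<Rightarrow> 'i set \<Rightarrow> ('i \<Rightarrow> 'a \<Rightarrow> complex) \<Rightarrow> bool" where
  "L2_orthonormal_basis M I e \<longleftrightarrow>
     (\<forall>i\<in>I. square_integrable M (e i)) \<and>
     (\<forall>i\<in>I. \<forall>j\<in>I. L2_inner M (e i) (e j) = of_bool (i = j)) \<and>
     (\<forall>f. square_integrable M f \<longrightarrow>
        (\<forall>\<epsilon>>0. \<exists>F a. finite F \<and> F \<subseteq> I \<and>
           L2_norm M (\<lambda>x. f x - (\<Sum>i\<in>F. a i * e i x)) < \<epsilon>))"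

definition is_spectrum :: "real measure \<Rightarrow> real set \<Rightarrow> bool" where
  "is_spectrum \<mu> \<Lambda> \<longleftrightarrow>
     countable \<Lambda> \<and>
     L2_orthonormal_basis \<mu> \<Lambda>
       (\<lambda>l x. exp (- 2 * complex_of_real pi * \<i> * complex_of_real (l * x)))"

definition spectral_eigenvalue :: "nat \<Rightarrow> int set \<Rightarrow> int set \<Rightarrow> nat \<Rightarrow> bool" where
  "spectral_eigenvalue b D C t \<longleftrightarrow>
     t \<ge> 1 \<and> is_spectrum (self_similar_measure b D) ((\<lambda>s. real t * real_of_int s) ` Lambda b C)"

definition primitively_spectral_eigenvalue :: "nat \<Rightarrow> int set \<Rightarrow> int set \<Rightarrow> nat \<Rightarrow> bool" where
  "primitively_spectral_eigenvalue b D C t \<longleftrightarrow> spectral_eigenvalue b D C t \<and> gcd t b = 1"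

text \<open>
  For coprime \<open>t\<close> and \<open>b\<close>, \<open>ord t b\<close> is the multiplicative order of \<open>b\<close> modulo \<open>t\<close>, i.e.
  \<open>O\<^sub>b(t)\<close>. The maximum below exists only for \<open>t > 1\<close> coprime to \<open>b > 1\<close>; the value is
  unspecified otherwise.
\<close>

definition ell :: "nat \<Rightarrow> nat \<Rightarrow> nat" where
  "ell b t = Max {k. k \<ge> 1 \<and> t ^ k dvd b ^ ord t b - 1}"

definition artin_conjecture :: bool where
  "artin_conjecture \<longleftrightarrow>
     (\<forall>a::nat. a > 1 \<and> \<not> is_square a \<longrightarrow>
        infinite {p::nat. prime p \<and> coprime p a \<and> ord p a = p - 1})"

end

theory Submission
  imports Defs "HOL-Complex_Analysis.Conformal_Mappings"
begin

text \<open>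
  Let \<open>m\<close> be the mask polynomial of \<open>D\<close>, so that the Fourier transform of the measure satisfies
  \<open>F(x) = m(x/b) F(x/b)\<close>. If \<open>t\<close> is coprime to \<open>b\<close>, then \<open>(b, D, tC)\<close> is again a Hadamard triple,
  because its orthogonality relations are Galois conjugate to those of \<open>(b, D, C)\<close>. Hence the
  exponentials with frequencies in \<open>t\<Lambda>\<close> are orthonormal, and they form a basis if and only if the sum
  of all \<open>|F(x + t\<lambda>)|\<^sup>2\<close> equals \<open>1\<close> for every \<open>x\<close>. If this fails, the minimum of that sum is attained
  on a finite set which the weighted branches \<open>x \<mapsto> (x + tc)/b\<close> preserve and which consists of cycles of
  nonzero integers; conversely such a cycle yields an exponential orthogonal to the whole family.
  So \<open>t\<close> is a spectral eigenvalue if and only if no such cycle exists.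

  A cycle lies strictly between \<open>0\<close> and \<open>t\<close>, at most at \<open>t(b-2)/(b-1)\<close>, and is closed under
  multiplication by \<open>b\<close> modulo \<open>t\<close>. This excludes cycles by counting residues when \<open>t\<close> is a large
  prime for which \<open>b\<close> has large order; for \<open>t = b\<^sup>n + 1\<close>, where \<open>x\<close> and \<open>t - x\<close> lie on the same cycle
  and their digits add up to \<open>b - 1\<close>; and for powers of a prime \<open>p\<close> beyond \<open>p\<^bsup>ell b p\<^esup>\<close>, where a cycle
  either contains a full residue class modulo \<open>p\<^bsup>ell b p\<^esup>\<close> or comes from a cycle for \<open>p\<^bsup>ell b p\<^esup>\<close>.
\<close>

section \<open>Galois conjugation of vanishing sums of roots of unity\<close>

text \<open>Galois conjugation is obtained from Frobenius alone. In the ring Z[z], for z a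
  \<open>b\<close>-th root of unity, the p-th power of a sum of powers of z is congruent modulo p to
  its conjugate. Only finitely many conjugates exist and a nonzero one is divisible by boundedly
  many primes, so a vanishing sum has vanishing conjugates under all large primes; \<open>t\<close>
  is reached by a congruent number all of whose prime factors are large.

  The set of minima is finite because the mask extends to an entire function. Its points are
  integers because a single branch carries the whole weight 1, so the mask has modulus 1 there, and
  gcd(D) = 1 turns this into integrality.

  On the arithmetic side the missing digit b - 1 matters: it leaves a gap of length about t/(b-1)
  below \<open>t\<close> that no cycle enters. A set closed under multiplication by \<open>b\<close>
  modulo \<open>t\<close> can hardly avoid this gap when the orbits of \<open>b\<close> are large,
  and both the residue count and the prime power argument exploit this.\<close>

inductive_set int_span_powers :: "complex \<Rightarrow> complex set" for z :: complex where
  zero: "0 \<in> int_span_powers z"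
| add_power: "x \<in> int_span_powers z \<Longrightarrow> x + z ^ k \<in> int_span_powers z"
| diff_power: "x \<in> int_span_powers z \<Longrightarrow> x - z ^ k \<in> int_span_powers z"

lemma int_span_powers_add:
  assumes "x \<in> int_span_powers z" "y \<in> int_span_powers z"
  shows "x + y \<in> int_span_powers z"
  using assms(2)
proof induction
  case zero
  then show ?case using assms by simp
next
  case (add_power y k)
  then show ?case using int_span_powers.add_power[of "x + y" z k] by (simp add: add.assoc)
next
  case (diff_power y k)
  then show ?case using int_span_powers.diff_power[of "x + y" z k] by (simp add: algebra_simps)
qed

lemma int_span_powers_minus:
  assumes "x \<in> int_span_powers z"
  shows "- x \<in> int_span_powers z"
  using assms
proof induction
  case zero
  then show ?case by (simp add: int_span_powers.zero)
next
  case (add_power y k)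
  then show ?case using int_span_powers.diff_power[of "- y" z k] by simp
next
  case (diff_power y k)
  then show ?case using int_span_powers.add_power[of "- y" z k] by simp
qed

lemma int_span_powers_mult_power:
  assumes "x \<in> int_span_powers z"
  shows "x * z ^ n \<in> int_span_powers z"
  using assms
proof induction
  case zero
  then show ?case by (simp add: int_span_powers.zero)
next
  case (add_power y k)
  then show ?case using int_span_powers.add_power[of "y * z ^ n" z "k + n"]
    by (simp add: algebra_simps power_add)
next
  case (diff_power y k)
  then show ?case using int_span_powers.diff_power[of "y * z ^ n" z "k + n"]
    by (simp add: algebra_simps power_add)
qed

lemma int_span_powers_mult:
  assumes "x \<in> int_span_powers z" "y \<in> int_span_powers z"
  shows "x * y \<in> int_span_powers z"
  using assms(2)
proof induction
  case zero
  then show ?case by (simp add: int_span_powers.zero)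
next
  case (add_power y k)
  then show ?case
    by (simp add: distrib_left int_span_powers_add int_span_powers_mult_power assms(1))
next
  case (diff_power y k)
  have "x * y + - (x * z ^ k) \<in> int_span_powers z"
    by (intro int_span_powers_add int_span_powers_minus int_span_powers_mult_power diff_power assms(1))
  then show ?case by (simp add: algebra_simps)
qed

lemma power_in_int_span_powers: "z ^ k \<in> int_span_powers z"
  using int_span_powers.add_power[OF int_span_powers.zero, of z k] by simp

lemma int_span_powers_power: "x \<in> int_span_powers z \<Longrightarrow> x ^ n \<in> int_span_powers z"
  by (induction n) (use power_in_int_span_powers[of z 0] in \<open>auto intro: int_span_powers_mult\<close>)

lemma int_span_powers_of_nat: "of_nat n \<in> int_span_powers z"
  by (induction n)
    (use power_in_int_span_powers[of z 0] in \<open>auto intro: int_span_powers_add int_span_powers.zero\<close>)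

lemma int_span_powers_sum:
  "(\<And>a. a \<in> A \<Longrightarrow> f a \<in> int_span_powers z) \<Longrightarrow> (\<Sum>a\<in>A. f a) \<in> int_span_powers z"
  by (induction A rule: infinite_finite_induct)
    (auto intro: int_span_powers_add int_span_powers.zero)

text \<open>The inner binomial coefficients are divisible by \<open>p\<close>; \<open>r\<close>
  collects their quotients. An explicit quotient takes the place of a congruence in Z[z] modulo
  \<open>p\<close>.\<close>

lemma frobenius_add_int_span_powers:
  assumes "prime p" "x \<in> int_span_powers z" "y \<in> int_span_powers z"
  shows "\<exists>r\<in>int_span_powers z. (x + y) ^ p = x ^ p + y ^ p + of_nat p * r"
proof -
  have p: "p > 1" using assms(1) prime_gt_1_nat by blast
  define r where "r = (\<Sum>k\<in>{1..<p}. of_nat ((p choose k) div p) * x ^ k * y ^ (p - k))"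
  have r: "r \<in> int_span_powers z"
    unfolding r_def
    by (intro int_span_powers_sum int_span_powers_mult int_span_powers_of_nat int_span_powers_power assms)
  have "(x + y) ^ p = (\<Sum>k\<in>{..p}. of_nat (p choose k) * x ^ k * y ^ (p - k))"
    by (rule binomial_ring)
  also have "{..p} = insert 0 (insert p {1..<p})" using p by auto
  also have "(\<Sum>k\<in>\<dots>. of_nat (p choose k) * x ^ k * y ^ (p - k)) =
      y ^ p + (x ^ p + (\<Sum>k\<in>{1..<p}. of_nat (p choose k) * x ^ k * y ^ (p - k)))"
    using p by simp
  also have "(\<Sum>k\<in>{1..<p}. of_nat (p choose k) * x ^ k * y ^ (p - k)) = of_nat p * r"
    unfolding r_def sum_distrib_left
  proof (rule sum.cong)
    fix k assume k: "k \<in> {1..<p}"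
    have "p dvd (p choose k)" using k assms(1) by (intro dvd_choose_prime) auto
    then have "(of_nat (p choose k) :: complex) = of_nat p * of_nat ((p choose k) div p)"
      by (metis dvd_mult_div_cancel of_nat_mult)
    then show "of_nat (p choose k) * x ^ k * y ^ (p - k) =
        of_nat p * (of_nat ((p choose k) div p) * x ^ k * y ^ (p - k))" by simp
  qed simp
  finally show ?thesis using r by (intro bexI[of _ r]) (simp_all add: algebra_simps)
qed

lemma frobenius_sum_int_span_powers:
  assumes "prime p" "finite A" "\<And>a. a \<in> A \<Longrightarrow> f a \<in> int_span_powers z"
  shows "\<exists>r\<in>int_span_powers z. (\<Sum>a\<in>A. f a) ^ p = (\<Sum>a\<in>A. f a ^ p) + of_nat p * r"
  using assms(2,3)
proof (induction A rule: finite_induct)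
  case empty
  then show ?case
    using assms(1) prime_gt_0_nat[of p]
    by (intro bexI[of _ 0]) (auto simp: int_span_powers.zero)
next
  case (insert a A)
  obtain r where r: "r \<in> int_span_powers z" "(\<Sum>a\<in>A. f a) ^ p = (\<Sum>a\<in>A. f a ^ p) + of_nat p * r"
    using insert by auto
  obtain s where s: "s \<in> int_span_powers z"
      "(f a + (\<Sum>a\<in>A. f a)) ^ p = f a ^ p + (\<Sum>a\<in>A. f a) ^ p + of_nat p * s"
    using frobenius_add_int_span_powers[OF assms(1), of "f a" z "\<Sum>a\<in>A. f a"] insert
    by (auto intro: int_span_powers_sum)
  show ?case
    using insert r s by (intro bexI[of _ "r + s"] int_span_powers_add) (auto simp: algebra_simps)
qed

text \<open>The complex numbers are regarded as a rational vector space, where the independent set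
  \<open>{s}\<close> extends to a basis. The functional will measure how far \<open>s\<close> can be
  divided by integers inside Z[z].\<close>

lemma rational_functional_exists:
  assumes "s \<noteq> (0 :: complex)"
  shows "\<exists>\<phi> :: complex \<Rightarrow> rat. (\<forall>x y. \<phi> (x + y) = \<phi> x + \<phi> y) \<and>
           (\<forall>q x. \<phi> (of_rat q * x) = q * \<phi> x) \<and> \<phi> s = 1"
proof -
  interpret vp: vector_space_pair "\<lambda>q z. of_rat q * z :: complex" "\<lambda>q r. q * r :: rat"
    by unfold_locales (auto simp: algebra_simps of_rat_add of_rat_mult)
  have "vp.vs1.independent {s}" using assms by simp
  then obtain \<phi> where lin: "Vector_Spaces.linear (\<lambda>q z. of_rat q * z) (\<lambda>q r. q * r) \<phi>"
      and s: "\<phi> s = (1::rat)"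
    using vp.linear_independent_extend[of "{s}" "\<lambda>_. 1"] by auto
  interpret Vector_Spaces.linear "\<lambda>q z. of_rat q * z :: complex" "\<lambda>q r. q * r :: rat" \<phi>
    by (rule lin)
  show ?thesis
    using add scale s by blast
qed

text \<open>A rational functional is \<open>1\<close> at \<open>s\<close> and has bounded denominators on the integral span
  of the powers of a root of unity.\<close>

lemma prime_divisors_bounded_int_span_powers:
  assumes "z ^ b = 1" "b > 0" "s \<noteq> (0 :: complex)"
  shows "\<exists>M. \<forall>p r. prime p \<longrightarrow> r \<in> int_span_powers z \<longrightarrow> s = of_nat p * r \<longrightarrow> p \<le> M"
proof -
  obtain \<phi> :: "complex \<Rightarrow> rat" where
    add: "\<And>x y. \<phi> (x + y) = \<phi> x + \<phi> y" and scale: "\<And>q x. \<phi> (of_rat q * x) = q * \<phi> x" and s: "\<phi> s = 1"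
    using rational_functional_exists[OF assms(3)] by blast
  have phi0: "\<phi> 0 = 0" using add[of 0 0] by simp
  have phi_minus: "\<phi> (- x) = - \<phi> x" for x using add[of x "- x"] phi0 by simp
  define den where "den k = snd (quotient_of (\<phi> (z ^ k)))" for k
  have den_pos: "den k > 0" for k unfolding den_def by (rule quotient_of_denom_pos')
  have den_int: "of_int (den k) * \<phi> (z ^ k) \<in> \<int>" for k
  proof -
    have "\<phi> (z ^ k) = of_int (fst (quotient_of (\<phi> (z ^ k)))) / of_int (den k)"
      unfolding den_def by (rule quotient_of_div) simp
    then have "of_int (den k) * \<phi> (z ^ k) = of_int (fst (quotient_of (\<phi> (z ^ k))))"
      using den_pos[of k] by (metis less_irrefl nonzero_mult_div_cancel_left of_int_0_eq_iff times_divide_eq_right)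
    then show ?thesis by simp
  qed
  \<comment> \<open>The powers of \<open>z\<close> repeat with period \<open>b\<close>, so a product
    of \<open>b\<close> denominators clears the functional on all of Z[z].\<close>
  define M where "M = (\<Prod>k<b. den k)"
  have M: "M > 0" unfolding M_def using den_pos by (intro prod_pos) auto
  have Mk: "of_int M * \<phi> (z ^ k) \<in> \<int>" for k
  proof -
    have "z ^ k = z ^ (b * (k div b) + k mod b)" by simp
    also have "\<dots> = z ^ (k mod b)" unfolding power_add power_mult assms(1) by simp
    finally have zk: "z ^ k = z ^ (k mod b)" .
    have "k mod b \<in> {..<b}" using assms(2) by simp
    then have "M = den (k mod b) * (\<Prod>j\<in>{..<b} - {k mod b}. den j)"
      unfolding M_def by (intro prod.remove) auto
    then have "of_int M * \<phi> (z ^ k) =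
        of_int (\<Prod>j\<in>{..<b} - {k mod b}. den j) * (of_int (den (k mod b)) * \<phi> (z ^ (k mod b)))"
      unfolding zk by simp
    then show ?thesis using den_int Ints_mult Ints_of_int by metis
  qed
  have int: "of_int M * \<phi> r \<in> \<int>" if "r \<in> int_span_powers z" for r
    using that
  proof induction
    case zero
    then show ?case by (simp add: phi0)
  next
    case (add_power x k)
    then show ?case using Mk by (simp add: add distrib_left)
  next
    case (diff_power x k)
    have "\<phi> (x - z ^ k) = \<phi> x - \<phi> (z ^ k)" using add[of x "- (z ^ k)"] phi_minus by simp
    then show ?case using diff_power Mk by (simp add: right_diff_distrib)
  qed
  show ?thesis
  proof (intro exI[of _ "nat M"] allI impI)
    fix p r assume p: "prime p" and r: "r \<in> int_span_powers z" and eq: "s = of_nat p * r"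
    \<comment> \<open>Applying the functional to \<open>s = of_nat p * r\<close> and multiplying by
      \<open>M\<close> writes \<open>M\<close> as \<open>p\<close> times an integer, so
      \<open>p\<close> divides the fixed number \<open>M\<close>.\<close>
    have "1 = of_nat p * \<phi> r" using scale[of "of_nat p" r] s eq by simp
    moreover obtain n where "of_int M * \<phi> r = of_int n" using int[OF r] by (auto elim: Ints_cases)
    ultimately have "rat_of_int M = of_int (int p * n)"
      by (simp, metis (no_types, lifting) mult.commute mult.left_commute mult_1)
    then have "M = int p * n" by (simp only: of_int_eq_iff)
    then have "int p dvd M" by simp
    then show "p \<le> nat M" using M zdvd_imp_le by fastforce
  qed
qed

text \<open>Chinese remainders prescribe \<open>t\<close> modulo \<open>b\<close> and 1 modulo the
  product of the small primes outside \<open>b\<close>. A small prime dividing \<open>b\<close> is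
  excluded because it would divide \<open>t\<close> as well.\<close>

lemma coprime_large_representative:
  fixes t b M :: nat
  assumes "coprime t b"
  shows "\<exists>t'. [t' = t] (mod b) \<and> (\<forall>p. prime p \<longrightarrow> p dvd t' \<longrightarrow> p > M)"
proof -
  define P where "P = (\<Prod>p\<in>{p. prime p \<and> p \<le> M \<and> \<not> p dvd b}. p)"
  have fin: "finite {p. prime p \<and> p \<le> M \<and> \<not> p dvd b}" by (rule finite_subset[of _ "{..M}"]) auto
  have "coprime b P"
    unfolding P_def by (rule prod_coprime_right) (auto simp: prime_imp_coprime coprime_commute)
  then obtain x where x: "[x = t] (mod b)" "[x = 1] (mod P)"
    using binary_chinese_remainder_nat by blast
  show ?thesis
  proof (intro exI conjI allI impI)
    show "[x = t] (mod b)" by (rule x)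
    fix p assume p: "prime p" "p dvd x"
    show "p > M"
    proof (rule ccontr)
      assume "\<not> p > M"
      show False
      proof (cases "p dvd b")
        case True
        then have "[x = t] (mod p)" using x(1) cong_dvd_modulus_nat by blast
        then have "p dvd t" using p(2) cong_dvd_iff by blast
        then show False using True assms p(1) by (meson coprime_common_divisor not_prime_unit)
      next
        case False
        then have "p dvd P" unfolding P_def using p \<open>\<not> p > M\<close> fin by (intro dvd_prodI) auto
        then have "[x = 1] (mod p)" using x(2) cong_dvd_modulus_nat by blast
        then have "p dvd 1" using p(2) cong_dvd_iff by blast
        then show False using p(1) by (meson not_prime_unit)
      qed
    qed
  qed
qed

text \<open>The value \<open>S r\<close> depends only on \<open>r\<close> modulo \<open>b\<close>.
  If \<open>S n = 0\<close>, Frobenius puts \<open>S (p * n)\<close> into p Z[z], and a prime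
  \<open>p\<close> above all bounds \<open>M r\<close> leaves only the value 0. Starting from
  \<open>S 1\<close>, such steps multiply up the prime factors of \<open>t'\<close>.\<close>

lemma sum_powers_root_of_unity_conjugate:
  fixes z :: complex and h :: "'a \<Rightarrow> nat"
  assumes "z ^ b = 1" "b > 0" "finite A" "(\<Sum>a\<in>A. z ^ h a) = 0" "coprime t b"
  shows "(\<Sum>a\<in>A. z ^ (t * h a)) = 0"
proof -
  define S where "S r = (\<Sum>a\<in>A. z ^ (r * h a))" for r
  have pow_cong: "z ^ k = z ^ (k mod b)" for k
  proof -
    have "z ^ k = z ^ (b * (k div b) + k mod b)" by simp
    also have "\<dots> = z ^ (k mod b)" unfolding power_add power_mult assms(1) by simp
    finally show ?thesis .
  qed
  have S_cong: "S r = S r'" if "[r = r'] (mod b)" for r r'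
  proof -
    have "z ^ (r * k) = z ^ (r' * k)" for k
      using that pow_cong[of "r * k"] pow_cong[of "r' * k"] cong_scalar_right[OF that, of k]
      by (simp add: cong_def)
    then show ?thesis by (simp add: S_def)
  qed
  have "\<forall>r. \<exists>M. S r \<noteq> 0 \<longrightarrow> (\<forall>p x. prime p \<longrightarrow> x \<in> int_span_powers z \<longrightarrow> S r = of_nat p * x \<longrightarrow> p \<le> M)"
    using prime_divisors_bounded_int_span_powers[OF assms(1,2)] by metis
  then obtain M where M: "\<And>r p x. S r \<noteq> 0 \<Longrightarrow> prime p \<Longrightarrow> x \<in> int_span_powers z \<Longrightarrow>
      S r = of_nat p * x \<Longrightarrow> p \<le> M r" by metis
  \<comment> \<open>The sum dominates every \<open>M r\<close> with \<open>r < b\<close>. The added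
    2 excludes \<open>t' = 0\<close>, which is divisible by the prime 2.\<close>
  define M' where "M' = (\<Sum>r<b. M r) + 2"
  have step: "S (p * n) = 0" if n: "S n = 0" and p: "prime p" "p > M'" for n p
  proof (rule ccontr)
    assume nz: "S (p * n) \<noteq> 0"
    define r where "r = (p * n) mod b"
    have Sr: "S (p * n) = S r" unfolding r_def by (rule S_cong) simp
    obtain x where x: "x \<in> int_span_powers z"
        "(\<Sum>a\<in>A. z ^ (n * h a)) ^ p = (\<Sum>a\<in>A. (z ^ (n * h a)) ^ p) + of_nat p * x"
      using frobenius_sum_int_span_powers[OF p(1) assms(3), of "\<lambda>a. z ^ (n * h a)" z]
        power_in_int_span_powers by blast
    have "S n ^ p = S (p * n) + of_nat p * x"
      using x(2) unfolding S_def by (simp add: power_mult[symmetric] mult_ac)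
    then have "S r = of_nat p * (- x)"
      using n p(1) prime_gt_0_nat[of p] Sr by (simp add: zero_power eq_neg_iff_add_eq_0)
    then have "p \<le> M r" using M[of r p "- x"] nz Sr p(1) int_span_powers_minus[OF x(1)] by auto
    also have "M r \<le> (\<Sum>r<b. M r)" using assms(2) by (intro member_le_sum) (auto simp: r_def)
    finally show False using p(2) by (simp add: M'_def)
  qed
  obtain t' where t': "[t' = t] (mod b)" "\<And>p. prime p \<Longrightarrow> p dvd t' \<Longrightarrow> p > M'"
    using coprime_large_representative[OF assms(5)] by blast
  have "S t' = 0" if "\<And>p. prime p \<Longrightarrow> p dvd t' \<Longrightarrow> p > M'" for t'
    using that
  proof (induction t' rule: less_induct)
    case (less t')
    have S1: "S 1 = 0" using assms(4) by (simp add: S_def)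
    show ?case
    proof (cases "t' = 1")
      case True
      then show ?thesis using S1 by simp
    next
      case False
      then obtain p where p: "prime p" "p dvd t'" using prime_factor_nat by blast
      then obtain n where n: "t' = p * n" by blast
      have "t' \<noteq> 0"
        using less.prems[OF two_is_prime_nat] by (cases "t' = 0") (auto simp: M'_def)
      then have "n < t'" using n p(1) prime_gt_1_nat[of p] by auto
      then have "S n = 0" using less n by (metis dvd_mult)
      then show ?thesis using step[of n p] less.prems p n by auto
    qed
  qed
  then have "S t' = 0" using t'(2) by blast
  then show ?thesis using S_cong[OF t'(1)] by (simp add: S_def)
qed

section \<open>Integer cycles\<close>

text \<open>A cycle through nonzero integers of the maps \<open>x \<mapsto> (x + t c) / b\<close> with \<open>c \<in> C\<close>, or a finite
  union of such cycles: the successor function \<open>f\<close> permutes \<open>X\<close>.\<close>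

definition integer_cycle :: "nat \<Rightarrow> int set \<Rightarrow> nat \<Rightarrow> int set \<Rightarrow> (int \<Rightarrow> int) \<Rightarrow> bool" where
  "integer_cycle b C t X f \<longleftrightarrow> finite X \<and> X \<noteq> {} \<and> 0 \<notin> X \<and> f ` X = X \<and>
     (\<forall>x\<in>X. \<exists>c\<in>C. int b * f x = x + int t * c)"

context
  fixes b t :: nat and C X :: "int set" and f :: "int \<Rightarrow> int"
  assumes b: "b > 2" and C: "C \<subseteq> {0..int b - 2}" and cyc: "integer_cycle b C t X f"
begin

lemma integer_cycle_pred: "y \<in> X \<Longrightarrow> \<exists>x\<in>X. \<exists>c\<in>C. int b * y = x + int t * c"
  using cyc unfolding integer_cycle_def by (metis imageE)

text \<open>The predecessor of the least element is not smaller and digits are nonnegative, so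
  \<open>int b * Min X \<ge> Min X\<close>. This excludes negative elements, and 0 is excluded by
  definition.\<close>

lemma integer_cycle_pos:
  assumes "x \<in> X"
  shows "x > 0"
proof -
  have fin: "finite X" "X \<noteq> {}" and nz: "0 \<notin> X" using cyc by (auto simp: integer_cycle_def)
  obtain y c where y: "y \<in> X" "c \<in> C" "int b * Min X = y + int t * c"
    using integer_cycle_pred[of "Min X"] fin by auto
  have "Min X \<le> y" "int t * c \<ge> 0" using y fin C by auto
  then have "(int b - 1) * Min X \<ge> 0" using y(3) by (simp add: algebra_simps)
  then have "Min X \<ge> 0" using b by (simp add: zero_le_mult_iff)
  then show ?thesis using nz assms fin Min_le[of X x] Min_in[of X] by (metis dual_order.trans order_le_less)
qed

text \<open>The same comparison at the greatest element, now with digits at most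
  \<open>b - 2\<close>.\<close>

lemma integer_cycle_upper:
  assumes "x \<in> X"
  shows "(int b - 1) * x \<le> (int b - 2) * int t"
proof -
  have fin: "finite X" "X \<noteq> {}" using cyc by (auto simp: integer_cycle_def)
  obtain y c where y: "y \<in> X" "c \<in> C" "int b * Max X = y + int t * c"
    using integer_cycle_pred[of "Max X"] fin by auto
  have "y \<le> Max X" using y fin by auto
  moreover have "int t * c \<le> int t * (int b - 2)" using y C by (intro mult_left_mono) auto
  ultimately have *: "(int b - 1) * Max X \<le> (int b - 2) * int t" using y(3) by (simp add: algebra_simps)
  have "(int b - 1) * x \<le> (int b - 1) * Max X" using fin assms b by (intro mult_left_mono) auto
  then show ?thesis using * by linarith
qed

lemma integer_cycle_less:
  assumes "x \<in> X"
  shows "x < int t"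
proof (rule ccontr)
  assume "\<not> x < int t"
  then have "int t * (int b - 1) \<le> x * (int b - 1)" using b by (intro mult_right_mono) auto
  then have "int t * (int b - 1) \<le> (int b - 2) * int t"
    using integer_cycle_upper[OF assms] by (simp add: mult.commute)
  then have "int t \<le> 0" by (simp add: algebra_simps)
  then show False using integer_cycle_upper[OF assms] integer_cycle_pos[OF assms] b
    by (auto simp: mult_le_0_iff)
qed

text \<open>Modulo \<open>t\<close>, multiplication by \<open>b\<close> inverts \<open>f\<close>: it
  leads from a point to a predecessor. Since elements of \<open>X\<close> lie strictly between 0 and
  \<open>t\<close>, the residue is the predecessor itself.\<close>

lemma integer_cycle_mult_mod:
  assumes "x \<in> X"
  shows "(int b ^ n * x) mod int t \<in> X"
proof (induction n)
  case 0
  then show ?case using assms integer_cycle_pos[OF assms] integer_cycle_less[OF assms] by simp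
next
  case (Suc n)
  obtain y c where y: "y \<in> X" "int b * ((int b ^ n * x) mod int t) = y + int t * c"
    using integer_cycle_pred[OF Suc] by blast
  have "(int b ^ Suc n * x) mod int t = (int b * ((int b ^ n * x) mod int t)) mod int t"
    by (simp add: mod_mult_right_eq mult.assoc)
  also have "\<dots> = y mod int t" using y(2) by simp
  also have "\<dots> = y" using integer_cycle_pos[OF y(1)] integer_cycle_less[OF y(1)] by simp
  finally show ?case using y(1) by simp
qed

lemma integer_cycle_cong_mem:
  assumes "x \<in> X" "0 < z" "z < int t" "[z = int b ^ n * x] (mod int t)"
  shows "z \<in> X"
  using integer_cycle_mult_mod[OF assms(1), of n] assms(2-4) by (simp add: cong_def)

end

section \<open>Exclusion of cycles for large primes and for \<open>b ^ n + 1\<close>\<close>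

lemma card_residue_class_le:
  fixes B r :: int
  assumes "b > 0" "B \<ge> 0"
  shows "int (card {x\<in>{0<..B}. x mod int b = r}) \<le> B div int b + 1"
proof -
  have "inj_on (\<lambda>x. x div int b) {x\<in>{0<..B}. x mod int b = r}"
    by (rule inj_onI) (metis (mono_tags, lifting) mem_Collect_eq mult_div_mod_eq)
  moreover have "(\<lambda>x. x div int b) ` {x\<in>{0<..B}. x mod int b = r} \<subseteq> {0..B div int b}"
    using assms zdiv_mono1[of _ B "int b"] by (auto simp: pos_imp_zdiv_nonneg_iff)
  ultimately have "card {x\<in>{0<..B}. x mod int b = r} \<le> card {0..B div int b}"
    by (intro card_inj_on_le) auto
  also have "\<dots> = nat (B div int b + 1)" by simp
  finally show ?thesis using assms by (simp add: pos_imp_zdiv_nonneg_iff le_nat_iff)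
qed

text \<open>The cycle contains an orbit of multiplication by \<open>b\<close> modulo \<open>p\<close>, but its elements lie in
  few residue classes modulo \<open>b\<close>.\<close>

lemma no_integer_cycle_large_order:
  assumes b: "b > 2" and C: "C \<subseteq> {0..int b - 2}" "finite C"
    and p: "prime p" "coprime p b" "p > b\<^sup>2"
    and k: "p - 1 \<le> 2 ^ k * ord p b" "2 ^ k * card C \<le> b"
  shows "\<not> integer_cycle b C p X f"
proof
  assume cyc: "integer_cycle b C p X f"
  have fin: "finite X" using cyc by (simp add: integer_cycle_def)
  obtain x where x: "x \<in> X" using cyc by (auto simp: integer_cycle_def)
  note pos = integer_cycle_pos[OF b C(1) cyc] and less = integer_cycle_less[OF b C(1) cyc]
  have cop: "coprime x (int p)"
  proof -
    have "\<not> int p dvd x" using pos[OF x] less[OF x] zdvd_imp_le by fastforce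
    then show ?thesis using p(1) by (metis coprime_commute prime_imp_coprime prime_int_nat_transfer
          prime_nat_int_transfer)
  qed
  have "inj_on (\<lambda>i. (int b ^ i * x) mod int p) {..<ord p b}"
  proof (rule inj_onI)
    fix i j assume ij: "i \<in> {..<ord p b}" "j \<in> {..<ord p b}"
      and eq: "(int b ^ i * x) mod int p = (int b ^ j * x) mod int p"
    then have "[int b ^ i = int b ^ j] (mod int p)"
      using cop by (simp add: cong_def[symmetric] cong_mult_rcancel)
    then have "[b ^ i = b ^ j] (mod p)" by (metis cong_int_iff of_nat_power)
    then show "i = j" using inj_power_mod[OF p(2)] ij by (auto simp: inj_on_def cong_def)
  qed
  then have "card {..<ord p b} \<le> card X"
    using integer_cycle_mult_mod[OF b C(1) cyc x] fin by (intro card_inj_on_le) auto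
  then have ord: "ord p b \<le> card X" by simp
  \<comment> \<open>\<open>B\<close> is the integer part of the upper bound for elements of a
    cycle.\<close>
  define B where "B = ((int b - 2) * int p) div (int b - 1)"
  have B: "B \<ge> 0" unfolding B_def using b by (simp add: pos_imp_zdiv_nonneg_iff)
  \<comment> \<open>The step equation determines \<open>x\<close> modulo \<open>b\<close> from its
    digit, so at most \<open>card C\<close> residue classes occur.\<close>
  have "X \<subseteq> (\<Union>c\<in>C. {x\<in>{0<..B}. x mod int b = (- (int p * c)) mod int b})"
  proof
    fix x assume x: "x \<in> X"
    then obtain c where c: "c \<in> C" "int b * f x = x + int p * c"
      using cyc by (auto simp: integer_cycle_def)
    have "x * (int b - 1) \<le> (int b - 2) * int p"
      using integer_cycle_upper[OF b C(1) cyc x] by (simp add: mult.commute)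
    then have "x \<le> B" unfolding B_def using b zdiv_mono1[of "x * (int b - 1)" _ "int b - 1"] by simp
    moreover have "x = - (int p * c) + int b * f x" using c(2) by simp
    then have "x mod int b = (- (int p * c)) mod int b" by (metis mod_mult_self2)
    ultimately show "x \<in> (\<Union>c\<in>C. {x\<in>{0<..B}. x mod int b = (- (int p * c)) mod int b})"
      using c(1) pos[OF x] by auto
  qed
  then have "card X \<le> card (\<Union>c\<in>C. {x\<in>{0<..B}. x mod int b = (- (int p * c)) mod int b})"
    using C(2) by (intro card_mono finite_UN_I) (auto intro: finite_subset[of _ "{0<..B}"])
  also have "\<dots> \<le> (\<Sum>c\<in>C. card {x\<in>{0<..B}. x mod int b = (- (int p * c)) mod int b})"
    by (rule card_UN_le[OF C(2)])
  finally have "int (card X) \<le> (\<Sum>c\<in>C. int (card {x\<in>{0<..B}. x mod int b = (- (int p * c)) mod int b}))"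
    by (simp flip: of_nat_sum)
  also have "\<dots> \<le> (\<Sum>c\<in>C. B div int b + 1)"
    using b B by (intro sum_mono card_residue_class_le) auto
  finally have X: "int (card X) \<le> int (card C) * (B div int b + 1)" by simp
  have Bb: "B div int b + 1 \<ge> 0" using B b by (simp add: pos_imp_zdiv_nonneg_iff add_nonneg_nonneg)
  \<comment> \<open>The factor \<open>2 ^ k\<close> lost in the order is absorbed by
    \<open>2 ^ k * card C \<le> b\<close>, which gives p - 1 \<le> B + b. Since B \<le>
    (b-2)p/(b-1), this means p \<le> b^2 - 1; hence the threshold on \<open>p\<close>.\<close>
  have "p - 1 \<le> 2 ^ k * card X" using k(1) ord by (meson le_trans mult_le_mono2)
  then have "int (p - 1) \<le> int (2 ^ k * card X)" by (simp only: of_nat_le_iff)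
  then have "int p - 1 \<le> 2 ^ k * int (card X)"
    using prime_gt_0_nat[OF p(1)] by (simp add: of_nat_diff)
  also have "\<dots> \<le> 2 ^ k * (int (card C) * (B div int b + 1))" using X by (intro mult_left_mono) auto
  also have "\<dots> = int (2 ^ k * card C) * (B div int b + 1)" by simp
  also have "\<dots> \<le> int b * (B div int b + 1)" using k(2) Bb by (intro mult_right_mono) (auto simp del: of_nat_mult)
  also have "\<dots> \<le> B + int b"
  proof -
    have "B = int b * (B div int b) + B mod int b" by simp
    moreover have "B mod int b \<ge> 0" using b by simp
    ultimately show ?thesis by (simp only: distrib_left)
  qed
  finally have "(int p - 1 - int b) * (int b - 1) \<le> B * (int b - 1)"
    using b by (intro mult_right_mono) auto
  also have "\<dots> \<le> (int b - 2) * int p"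
  proof -
    define w where "w = (int b - 2) * int p"
    have "w = (w div (int b - 1)) * (int b - 1) + w mod (int b - 1)"
      by (rule div_mult_mod_eq[symmetric])
    moreover have "w mod (int b - 1) \<ge> 0" using b by simp
    ultimately show ?thesis unfolding B_def w_def by linarith
  qed
  finally have "int p \<le> int b ^ 2 - 1" by (simp add: algebra_simps power2_eq_square)
  then have "p < b\<^sup>2" by (metis linorder_not_less of_nat_less_iff of_nat_power zle_diff1_eq)
  then show False using p(3) by simp
qed

lemma no_integer_cycle_power_plus_one:
  assumes b: "b > 2" and C: "C \<subseteq> {0..int b - 2}" "int b - 1 \<notin> C + C" and n: "n > 0"
  shows "\<not> integer_cycle b C (b ^ n + 1) X f"
proof
  define t where "t = b ^ n + 1"
  assume "integer_cycle b C (b ^ n + 1) X f"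
  then have cyc: "integer_cycle b C t X f" by (simp add: t_def)
  obtain x where x: "x \<in> X" using cyc by (auto simp: integer_cycle_def)
  note pos = integer_cycle_pos[OF b C(1) cyc] and less = integer_cycle_less[OF b C(1) cyc]
  \<comment> \<open>Modulo \<open>t\<close> the power \<open>b ^ n\<close> is -1, so the orbit of
    \<open>x\<close> passes through \<open>t - x\<close>.\<close>
  have "int b ^ n * x = (int t - x) + int t * (x - 1)" by (simp add: t_def algebra_simps)
  then have "[int t - x = int b ^ n * x] (mod int t)" by (simp add: cong_def)
  then have x': "int t - x \<in> X"
    using integer_cycle_cong_mem[OF b C(1) cyc x] pos[OF x] less[OF x] by simp
  obtain c where c: "c \<in> C" "int b * f x = x + int t * c" using cyc x by (auto simp: integer_cycle_def)
  obtain c' where c': "c' \<in> C" "int b * f (int t - x) = int t - x + int t * c'"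
    using cyc x' by (auto simp: integer_cycle_def)
  \<comment> \<open>Adding the two step equations cancels \<open>x\<close>. As \<open>t\<close> is
    coprime to \<open>b\<close> it divides \<open>s\<close>, and 0 < s < 2t leaves only s = t, that
    is, 1 + c + c' = b.\<close>
  define s where "s = f x + f (int t - x)"
  have bs: "int b * s = int t * (1 + c + c')" using c c' by (simp add: s_def algebra_simps)
  have "coprime t (b ^ n)" unfolding t_def by (rule coprime_add_one_left)
  then have "coprime (int t) (int b)" using n by (auto simp only: coprime_power_right_iff coprime_int_iff)
  then have "int t dvd s" using bs by (metis coprime_dvd_mult_right_iff dvd_triv_left)
  moreover have "f x \<in> X" "f (int t - x) \<in> X" using cyc x x' by (auto simp: integer_cycle_def)
  then have "0 < s" "s < 2 * int t" unfolding s_def using pos less by (smt (verit))+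
  ultimately obtain k where k: "s = int t * k" "0 < int t * k" "int t * k < int t * 2"
    by (metis dvdE mult.commute)
  have tpos: "int t > 0" by (simp add: t_def add_pos_nonneg)
  then have "0 < k" "k < 2" using k(2,3) by (simp_all add: zero_less_mult_iff)
  then have "s = int t" using k(1) by simp
  then have "int t * int b = int t * (1 + c + c')" using bs by (simp add: mult.commute)
  then have "int b - 1 = c + c'" by (simp add: t_def del: of_nat_add of_nat_power)
  then show False using C(2) c c' by (metis set_plus_intro)
qed

section \<open>Cycles modulo powers of a prime\<close>

lemma integer_cycle_scale:
  assumes "integer_cycle b C t X f" "s > 0"
  shows "integer_cycle b C (s * t) ((*) (int s) ` X) (\<lambda>x. int s * f (x div int s))"
  unfolding integer_cycle_def
proof (intro conjI ballI)
  show "finite ((*) (int s) ` X)" "(*) (int s) ` X \<noteq> {}" "0 \<notin> (*) (int s) ` X"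
    using assms by (auto simp: integer_cycle_def)
  show "(\<lambda>x. int s * f (x div int s)) ` (*) (int s) ` X = (*) (int s) ` X"
    using assms by (simp add: integer_cycle_def image_image) (metis image_image)
  fix x assume "x \<in> (*) (int s) ` X"
  then obtain y where y: "y \<in> X" "x = int s * y" by blast
  then obtain c where "c \<in> C" "int b * f y = y + int t * c" using assms by (auto simp: integer_cycle_def)
  then have "c \<in> C" "int s * (int b * f y) = int s * (y + int t * c)" by simp_all
  then show "\<exists>c\<in>C. int b * (int s * f (x div int s)) = x + int (s * t) * c"
    using y assms(2) by (intro bexI[of _ c]) (simp_all add: distrib_left mult.left_commute mult.assoc)
qed

text \<open>Since \<open>s\<close> is coprime to \<open>b\<close>, the step equation passes
  divisibility by \<open>s\<close> from \<open>y\<close> to \<open>f y\<close>. A surjection of a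
  finite set onto itself is injective, so \<open>f\<close> permutes the multiples of
  \<open>s\<close> in \<open>X\<close>, and these can be divided by \<open>s\<close>.\<close>

lemma integer_cycle_divide:
  assumes "integer_cycle b C (s * t) X f" "s > 0" "coprime s b" "x \<in> X" "int s dvd x"
  shows "\<exists>Y g. integer_cycle b C t Y g \<and> x div int s \<in> Y"
proof -
  define X' where "X' = {y\<in>X. int s dvd y}"
  have fin: "finite X'" using assms(1) by (auto simp: X'_def integer_cycle_def)
  have step: "\<exists>c\<in>C. int b * f y = y + int (s * t) * c" if "y \<in> X" for y
    using that assms(1) by (auto simp: integer_cycle_def)
  have "f ` X' \<subseteq> X'"
  proof
    fix z assume "z \<in> f ` X'"
    then obtain y where y: "y \<in> X" "int s dvd y" "z = f y" by (auto simp: X'_def)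
    obtain c where "int b * f y = y + int (s * t) * c" using step[OF y(1)] by blast
    then have "int s dvd int b * f y" using y(2) by (simp add: mult.assoc)
    then have "int s dvd f y" using assms(3) by (simp add: coprime_dvd_mult_right_iff)
    then show "z \<in> X'" using y assms(1) by (auto simp: X'_def integer_cycle_def)
  qed
  moreover have "inj_on f X"
    using assms(1) by (intro eq_card_imp_inj_on) (auto simp: integer_cycle_def)
  then have "inj_on f X'" by (rule inj_on_subset) (auto simp: X'_def)
  ultimately have surj: "f ` X' = X'" using fin by (simp add: endo_inj_surj)
  have Y: "integer_cycle b C t ((\<lambda>y. y div int s) ` X') (\<lambda>y. f (int s * y) div int s)"
    unfolding integer_cycle_def
  proof (intro conjI ballI)
    show "finite ((\<lambda>y. y div int s) ` X')" using fin by simp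
    show "(\<lambda>y. y div int s) ` X' \<noteq> {}" using assms by (auto simp: X'_def)
    show "0 \<notin> (\<lambda>y. y div int s) ` X'" using assms by (auto simp: X'_def integer_cycle_def)
    have "(\<lambda>y. f (int s * y) div int s) ` (\<lambda>y. y div int s) ` X' = (\<lambda>y. y div int s) ` f ` X'"
      unfolding image_image by (intro image_cong refl) (auto simp: X'_def)
    then show "(\<lambda>y. f (int s * y) div int s) ` (\<lambda>y. y div int s) ` X' = (\<lambda>y. y div int s) ` X'"
      using surj by simp
    fix y assume "y \<in> (\<lambda>y. y div int s) ` X'"
    then have y: "int s * y \<in> X'" by (auto simp: X'_def)
    then obtain c where c: "c \<in> C" "int b * f (int s * y) = int s * y + int (s * t) * c"
      using step by (auto simp: X'_def)
    have "f (int s * y) \<in> X'" using y surj by blast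
    then obtain k where k: "f (int s * y) = int s * k" by (auto simp: X'_def)
    then have "int s * (int b * k) = int s * (y + int t * c)"
      using c(2) by (simp add: algebra_simps)
    then show "\<exists>c\<in>C. int b * (f (int s * y) div int s) = y + int t * c"
      using c(1) k assms(2) by (intro bexI[of _ c]) simp_all
  qed
  have "x div int s \<in> (\<lambda>y. y div int s) ` X'" using assms(4,5) by (intro imageI) (simp add: X'_def)
  then show ?thesis using Y by blast
qed

text \<open>The quadratic term is kept explicit because lifting needs the divisibility of its
  coefficient: for a divisible by p exactly once, a bare remainder of order a^2 would only be
  divisible by p^2, the order of the main term.\<close>

lemma one_plus_power_expansion:
  fixes a :: int
  shows "\<exists>s. (1 + a) ^ n = 1 + int n * a + int (n choose 2) * a\<^sup>2 + a ^ 3 * s"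
proof (induction n)
  case 0
  then show ?case by (intro exI[of _ 0]) simp
next
  case (Suc n)
  then obtain s where s: "(1 + a) ^ n = 1 + int n * a + int (n choose 2) * a\<^sup>2 + a ^ 3 * s" by blast
  have "(Suc n) choose 2 = n + (n choose 2)" by (simp add: numeral_2_eq_2)
  then show ?case using s
    by (intro exI[of _ "s + a * s + int (n choose 2)"])
      (simp add: algebra_simps power2_eq_square power3_eq_cube)
qed

text \<open>For odd \<open>p\<close> the coefficient \<open>p choose 2\<close> is divisible by
  \<open>p\<close>. As m \<ge> 1, the quadratic and cubic terms are then divisible by p^(m+2), so
  the linear term alone decides the exponent.\<close>

lemma lifting_exponent_step:
  fixes p m :: nat and u :: int
  assumes "prime p" "odd p" "m > 0" "\<not> int p dvd u"
  shows "\<exists>v. (1 + int p ^ m * u) ^ p = 1 + int p ^ Suc m * v \<and> \<not> int p dvd v"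
proof -
  define a where "a = int p ^ m * u"
  obtain s where s: "(1 + a) ^ p = 1 + int p * a + int (p choose 2) * a\<^sup>2 + a ^ 3 * s"
    using one_plus_power_expansion by blast
  obtain h where h: "p choose 2 = p * h"
    using assms(1,2) dvd_choose_prime[of 2 p] prime_gt_1_nat[OF assms(1)]
    by (metis One_nat_def Suc_1 Suc_leI dvdE even_numeral le_neq_implies_less not_one_le_zero numeral_eq_one_iff
        prime_gt_0_nat semiring_norm(85) zero_neq_numeral less_numeral_extra(3))
  obtain m' where m: "m = Suc m'" using assms(3) gr0_implies_Suc by blast
  have "(1 + a) ^ p = 1 + int p ^ Suc m * (u + int p * (int p ^ m' * int h * u\<^sup>2 + int p ^ (2 * m') * u ^ 3 * s))"
    unfolding s h unfolding a_def m
    by (simp add: algebra_simps power2_eq_square power3_eq_cube power_add power_mult mult_2)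
  moreover have "\<not> int p dvd u + int p * (int p ^ m' * int h * u\<^sup>2 + int p ^ (2 * m') * u ^ 3 * s)"
    using assms(4) by (simp add: dvd_add_left_iff)
  ultimately show ?thesis unfolding a_def by blast
qed

lemma lifting_exponent:
  fixes p l j :: nat and g u :: int
  assumes "prime p" "odd p" "l > 0" "g = 1 + int p ^ l * u" "\<not> int p dvd u"
  shows "\<exists>v. g ^ (p ^ j) = 1 + int p ^ (l + j) * v \<and> \<not> int p dvd v"
proof (induction j)
  case 0
  then show ?case using assms by auto
next
  case (Suc j)
  then obtain v where v: "g ^ (p ^ j) = 1 + int p ^ (l + j) * v" "\<not> int p dvd v" by blast
  obtain w where "(1 + int p ^ (l + j) * v) ^ p = 1 + int p ^ Suc (l + j) * w" "\<not> int p dvd w"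
    using lifting_exponent_step[OF assms(1,2) _ v(2), of "l + j"] assms(3) by auto
  then show ?case using v(1) by (auto simp: power_mult mult.commute[of p] intro!: exI[of _ w])
qed

text \<open>The powers of \<open>b ^ d\<close> fill the group of residues congruent to 1 modulo p^l,
  so their multiples of \<open>y\<close> fill the class of \<open>y\<close>. The induction refines
  the exponent: adding \<open>d * p ^ j * r\<close> changes the value, to first order, by p^(l+j)
  times \<open>v * int b ^ i * y * int r\<close>.\<close>

lemma power_orbit_covers_residues:
  fixes p l j d b :: nat and y z u :: int
  assumes p: "prime p" "odd p" and l: "l > 0" and bd: "int b ^ d = 1 + int p ^ l * u" "\<not> int p dvd u"
    and y: "\<not> int p dvd y" and b: "coprime p b" and z: "[z = y] (mod int p ^ l)"
  shows "\<exists>i. [z = int b ^ i * y] (mod int p ^ (l + j))"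
proof (induction j)
  case 0
  then show ?case using z by (intro exI[of _ 0]) simp
next
  case (Suc j)
  have pp: "prime (int p)" using p(1) by simp
  obtain i where i: "[z = int b ^ i * y] (mod int p ^ (l + j))" using Suc by blast
  obtain v where v: "(int b ^ d) ^ (p ^ j) = 1 + int p ^ (l + j) * v" "\<not> int p dvd v"
    using lifting_exponent[OF p l bd] by blast
  obtain w where w: "z - int b ^ i * y = int p ^ (l + j) * w"
    using i by (meson cong_iff_dvd_diff dvdE)
  have "\<not> int p dvd int b"
    using p(1) b by (metis coprime_common_divisor_nat dvd_refl int_dvd_int_iff not_prime_1)
  then have "\<not> int p dvd (v * int b ^ i * y)"
    using v(2) y pp by (auto simp: prime_dvd_mult_iff dest: prime_dvd_power[OF pp])
  then have "coprime (v * int b ^ i * y) (int p)"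
    using pp prime_imp_coprime coprime_commute by blast
  then obtain x where x: "[v * int b ^ i * y * x = 1] (mod int p)" using cong_solve_coprime_int by blast
  \<comment> \<open>\<open>x\<close> inverts \<open>v * int b ^ i * y\<close> modulo
    \<open>p\<close>, so this \<open>r\<close> makes the first-order change equal to the remaining
    error \<open>w\<close> modulo \<open>p\<close>.\<close>
  define r where "r = nat ((x * w) mod int p)"
  have r: "int r = (x * w) mod int p" unfolding r_def using prime_gt_0_nat[OF p(1)] by simp
  have "[v * int b ^ i * y * int r = v * int b ^ i * y * (x * w)] (mod int p)"
    unfolding r by (intro cong_mult) (auto simp: cong_def)
  also have "[v * int b ^ i * y * (x * w) = 1 * w] (mod int p)"
    using cong_mult[OF x cong_refl[of w]] by (simp add: mult.assoc)
  finally obtain e where e: "w - v * int b ^ i * y * int r = int p * e"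
    by (metis cong_iff_dvd_diff cong_sym dvdE mult_1)
  obtain s where s: "(1 + int p ^ (l + j) * v) ^ r = 1 + int r * (int p ^ (l + j) * v)
      + int (r choose 2) * (int p ^ (l + j) * v)\<^sup>2 + (int p ^ (l + j) * v) ^ 3 * s"
    using one_plus_power_expansion by blast
  \<comment> \<open>Because l > 0, a further factor p^(l+j) contains a factor \<open>p\<close>; the
    terms of higher order in \<open>S\<close> thus vanish modulo p^(l+j+1).\<close>
  obtain q where q: "int p ^ (l + j) = int p * q" using l by (metis gr0_implies_Suc add_Suc power_Suc)
  define S where "S = int (r choose 2) * v\<^sup>2 + int p ^ (l + j) * v ^ 3 * s"
  have "(1 + int p ^ (l + j) * v) ^ r = 1 + int p ^ (l + j) * (int r * v + int p ^ (l + j) * S)"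
    unfolding s S_def by (simp add: algebra_simps power2_eq_square power3_eq_cube)
  moreover have "int b ^ (d * p ^ j * r + i) * y = (1 + int p ^ (l + j) * v) ^ r * int b ^ i * y"
    using v(1) by (simp only: power_add power_mult)
  ultimately have "int b ^ (d * p ^ j * r + i) * y
      = (1 + int p ^ (l + j) * (int r * v + int p * q * S)) * int b ^ i * y"
    using q by simp
  also have "\<dots> = int b ^ i * y + int p ^ (l + j) * (v * int b ^ i * y * int r + int p * q * S * int b ^ i * y)"
    by (simp only: algebra_simps mult_1_left)
  also have "\<dots> = z - int p ^ (l + j) * (int p * (e - q * S * int b ^ i * y))"
  proof -
    have "int b ^ i * y = z - int p ^ (l + j) * w" "v * int b ^ i * y * int r = w - int p * e"
      using w e by linarith+
    then show ?thesis by (simp only:) (simp only: algebra_simps)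
  qed
  finally have "z - int b ^ (d * p ^ j * r + i) * y = int p ^ (l + Suc j) * (e - q * S * int b ^ i * y)"
    by (simp add: algebra_simps)
  then show ?case by (metis cong_iff_dvd_diff dvd_triv_left)
qed

text \<open>Removing the power of \<open>p\<close> from a point of the cycle lowers the exponent to
  \<open>n - j\<close>. If this is at most \<open>l\<close>, scaling back up contradicts the
  assumption for p^l. Otherwise the orbit of a unit modulo \<open>p\<close> fills its class modulo
  p^l and reaches the forbidden gap below the modulus.\<close>

lemma no_integer_cycle_prime_power:
  assumes b: "b > 2" and C: "C \<subseteq> {0..int b - 2}"
    and p: "prime p" "coprime p b" "p \<ge> b" and l: "l > 0"
    and bd: "p ^ l dvd b ^ d - 1" "\<not> p ^ Suc l dvd b ^ d - 1" and n: "n \<ge> l"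
    and no: "\<nexists>X f. integer_cycle b C (p ^ l) X f"
  shows "\<not> integer_cycle b C (p ^ n) X f"
proof
  assume cyc: "integer_cycle b C (p ^ n) X f"
  have odd: "odd p" using p b by (metis linorder_not_less order.strict_trans2 prime_odd_nat)
  obtain u' where u': "b ^ d - 1 = p ^ l * u'" using bd(1) by blast
  have "b ^ d = 1 + p ^ l * u'" using u' b by (metis le_add_diff_inverse one_le_power order_less_imp_le one_less_numeral_iff semiring_norm(76) order.strict_trans)
  then have u: "int b ^ d = 1 + int p ^ l * int u'" by (metis of_nat_1 of_nat_add of_nat_mult of_nat_power)
  have pu: "\<not> int p dvd int u'"
  proof
    assume "int p dvd int u'"
    then have "p ^ l * p dvd p ^ l * u'" by (intro mult_dvd_mono) auto
    then show False using bd(2) u' by (simp add: mult.commute)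
  qed
  obtain x where x: "x \<in> X" using cyc by (auto simp: integer_cycle_def)
  have xpos: "x > 0" and xless: "x < int (p ^ n)"
    using integer_cycle_pos[OF b C cyc x] integer_cycle_less[OF b C cyc x] by auto
  define j where "j = multiplicity (int p) x"
  have pp: "prime (int p)" using p(1) by simp
  have jx: "int (p ^ j) dvd x" unfolding j_def by (simp add: multiplicity_dvd)
  have jn: "j < n"
  proof -
    have "int (p ^ j) \<le> x" using jx xpos by (rule zdvd_imp_le)
    then have "p ^ j < p ^ n" using xless by (metis order.strict_trans1 of_nat_less_iff)
    then show ?thesis using prime_gt_1_nat[OF p(1)] by simp
  qed
  define y where "y = x div int (p ^ j)"
  have py: "\<not> int p dvd y"
    using multiplicity_decompose[of x "int p"] xpos prime_gt_1_nat[OF p(1)] unfolding y_def j_def by simp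
  have "p ^ j * p ^ (n - j) = p ^ n" using jn by (simp flip: power_add)
  then obtain Y g where Y: "integer_cycle b C (p ^ (n - j)) Y g" "y \<in> Y"
    using integer_cycle_divide[of b C "p ^ j" "p ^ (n - j)" X f x] cyc x jx p prime_gt_0_nat[OF p(1)]
    unfolding y_def by auto
  show False
  proof (cases "n - j \<le> l")
    case True
    have "p ^ (l - (n - j)) * p ^ (n - j) = p ^ l" using True by (simp flip: power_add)
    then show False
      using integer_cycle_scale[OF Y(1), of "p ^ (l - (n - j))"] no prime_gt_0_nat[OF p(1)] by auto
  next
    case False
    define m where "m = n - j - l"
    have m: "n - j = l + m" "m > 0" using False by (auto simp: m_def)
    define t where "t = p ^ (l + m)"
    have cycY: "integer_cycle b C t Y g" using Y(1) m by (simp add: t_def)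
    define q where "q = int p ^ l"
    have q: "q > 0" using prime_gt_0_nat[OF p(1)] by (simp add: q_def)
    \<comment> \<open>The largest number below \<open>t\<close> congruent to \<open>y\<close> modulo
      p^l. It is at least t - q, so the upper bound for cycles would force t \<le> (b-1)q, whereas p
      \<ge> b gives t \<ge> bq.\<close>
    define z where "z = int t - q + y mod q"
    have "[z = y] (mod int p ^ l)"
    proof -
      have "z = y + q * (int p ^ m - 1 - y div q)"
        unfolding z_def t_def by (simp add: q_def power_add right_diff_distrib minus_mult_div_eq_mod[symmetric])
      then show ?thesis by (simp add: cong_iff_dvd_diff q_def)
    qed
    then obtain i where i: "[z = int b ^ i * y] (mod int p ^ (l + m))"
      using power_orbit_covers_residues[OF p(1) odd l u pu py p(2)] by blast
    have "int b * q \<le> int p ^ m * q"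
    proof (intro mult_right_mono)
      have "b \<le> p" by (rule p)
      also have "p \<le> p ^ m" using m(2) prime_gt_0_nat[OF p(1)] by (simp add: self_le_power)
      finally show "int b \<le> int p ^ m" by (metis of_nat_le_iff of_nat_power)
    qed (use q in simp)
    then have bq: "int b * q \<le> int t" by (simp add: t_def q_def power_add mult.commute)
    have bq3: "3 * q \<le> int b * q" using b q by (intro mult_right_mono) auto
    have modq: "0 \<le> y mod q" "y mod q < q" using q by auto
    have "z > 0" "z < int t" unfolding z_def using bq bq3 modq q by linarith+
    then have "z \<in> Y" using integer_cycle_cong_mem[OF b C cycY Y(2)] i by (simp add: t_def)
    then have "(int b - 1) * z \<le> (int b - 2) * int t" by (rule integer_cycle_upper[OF b C cycY])
    moreover have "(int b - 1) * (int t - q) \<le> (int b - 1) * z"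
      unfolding z_def using b modq by (intro mult_left_mono) auto
    ultimately have "int t \<le> (int b - 1) * q" by (simp add: algebra_simps)
    then show False using bq q by (simp add: algebra_simps)
  qed
qed

text \<open>The maximum is taken over a finite nonempty set: k < p^k bounds the exponents, and 1
  belongs to it by the definition of the order. So \<open>ell b p\<close> is the exact exponent of
  \<open>p\<close> in \<open>b ^ ord p b - 1\<close>.\<close>

lemma ell_props:
  assumes "b > 2" "prime p" "coprime p b"
  shows "ell b p > 0" "p ^ ell b p dvd b ^ ord p b - 1" "\<not> p ^ Suc (ell b p) dvd b ^ ord p b - 1"
proof -
  define A where "A = {k. k \<ge> 1 \<and> p ^ k dvd b ^ ord p b - 1}"
  have "ord p b > 0" using assms(3) by (simp add: coprime_commute)
  then have "b ^ ord p b > 1" using assms(1) by (intro one_less_power) auto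
  then have pos: "b ^ ord p b - 1 > 0" by simp
  have "k \<le> b ^ ord p b - 1" if "k \<in> A" for k
  proof -
    have "k < p ^ k" using prime_gt_Suc_0_nat[OF assms(2)] by (rule power_gt_expt)
    also have "p ^ k \<le> b ^ ord p b - 1" using that pos by (intro dvd_imp_le) (auto simp: A_def)
    finally show ?thesis by simp
  qed
  then have fin: "finite A" by (meson finite_nat_set_iff_bounded_le)
  have "[b ^ ord p b = 1] (mod p)" by (rule ord)
  then have "p dvd b ^ ord p b - 1" using pos by (metis cong_to_1_nat)
  then have "1 \<in> A" by (simp add: A_def)
  then have "Max A \<in> A" using fin by (intro Max_in) auto
  moreover have "Suc (Max A) \<notin> A" using fin Max_ge not_less_eq_eq by blast
  moreover have "ell b p = Max A" by (simp add: ell_def A_def)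
  ultimately show "ell b p > 0" "p ^ ell b p dvd b ^ ord p b - 1" "\<not> p ^ Suc (ell b p) dvd b ^ ord p b - 1"
    by (auto simp: A_def)
qed

section \<open>Self-similar measures and their Fourier transforms\<close>

definition echar :: "real \<Rightarrow> complex" where
  "echar u = cis (- (2 * pi * u))"

lemma echar_0 [simp]: "echar 0 = 1"
  by (simp add: echar_def)

lemma echar_add: "echar (u + v) = echar u * echar v"
  by (simp add: echar_def cis_mult algebra_simps)

lemma norm_echar [simp]: "norm (echar u) = 1"
  by (simp add: echar_def)

lemma cnj_echar: "cnj (echar u) = echar (- u)"
  by (simp add: echar_def cis_cnj)

lemma echar_of_int [simp]: "echar (of_int n) = 1"
  using cis_multiple_2pi[of "- of_int n"] by (simp add: echar_def mult.commute mult.left_commute)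

lemma echar_eq_1_iff: "echar u = 1 \<longleftrightarrow> u \<in> \<int>"
proof
  assume "echar u = 1"
  then have "cos (2 * pi * u) = 1" by (simp add: echar_def complex_eq_iff)
  then obtain n :: int where "2 * pi * u = of_int n * 2 * pi" using cos_one_2pi_int by blast
  then have "u = of_int n" by simp
  then show "u \<in> \<int>" by simp
qed (auto elim: Ints_cases)

lemma echar_power: "echar u ^ n = echar (of_nat n * u)"
  by (simp only: echar_def Complex.DeMoivre) (simp add: algebra_simps)

lemma continuous_on_echar [continuous_intros]:
  "continuous_on S f \<Longrightarrow> continuous_on S (\<lambda>x. echar (f x))"
  unfolding echar_def by (intro continuous_intros)

lemma borel_measurable_echar [measurable]: "echar \<in> borel_measurable borel"
  by (intro borel_measurable_continuous_onI continuous_intros)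

definition invariant_measure :: "nat \<Rightarrow> int set \<Rightarrow> real measure \<Rightarrow> bool" where
  "invariant_measure b D \<mu> \<longleftrightarrow> prob_space \<mu> \<and> sets \<mu> = sets borel \<and>
     (\<forall>E\<in>sets borel. measure \<mu> E = 1 / real (card D) * (\<Sum>d\<in>D. measure \<mu> (ifs_map b d -` E)))"

definition mask :: "int set \<Rightarrow> real \<Rightarrow> complex" where
  "mask D u = (\<Sum>d\<in>D. echar (of_int d * u)) / of_nat (card D)"

definition fourier :: "real measure \<Rightarrow> real \<Rightarrow> complex" where
  "fourier \<mu> \<xi> = (\<integral>x. echar (\<xi> * x) \<partial>\<mu>)"

lemma fourier_eq_char: "fourier \<mu> \<xi> = char \<mu> (- (2 * pi * \<xi>))"
  unfolding fourier_def char_def echar_def cis_conv_exp by (simp add: mult.assoc)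

lemma borel_measurable_ifs_map [measurable]: "ifs_map b d \<in> borel_measurable borel"
  unfolding ifs_map_def by measurable

context
  fixes b :: nat and D :: "int set"
  assumes b: "b > 1" and D: "finite D" "D \<noteq> {}"
begin

lemma mask_0: "mask D 0 = 1"
  using D by (simp add: mask_def)

text \<open>Invariance says that \<mu> is the image of the uniform law on \<open>D\<close> times
  \<mu> under \<open>(d, x) \<mapsto> ifs_map b d x\<close>. Change of variables and Fubini,
  justified by the bound \<open>B\<close>, give the formula.\<close>

lemma invariant_measure_integral:
  fixes f :: "real \<Rightarrow> complex"
  assumes \<mu>: "invariant_measure b D \<mu>" and f [measurable]: "f \<in> borel_measurable borel"
    and bdd: "\<And>x. norm (f x) \<le> B"
  shows "(\<integral>x. f x \<partial>\<mu>) = (\<Sum>d\<in>D. \<integral>x. f (ifs_map b d x) \<partial>\<mu>) / of_nat (card D)"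
proof -
  interpret prob_space \<mu> using \<mu> by (simp add: invariant_measure_def)
  have sets [measurable_cong, simp]: "sets \<mu> = sets borel" using \<mu> by (simp add: invariant_measure_def)
  have space [simp]: "space \<mu> = UNIV" using sets_eq_imp_space_eq[OF sets] by simp
  define P where "P = measure_pmf (pmf_of_set D) \<Otimes>\<^sub>M \<mu>"
  interpret D: prob_space "measure_pmf (pmf_of_set D)" by (rule prob_space_measure_pmf)
  interpret P: pair_prob_space "measure_pmf (pmf_of_set D)" \<mu> ..
  define g where "g = (\<lambda>(d, x). ifs_map b d x)"
  have g [measurable]: "g \<in> borel_measurable P"
    unfolding g_def P_def ifs_map_def by measurable
  have eq: "\<mu> = distr P borel g"
  proof (rule measure_eqI)
    fix E assume "E \<in> sets \<mu>"
    then have E [measurable]: "E \<in> sets borel" by simp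
    have vim [measurable]: "ifs_map b d -` E \<in> sets borel" for d
      using measurable_sets[OF borel_measurable_ifs_map E] by simp
    have "emeasure (distr P borel g) E = emeasure P (g -` E \<inter> space P)" by (simp add: emeasure_distr)
    also have "\<dots> = (\<integral>\<^sup>+d. emeasure \<mu> (Pair d -` (g -` E \<inter> space P)) \<partial>measure_pmf (pmf_of_set D))"
      unfolding P_def by (rule emeasure_pair_measure_alt, fold P_def) measurable
    also have "\<dots> = (\<integral>\<^sup>+d. emeasure \<mu> (ifs_map b d -` E) \<partial>measure_pmf (pmf_of_set D))"
      by (intro nn_integral_cong arg_cong[where f = "emeasure \<mu>"])
        (auto simp: g_def P_def space_pair_measure)
    also have "\<dots> = (\<Sum>d\<in>D. emeasure \<mu> (ifs_map b d -` E)) / card D"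
      by (rule nn_integral_pmf_of_set[OF D(2,1)])
    also have "\<dots> = ennreal ((\<Sum>d\<in>D. measure \<mu> (ifs_map b d -` E)) / card D)"
      using D by (simp add: emeasure_eq_measure sum_nonneg divide_ennreal card_gt_0_iff
          ennreal_of_nat_eq_real_of_nat)
    also have "\<dots> = emeasure \<mu> E"
      using \<mu> E by (simp add: emeasure_eq_measure invariant_measure_def)
    finally show "emeasure \<mu> E = emeasure (distr P borel g) E" by simp
  qed simp
  have "(\<integral>x. f x \<partial>\<mu>) = (\<integral>x. f x \<partial>distr P borel g)" using eq by simp
  also have "\<dots> = (\<integral>z. f (g z) \<partial>P)" by (rule integral_distr) auto
  also have "\<dots> = (\<integral>d. \<integral>x. f (g (d, x)) \<partial>\<mu> \<partial>measure_pmf (pmf_of_set D))"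
    unfolding P_def
  proof (rule P.integral_fst'[symmetric])
    show "integrable (measure_pmf (pmf_of_set D) \<Otimes>\<^sub>M \<mu>) (\<lambda>z. f (g z))"
      using bdd g by (intro P.integrable_const_bound[where B = B]) (auto simp: P_def)
  qed
  also have "\<dots> = (\<Sum>d\<in>D. pmf (pmf_of_set D) d *\<^sub>R (\<integral>x. f (g (d, x)) \<partial>\<mu>))"
    using D by (intro integral_measure_pmf) auto
  also have "\<dots> = (\<Sum>d\<in>D. \<integral>x. f (ifs_map b d x) \<partial>\<mu>) / of_nat (card D)"
    unfolding sum_divide_distrib
    by (intro sum.cong) (use D in \<open>auto simp: g_def scaleR_conv_of_real\<close>)
  finally show ?thesis .
qed

lemma invariant_measure_real_distribution:
  "invariant_measure b D \<mu> \<Longrightarrow> real_distribution \<mu>"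
  by (simp add: invariant_measure_def real_distribution_def real_distribution_axioms_def)

lemma fourier_invariant_measure:
  assumes \<mu>: "invariant_measure b D \<mu>"
  shows "fourier \<mu> \<xi> = mask D (\<xi> / b) * fourier \<mu> (\<xi> / b)"
proof -
  have [measurable_cong]: "sets \<mu> = sets borel" using \<mu> by (simp add: invariant_measure_def)
  have "fourier \<mu> \<xi> = (\<Sum>d\<in>D. \<integral>x. echar (\<xi> * ifs_map b d x) \<partial>\<mu>) / of_nat (card D)"
    unfolding fourier_def
    by (rule invariant_measure_integral[OF \<mu>, where B = 1]) auto
  also have "(\<Sum>d\<in>D. \<integral>x. echar (\<xi> * ifs_map b d x) \<partial>\<mu>) =
      (\<Sum>d\<in>D. echar (of_int d * (\<xi> / b)) * fourier \<mu> (\<xi> / b))"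
  proof (rule sum.cong)
    fix d
    have "\<xi> * ifs_map b d x = of_int d * (\<xi> / b) + \<xi> / b * x" for x
      using b by (simp add: ifs_map_def divide_simps) (simp add: algebra_simps)
    then show "(\<integral>x. echar (\<xi> * ifs_map b d x) \<partial>\<mu>) = echar (of_int d * (\<xi> / b)) * fourier \<mu> (\<xi> / b)"
      by (simp only: echar_add fourier_def integral_mult_right_zero)
  qed simp
  finally show ?thesis by (simp add: mask_def sum_distrib_right)
qed

lemma fourier_invariant_measure_tendsto:
  assumes \<mu>: "invariant_measure b D \<mu>"
  shows "(\<lambda>n. fourier \<mu> (\<xi> / real b ^ n)) \<longlonglongrightarrow> 1"
proof -
  interpret real_distribution \<mu> by (rule invariant_measure_real_distribution[OF \<mu>])
  have "norm (1 / real b) < 1" using b by (simp add: norm_divide)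
  then have "(\<lambda>n. (1 / real b) ^ n) \<longlonglongrightarrow> 0" by (rule LIMSEQ_power_zero)
  then have "(\<lambda>n. - (2 * pi * \<xi>) * (1 / real b) ^ n) \<longlonglongrightarrow> - (2 * pi * \<xi>) * 0"
    by (rule tendsto_mult_left)
  then have "(\<lambda>n. - (2 * pi * (\<xi> / real b ^ n))) \<longlonglongrightarrow> 0" by (simp add: power_one_over)
  then have "(\<lambda>n. char \<mu> (- (2 * pi * (\<xi> / real b ^ n)))) \<longlonglongrightarrow> char \<mu> 0"
    by (rule isCont_tendsto_compose[OF isCont_char])
  then show ?thesis by (simp add: fourier_eq_char char_zero)
qed

text \<open>Iterating the functional equation exhibits the transform as an infinite product of mask
  values, which depends on \<open>b\<close> and \<open>D\<close> only. Characteristic functions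
  determine the law.\<close>

lemma invariant_measure_unique:
  assumes "invariant_measure b D \<mu>" "invariant_measure b D \<nu>"
  shows "\<mu> = \<nu>"
proof (rule Levy_uniqueness)
  show "real_distribution \<mu>" "real_distribution \<nu>"
    using assms by (auto intro: invariant_measure_real_distribution)
  have prod: "fourier \<mu> \<xi> = (\<Prod>k<n. mask D (\<xi> / real b ^ Suc k)) * fourier \<mu> (\<xi> / real b ^ n)"
    if "invariant_measure b D \<mu>" for \<mu> \<xi> n
  proof (induction n)
    case (Suc n)
    then show ?case
      using fourier_invariant_measure[OF that, of "\<xi> / real b ^ n"] by (simp add: field_simps)
  qed simp
  have lim: "(\<lambda>n. \<Prod>k<n. mask D (\<xi> / real b ^ Suc k)) \<longlonglongrightarrow> fourier \<mu> \<xi>"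
    if "invariant_measure b D \<mu>" for \<mu> \<xi>
  proof -
    note t = fourier_invariant_measure_tendsto[OF that, of \<xi>]
    \<comment> \<open>The tail factor tends to 1, so it can be divided out for all large
      \<open>n\<close> even though mask factors may vanish.\<close>
    have ev: "eventually (\<lambda>n. fourier \<mu> (\<xi> / real b ^ n) \<noteq> 0) sequentially"
      by (rule tendsto_imp_eventually_ne[OF t]) simp
    have "(\<lambda>n. fourier \<mu> \<xi> / fourier \<mu> (\<xi> / real b ^ n)) \<longlonglongrightarrow> fourier \<mu> \<xi> / 1"
      by (intro tendsto_intros t) simp
    then have "(\<lambda>n. fourier \<mu> \<xi> / fourier \<mu> (\<xi> / real b ^ n)) \<longlonglongrightarrow> fourier \<mu> \<xi>" by simp
    then show ?thesis
    proof (rule Lim_transform_eventually)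
      show "\<forall>\<^sub>F n in sequentially. fourier \<mu> \<xi> / fourier \<mu> (\<xi> / real b ^ n) =
          (\<Prod>k<n. mask D (\<xi> / real b ^ Suc k))"
        using ev by eventually_elim (use prod[OF that, of \<xi>] in \<open>auto simp: nonzero_divide_eq_eq\<close>)
    qed
  qed
  show "char \<mu> = char \<nu>"
  proof
    fix s
    have "fourier \<mu> (- s / (2 * pi)) = fourier \<nu> (- s / (2 * pi))"
      using lim[OF assms(1)] lim[OF assms(2)] LIMSEQ_unique by blast
    then show "char \<mu> s = char \<nu> s" by (simp add: fourier_eq_char)
  qed
qed

text \<open>The invariant measure is the law of the random \<open>b\<close>-adic expansion with independent digits
  uniform in \<open>D\<close>; digits outside the support are reset to \<open>0\<close> so that the series always converges.\<close>

lemma invariant_measure_exists: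
  "\<exists>\<mu> R. invariant_measure b D \<mu> \<and> (AE x in \<mu>. \<bar>x\<bar> \<le> R)"
proof -
  define p where "p = measure_pmf (pmf_of_set D)"
  interpret p: prob_space p unfolding p_def by (rule prob_space_measure_pmf)
  interpret S: prob_space "stream_space p" by (rule p.prob_space_stream_space)
  define dig where "dig d = (if d \<in> D then real_of_int d else 0)" for d
  define K where "K = (\<Sum>d\<in>D. \<bar>real_of_int d\<bar>)"
  have dig: "\<bar>dig d\<bar> \<le> K" for d
    unfolding dig_def K_def using D by (auto intro: member_le_sum sum_nonneg)
  define X where "X \<omega> = (\<Sum>k. dig (\<omega> !! k) / real b ^ Suc k)" for \<omega>
  have geo: "summable (\<lambda>k. K * (1 / real b) ^ Suc k)" using b
    by (intro summable_mult) (simp only: summable_Suc_iff, rule summable_geometric, simp)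
  have term_le: "norm (dig (\<omega> !! k) / real b ^ Suc k) \<le> K * (1 / real b) ^ Suc k" for \<omega> k
    using dig[of "\<omega> !! k"] b by (simp add: power_one_over abs_mult divide_right_mono)
  have sm: "summable (\<lambda>k. dig (\<omega> !! k) / real b ^ Suc k)" for \<omega>
    by (rule summable_comparison_test'[OF geo term_le])
  have bound: "\<bar>X \<omega>\<bar> \<le> (\<Sum>k. K * (1 / real b) ^ Suc k)" for \<omega>
  proof -
    have "norm (X \<omega>) \<le> (\<Sum>k. norm (dig (\<omega> !! k) / real b ^ Suc k))" unfolding X_def
      by (intro summable_norm summable_comparison_test'[OF geo, of 0]) (use term_le in auto)
    also have "\<dots> \<le> (\<Sum>k. K * (1 / real b) ^ Suc k)"
      by (intro suminf_le term_le geo summable_comparison_test'[OF geo, of 0]) (use term_le in auto)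
    finally show ?thesis by simp
  qed
  have [measurable]: "X \<in> borel_measurable (stream_space p)"
  proof -
    have [measurable]: "(\<lambda>\<omega>. dig (\<omega> !! k)) \<in> borel_measurable (stream_space p)" for k
      by (rule measurable_compose[OF measurable_snth]) (simp add: p_def)
    show ?thesis unfolding X_def by measurable
  qed
  \<comment> \<open>Prepending a digit acts on the value of the expansion as \<open>ifs_map\<close>;
    conditioning on the first digit therefore yields the invariance equation.\<close>
  have X_Stream: "X (d ## \<omega>) = ifs_map b d (X \<omega>)" if "d \<in> D" for d \<omega>
  proof -
    have "X (d ## \<omega>) = dig d / b + (\<Sum>k. dig (\<omega> !! k) / real b ^ Suc (Suc k))"
      using suminf_split_head[OF sm[of "d ## \<omega>"]] by (simp add: X_def)
    also have "(\<Sum>k. dig (\<omega> !! k) / real b ^ Suc (Suc k)) = (\<Sum>k. dig (\<omega> !! k) / real b ^ Suc k / b)"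
      by (simp add: field_simps)
    also have "\<dots> = X \<omega> / b" unfolding X_def by (rule suminf_divide[OF sm])
    finally show ?thesis using that by (simp add: ifs_map_def dig_def add_divide_distrib)
  qed
  define \<mu> where "\<mu> = distr (stream_space p) borel X"
  have "prob_space \<mu>" unfolding \<mu>_def by (rule S.prob_space_distr) simp
  moreover have "sets \<mu> = sets borel" by (simp add: \<mu>_def)
  moreover have "measure \<mu> E = 1 / real (card D) * (\<Sum>d\<in>D. measure \<mu> (ifs_map b d -` E))"
    if E [measurable]: "E \<in> sets borel" for E
  proof -
    have vim [measurable]: "ifs_map b d -` E \<in> sets borel" for d
      using measurable_sets[OF borel_measurable_ifs_map E] by simp
    have \<mu>: "measure \<mu> F = \<P>(\<omega> in stream_space p. X \<omega> \<in> F)" if "F \<in> sets borel" for F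
      using that by (simp add: \<mu>_def measure_distr vimage_def Int_def conj_commute)
    have "ennreal (measure \<mu> E) = (\<integral>\<^sup>+d. \<P>(\<omega> in stream_space p. X (d ## \<omega>) \<in> E) \<partial>p)"
      unfolding \<mu>[OF E] by (rule p.prob_stream_space) measurable
    also have "\<dots> = (\<Sum>d\<in>D. ennreal (\<P>(\<omega> in stream_space p. X (d ## \<omega>) \<in> E))) / card D"
      unfolding p_def by (rule nn_integral_pmf_of_set[OF D(2,1)])
    also have "(\<Sum>d\<in>D. ennreal (\<P>(\<omega> in stream_space p. X (d ## \<omega>) \<in> E))) =
        (\<Sum>d\<in>D. ennreal (measure \<mu> (ifs_map b d -` E)))"
      by (intro sum.cong refl) (simp add: X_Stream \<mu>[OF vim])
    also have "\<dots> / card D = ennreal ((\<Sum>d\<in>D. measure \<mu> (ifs_map b d -` E)) / card D)"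
      using D by (simp add: sum_nonneg divide_ennreal card_gt_0_iff ennreal_of_nat_eq_real_of_nat)
    finally show ?thesis by (simp add: sum_nonneg)
  qed
  ultimately have "invariant_measure b D \<mu>" by (simp add: invariant_measure_def)
  moreover have "AE x in \<mu>. \<bar>x\<bar> \<le> (\<Sum>k. K * (1 / real b) ^ Suc k)"
    unfolding \<mu>_def by (subst AE_distr_iff) (use bound in auto)
  ultimately show ?thesis by blast
qed

end

text \<open>Existence and uniqueness make the definite description denote. Boundedness of the
  support is recorded for the polynomial approximation in the density proof.\<close>

lemma self_similar_measure_props:
  assumes "b > 1" "finite D" "D \<noteq> {}"
  shows "invariant_measure b D (self_similar_measure b D)"
    and "\<exists>R. AE x in self_similar_measure b D. \<bar>x\<bar> \<le> R"
proof -
  obtain \<mu> R where \<mu>: "invariant_measure b D \<mu>" "AE x in \<mu>. \<bar>x\<bar> \<le> R"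
    using invariant_measure_exists[OF assms] by blast
  have "self_similar_measure b D = (THE \<mu>. invariant_measure b D \<mu>)"
    by (simp add: self_similar_measure_def invariant_measure_def)
  also have "\<dots> = \<mu>"
    using \<mu>(1) invariant_measure_unique[OF assms] by (intro the_equality) auto
  finally show "invariant_measure b D (self_similar_measure b D)"
    "\<exists>R. AE x in self_similar_measure b D. \<bar>x\<bar> \<le> R" using \<mu> by auto
qed

section \<open>Density of exponentials\<close>

text \<open>The closed linear span in the space of square-integrable functions. Distances are
  squared so that estimates stay free of square roots.\<close>

definition L2_span_closure :: "'a measure \<Rightarrow> 'i set \<Rightarrow> ('i \<Rightarrow> 'a \<Rightarrow> complex) \<Rightarrow> ('a \<Rightarrow> complex) set" where
  "L2_span_closure M I e = {f. square_integrable M f \<and>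
     (\<forall>\<epsilon>>0. \<exists>F a. finite F \<and> F \<subseteq> I \<and> (\<integral>x. (norm (f x - (\<Sum>i\<in>F. a i * e i x)))\<^sup>2 \<partial>M) < \<epsilon>)}"

lemma norm_add_square_le: "(norm (x + y :: complex))\<^sup>2 \<le> 2 * (norm x)\<^sup>2 + 2 * (norm y)\<^sup>2"
proof -
  have "(norm (x + y))\<^sup>2 \<le> (norm x + norm y)\<^sup>2" by (intro power_mono norm_triangle_ineq) simp
  also have "\<dots> \<le> 2 * (norm x)\<^sup>2 + 2 * (norm y)\<^sup>2"
    using sum_squares_bound[of "norm x" "norm y"] by (simp add: power2_sum)
  finally show ?thesis .
qed

lemma square_integrable_add:
  assumes "square_integrable M f" "square_integrable M g"
  shows "square_integrable M (\<lambda>x. f x + g x)"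
  unfolding square_integrable_def
proof
  have [measurable]: "f \<in> borel_measurable M" "g \<in> borel_measurable M"
    and int: "integrable M (\<lambda>x. (norm (f x))\<^sup>2)" "integrable M (\<lambda>x. (norm (g x))\<^sup>2)"
    using assms by (auto simp: square_integrable_def)
  show "(\<lambda>x. f x + g x) \<in> borel_measurable M" by measurable
  show "integrable M (\<lambda>x. (norm (f x + g x))\<^sup>2)"
  proof (rule Bochner_Integration.integrable_bound)
    show "integrable M (\<lambda>x. 2 * (norm (f x))\<^sup>2 + 2 * (norm (g x))\<^sup>2)" using int by simp
  qed (use norm_add_square_le in auto)
qed

lemma square_integrable_cmult:
  "square_integrable M f \<Longrightarrow> square_integrable M (\<lambda>x. c * f x)"
  by (auto simp: square_integrable_def norm_mult power_mult_distrib)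

lemma square_integrable_diff:
  "square_integrable M f \<Longrightarrow> square_integrable M g \<Longrightarrow> square_integrable M (\<lambda>x. f x - g x)"
  using square_integrable_add[of M f "\<lambda>x. (- 1) * g x"] square_integrable_cmult[of M g "- 1"] by simp

lemma square_integrable_sum:
  "(\<And>i. i \<in> F \<Longrightarrow> square_integrable M (e i)) \<Longrightarrow> square_integrable M (\<lambda>x. \<Sum>i\<in>F. a i * e i x)"
proof (induction F rule: infinite_finite_induct)
  case (insert i F)
  then show ?case by (simp add: square_integrable_add square_integrable_cmult)
qed (auto simp: square_integrable_def)

text \<open>Stands in for the Minkowski inequality; its factor 2 is the reason for the quarters of
  \<epsilon> in the approximation arguments.\<close>

lemma L2_distance_triangle:
  assumes "square_integrable M f" "square_integrable M g"
  shows "(\<integral>x. (norm (f x + g x))\<^sup>2 \<partial>M) \<le> 2 * (\<integral>x. (norm (f x))\<^sup>2 \<partial>M) + 2 * (\<integral>x. (norm (g x))\<^sup>2 \<partial>M)"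
proof -
  have "(\<integral>x. (norm (f x + g x))\<^sup>2 \<partial>M) \<le> (\<integral>x. 2 * (norm (f x))\<^sup>2 + 2 * (norm (g x))\<^sup>2 \<partial>M)"
    using assms square_integrable_add[OF assms] norm_add_square_le
    by (intro integral_mono) (auto simp: square_integrable_def)
  also have "\<dots> = 2 * (\<integral>x. (norm (f x))\<^sup>2 \<partial>M) + 2 * (\<integral>x. (norm (g x))\<^sup>2 \<partial>M)"
    using assms by (simp add: square_integrable_def)
  finally show ?thesis .
qed

context
  fixes M :: "'a measure" and I :: "'i set" and e :: "'i \<Rightarrow> 'a \<Rightarrow> complex"
  assumes e_sq: "\<forall>i\<in>I. square_integrable M (e i)"
begin

private lemma e: "i \<in> I \<Longrightarrow> square_integrable M (e i)"
  using e_sq by blast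

lemma L2_span_closure_square_integrable: "f \<in> L2_span_closure M I e \<Longrightarrow> square_integrable M f"
  by (simp add: L2_span_closure_def)

lemma L2_span_closureE:
  assumes "f \<in> L2_span_closure M I e" "\<epsilon> > 0"
  obtains F a where "finite F" "F \<subseteq> I" "(\<integral>x. (norm (f x - (\<Sum>i\<in>F. a i * e i x)))\<^sup>2 \<partial>M) < \<epsilon>"
  using assms by (auto simp: L2_span_closure_def)

lemma L2_span_closure_add:
  assumes f: "f \<in> L2_span_closure M I e" and g: "g \<in> L2_span_closure M I e"
  shows "(\<lambda>x. f x + g x) \<in> L2_span_closure M I e"
  unfolding L2_span_closure_def
proof (intro CollectI conjI allI impI)
  note sq = f[THEN L2_span_closure_square_integrable] g[THEN L2_span_closure_square_integrable]
  show "square_integrable M (\<lambda>x. f x + g x)" by (intro square_integrable_add sq)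
  fix \<epsilon> :: real assume \<epsilon>: "\<epsilon> > 0"
  then have \<epsilon>4: "\<epsilon> / 4 > 0" by simp
  obtain F a where F: "finite F" "F \<subseteq> I" "(\<integral>x. (norm (f x - (\<Sum>i\<in>F. a i * e i x)))\<^sup>2 \<partial>M) < \<epsilon> / 4"
    by (rule L2_span_closureE[OF f \<epsilon>4])
  obtain G c where G: "finite G" "G \<subseteq> I" "(\<integral>x. (norm (g x - (\<Sum>i\<in>G. c i * e i x)))\<^sup>2 \<partial>M) < \<epsilon> / 4"
    by (rule L2_span_closureE[OF g \<epsilon>4])
  define a' where "a' i = (if i \<in> F then a i else 0)" for i
  define c' where "c' i = (if i \<in> G then c i else 0)" for i
  have "(\<Sum>i\<in>F. a i * e i x) = (\<Sum>i\<in>F \<union> G. a' i * e i x)" for x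
    using F(1) G(1) by (intro sum.mono_neutral_cong_left) (auto simp: a'_def)
  moreover have "(\<Sum>i\<in>G. c i * e i x) = (\<Sum>i\<in>F \<union> G. c' i * e i x)" for x
    using F(1) G(1) by (intro sum.mono_neutral_cong_left) (auto simp: c'_def)
  ultimately have eq: "f x + g x - (\<Sum>i\<in>F \<union> G. (a' i + c' i) * e i x) =
      (f x - (\<Sum>i\<in>F. a i * e i x)) + (g x - (\<Sum>i\<in>G. c i * e i x))" for x
    by (simp add: distrib_right sum.distrib)
  have "(\<integral>x. (norm (f x + g x - (\<Sum>i\<in>F \<union> G. (a' i + c' i) * e i x)))\<^sup>2 \<partial>M)
      \<le> 2 * (\<integral>x. (norm (f x - (\<Sum>i\<in>F. a i * e i x)))\<^sup>2 \<partial>M) + 2 * (\<integral>x. (norm (g x - (\<Sum>i\<in>G. c i * e i x)))\<^sup>2 \<partial>M)"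
    unfolding eq
    by (intro L2_distance_triangle square_integrable_diff square_integrable_sum sq e) (use F G in auto)
  also have "\<dots> < \<epsilon>" using F(3) G(3) by linarith
  finally show "\<exists>F a. finite F \<and> F \<subseteq> I \<and> (\<integral>x. (norm (f x + g x - (\<Sum>i\<in>F. a i * e i x)))\<^sup>2 \<partial>M) < \<epsilon>"
    using F G by (intro exI[of _ "F \<union> G"] exI[of _ "\<lambda>i. a' i + c' i"]) auto
qed

lemma L2_span_closure_limit:
  assumes f: "square_integrable M f"
    and app: "\<And>\<epsilon>. \<epsilon> > 0 \<Longrightarrow> \<exists>g\<in>L2_span_closure M I e. (\<integral>x. (norm (f x - g x))\<^sup>2 \<partial>M) < \<epsilon>"
  shows "f \<in> L2_span_closure M I e"
  unfolding L2_span_closure_def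
proof (intro CollectI conjI allI impI f)
  fix \<epsilon> :: real assume \<epsilon>: "\<epsilon> > 0"
  then have \<epsilon>4: "\<epsilon> / 4 > 0" by simp
  then obtain g where g: "g \<in> L2_span_closure M I e" "(\<integral>x. (norm (f x - g x))\<^sup>2 \<partial>M) < \<epsilon> / 4"
    using app by blast
  obtain F a where F: "finite F" "F \<subseteq> I" "(\<integral>x. (norm (g x - (\<Sum>i\<in>F. a i * e i x)))\<^sup>2 \<partial>M) < \<epsilon> / 4"
    by (rule L2_span_closureE[OF g(1) \<epsilon>4])
  have eq: "f x - (\<Sum>i\<in>F. a i * e i x) = (f x - g x) + (g x - (\<Sum>i\<in>F. a i * e i x))" for x by simp
  have "(\<integral>x. (norm (f x - (\<Sum>i\<in>F. a i * e i x)))\<^sup>2 \<partial>M)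
      \<le> 2 * (\<integral>x. (norm (f x - g x))\<^sup>2 \<partial>M) + 2 * (\<integral>x. (norm (g x - (\<Sum>i\<in>F. a i * e i x)))\<^sup>2 \<partial>M)"
    unfolding eq
    by (intro L2_distance_triangle square_integrable_diff square_integrable_sum f e
        L2_span_closure_square_integrable[OF g(1)]) (use F in auto)
  also have "\<dots> < \<epsilon>" using F(3) g(2) by linarith
  finally show "\<exists>F a. finite F \<and> F \<subseteq> I \<and> (\<integral>x. (norm (f x - (\<Sum>i\<in>F. a i * e i x)))\<^sup>2 \<partial>M) < \<epsilon>"
    using F by blast
qed

lemma L2_span_closure_cmult:
  assumes f: "f \<in> L2_span_closure M I e"
  shows "(\<lambda>x. c * f x) \<in> L2_span_closure M I e"
proof (cases "c = 0")
  case True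
  have "square_integrable M (\<lambda>x. 0)" by (simp add: square_integrable_def)
  then show ?thesis using True unfolding L2_span_closure_def by (auto intro!: exI[of _ "{}"])
next
  case False
  show ?thesis
    unfolding L2_span_closure_def
  proof (intro CollectI conjI allI impI)
    show "square_integrable M (\<lambda>x. c * f x)"
      by (intro square_integrable_cmult L2_span_closure_square_integrable[OF f])
    fix \<epsilon> :: real assume \<epsilon>: "\<epsilon> > 0"
    then have "\<epsilon> / (norm c)\<^sup>2 > 0" using False by simp
    then obtain F a where F: "finite F" "F \<subseteq> I"
      "(\<integral>x. (norm (f x - (\<Sum>i\<in>F. a i * e i x)))\<^sup>2 \<partial>M) < \<epsilon> / (norm c)\<^sup>2"
      by (rule L2_span_closureE[OF f])
    have "c * f x - (\<Sum>i\<in>F. c * a i * e i x) = c * (f x - (\<Sum>i\<in>F. a i * e i x))" for x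
      by (simp add: right_diff_distrib sum_distrib_left mult.assoc)
    then have "(\<integral>x. (norm (c * f x - (\<Sum>i\<in>F. c * a i * e i x)))\<^sup>2 \<partial>M) < \<epsilon>"
      using F(3) False by (simp add: norm_mult power_mult_distrib pos_less_divide_eq mult.commute)
    then show "\<exists>F a. finite F \<and> F \<subseteq> I \<and> (\<integral>x. (norm (c * f x - (\<Sum>i\<in>F. a i * e i x)))\<^sup>2 \<partial>M) < \<epsilon>"
      using F by (intro exI[of _ F] exI[of _ "\<lambda>i. c * a i"]) auto
  qed
qed

lemma L2_span_closure_zero: "(\<lambda>x. 0) \<in> L2_span_closure M I e"
  by (auto simp: L2_span_closure_def square_integrable_def intro!: exI[of _ "{}"])

lemma L2_span_closure_sum:
  "(\<And>j. j \<in> J \<Longrightarrow> h j \<in> L2_span_closure M I e) \<Longrightarrow> (\<lambda>x. \<Sum>j\<in>J. c j * h j x) \<in> L2_span_closure M I e"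
  by (induction J rule: infinite_finite_induct)
    (simp_all add: L2_span_closure_add L2_span_closure_cmult L2_span_closure_zero)

text \<open>Turns pointwise limits with a square-integrable majorant into limits in mean square, by
  dominated convergence with majorant 4w^2. All approximation steps of the density proof go through
  it.\<close>

lemma L2_span_closure_dominated:
  assumes g: "\<And>n. g n \<in> L2_span_closure M I e" and f [measurable]: "f \<in> borel_measurable M"
    and lim: "AE x in M. (\<lambda>n. g n x) \<longlonglongrightarrow> f x"
    and bd: "\<And>n. AE x in M. norm (g n x) \<le> w x" and w: "integrable M (\<lambda>x. (w x)\<^sup>2)"
  shows "f \<in> L2_span_closure M I e"
proof (rule L2_span_closure_limit)
  have [measurable]: "g n \<in> borel_measurable M" for n
    using L2_span_closure_square_integrable[OF g[of n]] by (simp add: square_integrable_def)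
  have bd': "AE x in M. \<forall>n. norm (g n x) \<le> w x" using bd by (simp add: AE_all_countable)
  have fw: "AE x in M. norm (f x) \<le> w x"
    using lim bd' by eventually_elim (auto intro: LIMSEQ_le_const2 tendsto_norm)
  show "square_integrable M f"
    unfolding square_integrable_def
  proof
    show "integrable M (\<lambda>x. (norm (f x))\<^sup>2)"
    proof (rule Bochner_Integration.integrable_bound[OF w])
      show "AE x in M. norm ((norm (f x))\<^sup>2) \<le> norm ((w x)\<^sup>2)"
        using fw by eventually_elim (simp add: power_mono)
    qed measurable
  qed measurable
  have "(\<lambda>n. \<integral>x. (norm (f x - g n x))\<^sup>2 \<partial>M) \<longlonglongrightarrow> (\<integral>x. 0 \<partial>M)"
  proof (rule integral_dominated_convergence[where w = "\<lambda>x. 4 * (w x)\<^sup>2"])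
    show "AE x in M. (\<lambda>n. (norm (f x - g n x))\<^sup>2) \<longlonglongrightarrow> 0"
      using lim
    proof eventually_elim
      case (elim x)
      then have "(\<lambda>n. (norm (f x - g n x))\<^sup>2) \<longlonglongrightarrow> (norm (f x - f x))\<^sup>2" by (intro tendsto_intros)
      then show ?case by simp
    qed
    show "AE x in M. norm ((norm (f x - g n x))\<^sup>2) \<le> 4 * (w x)\<^sup>2" for n
      using fw bd'
    proof eventually_elim
      case (elim x)
      have "norm (f x - g n x) \<le> 2 * w x" using elim norm_triangle_ineq4[of "f x" "g n x"]
        by (smt (verit, best))
      then have "(norm (f x - g n x))\<^sup>2 \<le> (2 * w x)\<^sup>2" by (intro power_mono) auto
      then show ?case by (simp add: power_mult_distrib)
    qed
  qed (use w in auto)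
  then have "(\<lambda>n. \<integral>x. (norm (f x - g n x))\<^sup>2 \<partial>M) \<longlonglongrightarrow> 0" by simp
  from eventually_happens[OF order_tendstoD(2)[OF this]] show "\<exists>g\<in>L2_span_closure M I e. (\<integral>x. (norm (f x - g x))\<^sup>2 \<partial>M) < \<epsilon>" if "\<epsilon> > 0" for \<epsilon>
    using that g by auto
qed

end

section \<open>From exponentials to all square-integrable functions\<close>

lemma norm_echar_minus_1: "norm (echar u - 1) \<le> 2 * pi * \<bar>u\<bar>"
  using iexp_approx1[of "- (2 * pi * u)" 0] by (simp add: echar_def cis_conv_exp abs_mult)

text \<open>The derivative of the exponential at 0, sampled at 1/(k+1): it recovers the coordinate
  function from exponentials.\<close>

lemma echar_difference_quotient_tendsto:
  "(\<lambda>k. (echar (x / real (Suc k)) - 1) / (- 2 * of_real pi * \<i> / of_nat (Suc k))) \<longlonglongrightarrow> of_real x"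
proof -
  define c where "c = - 2 * of_real pi * \<i>"
  have "((\<lambda>z. exp (c * of_real x * z)) has_field_derivative c * of_real x) (at 0)"
    by (auto intro!: derivative_eq_intros)
  then have "((\<lambda>z. (exp (c * of_real x * z) - 1) / z) \<longlongrightarrow> c * of_real x) (at 0)"
    by (simp add: has_field_derivative_iff)
  moreover have "filterlim (\<lambda>k. 1 / of_nat (Suc k) :: complex) (at 0) sequentially"
  proof (rule filterlim_atI)
    have "(\<lambda>k. of_real (1 / real (Suc k)) :: complex) \<longlonglongrightarrow> of_real 0"
      by (intro tendsto_of_real) (use LIMSEQ_inverse_real_of_nat in \<open>simp add: inverse_eq_divide\<close>)
    then show "(\<lambda>k. 1 / of_nat (Suc k) :: complex) \<longlonglongrightarrow> 0" by simp
  qed (simp del: of_nat_Suc)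
  ultimately have "(\<lambda>k. (exp (c * of_real x * (1 / of_nat (Suc k))) - 1) / (1 / of_nat (Suc k)))
      \<longlonglongrightarrow> c * of_real x"
    by (rule filterlim_compose)
  then have "(\<lambda>k. (exp (c * of_real x * (1 / of_nat (Suc k))) - 1) / (1 / of_nat (Suc k)) / c)
      \<longlonglongrightarrow> c * of_real x / c"
    by (intro tendsto_divide tendsto_const) (auto simp: c_def)
  moreover have "exp (c * of_real x * (1 / of_nat (Suc k))) = echar (x / real (Suc k))" for k
    by (simp add: c_def echar_def cis_conv_exp mult_ac)
  ultimately show ?thesis by (simp add: c_def field_simps del: of_nat_Suc)
qed

text \<open>A power of a difference quotient is again a combination of exponentials, and on the
  bounded support it is dominated by \<open>R ^ n\<close>; this yields monomials. Weierstrass then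
  gives bounded continuous functions, from which half-lines, Borel sets, simple functions and
  finally \<open>f\<close> arise as dominated limits.\<close>

lemma exponentials_dense_L2:
  fixes \<mu> :: "real measure" and I :: "'i set" and e :: "'i \<Rightarrow> real \<Rightarrow> complex"
  assumes \<mu>: "real_distribution \<mu>" and R: "AE x in \<mu>. \<bar>x\<bar> \<le> R"
    and e: "\<forall>i\<in>I. square_integrable \<mu> (e i)"
    and exps: "\<And>\<xi>. (\<lambda>x. echar (\<xi> * x)) \<in> L2_span_closure \<mu> I e"
    and f: "square_integrable \<mu> f"
  shows "f \<in> L2_span_closure \<mu> I e"
proof -
  interpret real_distribution \<mu> by (rule \<mu>)
  let ?A = "L2_span_closure \<mu> I e"
  note add = L2_span_closure_add[where e = e, OF e] and cmult = L2_span_closure_cmult[where e = e, OF e]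
    and sumA = L2_span_closure_sum[where e = e, OF e] and dom = L2_span_closure_dominated[where e = e, OF e]
  have monomial: "(\<lambda>x. of_real x ^ n) \<in> ?A" for n
  proof (rule dom[where w = "\<lambda>x. R ^ n"])
    define g where "g k x = ((echar (x / real (Suc k)) - 1) / (- 2 * of_real pi * \<i> / of_nat (Suc k))) ^ n"
      for k x
    show "g k \<in> ?A" for k
    proof -
      define c where "c = (1 / (- 2 * of_real pi * \<i> / of_nat (Suc k))) ^ n"
      have "g k x = c * (\<Sum>j\<le>n. (of_nat (n choose j) * (- 1) ^ (n - j)) * echar (real j / real (Suc k) * x))" for x
      proof -
        have "g k x = c * (echar (x / real (Suc k)) + (- 1)) ^ n"
          unfolding g_def c_def power_mult_distrib[symmetric] by (simp add: mult.commute)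
        also have "(echar (x / real (Suc k)) + (- 1)) ^ n =
            (\<Sum>j\<le>n. (of_nat (n choose j) * (- 1) ^ (n - j)) * echar (real j / real (Suc k) * x))"
          unfolding binomial_ring by (simp add: echar_power mult_ac del: of_nat_Suc)
        finally show ?thesis .
      qed
      then have "g k = (\<lambda>x. c * (\<Sum>j\<le>n. (of_nat (n choose j) * (- 1) ^ (n - j)) * echar (real j / real (Suc k) * x)))"
        by blast
      also have "\<dots> \<in> ?A" by (intro cmult sumA exps)
      finally show ?thesis .
    qed
    show "AE x in \<mu>. (\<lambda>k. g k x) \<longlonglongrightarrow> of_real x ^ n"
      unfolding g_def by (intro AE_I2 tendsto_power echar_difference_quotient_tendsto)
    show "AE x in \<mu>. norm (g k x) \<le> R ^ n" for k
      using R
    proof eventually_elim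
      case (elim x)
      have "norm (echar (x / real (Suc k)) - 1) \<le> 2 * pi * \<bar>x\<bar> / real (Suc k)"
        using norm_echar_minus_1[of "x / real (Suc k)"] by (simp add: abs_divide del: of_nat_Suc)
      also have "\<dots> \<le> 2 * pi * R / real (Suc k)" using elim by (intro divide_right_mono mult_left_mono) auto
      finally have "norm (echar (x / real (Suc k)) - 1) * real (Suc k) / (2 * pi) \<le> R"
        by (simp add: field_simps del: of_nat_Suc)
      then have "norm ((echar (x / real (Suc k)) - 1) / (- 2 * of_real pi * \<i> / of_nat (Suc k))) \<le> R"
        unfolding norm_divide norm_mult norm_of_nat norm_minus_cancel by simp
      then show ?case unfolding g_def norm_power by (intro power_mono) auto
    qed
  qed auto
  have poly: "(\<lambda>x. of_real (p x)) \<in> ?A" if pp: "real_polynomial_function p" for p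
  proof -
    obtain a n where p: "p = (\<lambda>x. \<Sum>i\<le>n. a i * x ^ i)"
      using pp unfolding real_polynomial_function_iff_sum by blast
    have "(\<lambda>x. \<Sum>i\<le>n. of_real (a i) * of_real x ^ i) \<in> ?A" by (intro sumA monomial)
    then show ?thesis by (simp add: p)
  qed
  have cont: "(\<lambda>x. of_real (g x)) \<in> ?A"
    if g: "continuous_on UNIV g" and g1: "\<And>x. \<bar>g x\<bar> \<le> 1" for g :: "real \<Rightarrow> real"
  proof -
    have "\<exists>p. real_polynomial_function p \<and> (\<forall>x\<in>{-R..R}. \<bar>g x - p x\<bar> < 1 / real (Suc n))" for n
      using Stone_Weierstrass_real_polynomial_function[of "{-R..R}" g "1 / real (Suc n)"]
        continuous_on_subset[OF g] by (metis compact_Icc subset_UNIV of_nat_0_less_iff zero_less_Suc zero_less_divide_1_iff)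
    then obtain p where p: "\<And>n. real_polynomial_function (p n)"
      "\<And>n x. x \<in> {-R..R} \<Longrightarrow> \<bar>g x - p n x\<bar> < 1 / real (Suc n)" by metis
    show ?thesis
    proof (rule dom[where w = "\<lambda>x. 2" and g = "\<lambda>n x. of_real (p n x)"])
      show "(\<lambda>x. of_real (p n x)) \<in> ?A" for n by (rule poly[OF p(1)])
      have [measurable]: "g \<in> borel_measurable borel" using g by (rule borel_measurable_continuous_onI)
      show "(\<lambda>x. of_real (g x) :: complex) \<in> borel_measurable \<mu>" by measurable
      show "AE x in \<mu>. (\<lambda>n. of_real (p n x)) \<longlonglongrightarrow> (of_real (g x) :: complex)"
        using R
      proof eventually_elim
        case (elim x)
        have "(\<lambda>n. p n x) \<longlonglongrightarrow> g x"
        proof (rule LIM_zero_cancel, rule Lim_null_comparison[OF _ LIMSEQ_inverse_real_of_nat])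
          have "norm (p n x - g x) \<le> inverse (real (Suc n))" for n
          proof -
            have "x \<in> {-R..R}" using elim by auto
            then show ?thesis using p(2)[of x n] by (simp add: abs_minus_commute inverse_eq_divide)
          qed
          then show "\<forall>\<^sub>F n in sequentially. norm (p n x - g x) \<le> inverse (real (Suc n))"
            by (intro always_eventually allI)
        qed
        then show ?case by (rule tendsto_of_real)
      qed
      show "AE x in \<mu>. norm (of_real (p n x) :: complex) \<le> 2" for n
        using R
      proof eventually_elim
        case (elim x)
        have "x \<in> {-R..R}" using elim by auto
        then have "\<bar>g x - p n x\<bar> < 1 / real (Suc n)" by (rule p(2))
        also have "\<dots> \<le> 1" by simp
        finally show ?case using g1[of x] by simp
      qed
    qed auto
  qed
  have halfline: "(\<lambda>x. indicator {..a} x) \<in> ?A" for a :: real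
  \<comment> \<open>For n > 0 these functions are 1 up to \<open>a\<close> and descend linearly to 0
    on the interval from \<open>a\<close> to a + 1/n.\<close>
  proof (rule dom[where w = "\<lambda>x. 1" and g = "\<lambda>n x. of_real (max 0 (min 1 (1 - real n * (x - a))))"])
    show "(\<lambda>x. of_real (max 0 (min 1 (1 - real n * (x - a))))) \<in> ?A" for n
      by (intro cont continuous_intros) auto
    show "AE x in \<mu>. (\<lambda>n. of_real (max 0 (min 1 (1 - real n * (x - a))))) \<longlonglongrightarrow> (indicator {..a} x :: complex)"
    proof (rule AE_I2)
      fix x
      show "(\<lambda>n. of_real (max 0 (min 1 (1 - real n * (x - a))))) \<longlonglongrightarrow> (indicator {..a} x :: complex)"
      proof (cases "x \<le> a")
        case True
        then have "max 0 (min 1 (1 - real n * (x - a))) = 1" for n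
          using mult_nonneg_nonpos[of "real n" "x - a"] by simp
        then show ?thesis using True by simp
      next
        case False
        then obtain N where N: "1 < real N * (x - a)" using reals_Archimedean3[of "x - a"] by auto
        have "max 0 (min 1 (1 - real n * (x - a))) = 0" if "n \<ge> N" for n
        proof -
          have "real N * (x - a) \<le> real n * (x - a)" using that False by (intro mult_right_mono) auto
          then show ?thesis using N by simp
        qed
        then have "\<forall>\<^sub>F n in sequentially. of_real (max 0 (min 1 (1 - real n * (x - a)))) = (indicator {..a} x :: complex)"
          using False by (auto simp: eventually_sequentially intro!: exI[of _ N])
        then show ?thesis by (rule tendsto_eventually)
      qed
    qed
  qed auto
  have one: "(\<lambda>x. 1) \<in> ?A" using exps[of 0] by simp
  have ind: "(\<lambda>x. indicator E x) \<in> ?A" if "E \<in> sets borel" for E :: "real set"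
  proof -
    have "sets borel = sigma_sets UNIV (range (\<lambda>a::real. {..a}))" by (simp add: borel_eq_atMost)
    then have sig: "E \<in> sigma_sets UNIV (range (\<lambda>a::real. {..a}))"
      and sets: "\<And>F. F \<in> sigma_sets UNIV (range (\<lambda>a::real. {..a})) \<Longrightarrow> F \<in> sets borel"
      using that by auto
    have "Int_stable (range (\<lambda>a::real. {..a}))" by (auto simp: Int_stable_def)
    moreover have "range (\<lambda>a::real. {..a}) \<subseteq> Pow UNIV" by simp
    ultimately show ?thesis using sig
    proof (induction rule: sigma_sets_induct_disjoint)
      case (basic F)
      then show ?case using halfline by auto
    next
      case empty
      show ?case using cmult[OF one, of 0] by simp
    next
      case (compl F)
      have "(\<lambda>x. 1 + (- 1) * indicator F x) \<in> ?A" by (intro add one cmult compl)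
      moreover have "1 + (- 1) * indicator F x = (indicator (UNIV - F) x :: complex)" for x
        by (simp add: indicator_def)
      ultimately show ?case by simp
    next
      case (union F)
      have F [measurable]: "F i \<in> sets borel" for i using union(2) by (intro sets) auto
      show ?case
      proof (rule dom[where w = "\<lambda>x. 1" and g = "\<lambda>n x. indicator (\<Union>i<n. F i) x"])
        show "(\<lambda>x. indicator (\<Union>i<n. F i) x) \<in> ?A" for n
        proof -
          have "(\<lambda>x. \<Sum>i<n. 1 * indicator (F i) x) \<in> ?A" by (intro sumA union)
          moreover have "indicator (\<Union>i<n. F i) x = (\<Sum>i<n. indicator (F i) x :: complex)" for x
            using union(1) by (intro indicator_UN_disjoint) (auto simp: disjoint_family_on_def)
          ultimately show ?thesis by simp
        qed
        show "AE x in \<mu>. (\<lambda>n. indicator (\<Union>i<n. F i) x) \<longlonglongrightarrow> (indicator (\<Union>i. F i) x :: complex)"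
          by (intro AE_I2 LIMSEQ_indicator_UN)
        show "AE x in \<mu>. norm (indicator (\<Union>i<n. F i) x :: complex) \<le> 1" for n
          by (intro AE_I2) (simp add: indicator_def)
      qed auto
    qed
  qed
  have simple: "s \<in> ?A" if s: "simple_function \<mu> s" for s :: "real \<Rightarrow> complex"
  proof -
    have mem: "(\<lambda>x. \<Sum>y\<in>s ` space \<mu>. y * indicator (s -` {y} \<inter> space \<mu>) x) \<in> ?A"
    proof (intro sumA ind)
      show "s -` {y} \<inter> space \<mu> \<in> sets borel" for y
        using simple_functionD(2)[OF s, of "{y}"] by simp
    qed
    have rep: "s x = (\<Sum>y\<in>s ` space \<mu>. y * indicator (s -` {y} \<inter> space \<mu>) x)" for x
    proof -
      have "s x = (\<Sum>y\<in>s ` space \<mu>. indicator (s -` {y} \<inter> space \<mu>) x *\<^sub>R y)"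
        by (rule simple_function_indicator_representation_banach[OF s]) simp
      also have "\<dots> = (\<Sum>y\<in>s ` space \<mu>. y * indicator (s -` {y} \<inter> space \<mu>) x)"
        by (intro sum.cong refl) (simp add: indicator_def)
      finally show ?thesis .
    qed
    from rep have "(\<lambda>x. \<Sum>y\<in>s ` space \<mu>. y * indicator (s -` {y} \<inter> space \<mu>) x) = s" by (rule ext[OF sym])
    with mem show ?thesis by (rule back_subst[where P = "\<lambda>h. h \<in> ?A"])
  qed
  have [measurable]: "f \<in> borel_measurable \<mu>" using f by (simp add: square_integrable_def)
  obtain F where F: "\<And>i. simple_function \<mu> (F i)" "\<And>x. (\<lambda>i. F i x) \<longlonglongrightarrow> f x"
      "\<And>i x. dist (F i x) 0 \<le> 2 * dist (f x) 0"
    using borel_measurable_implies_sequence_metric[of f \<mu> 0] by auto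
  show ?thesis
  proof (rule dom[where g = F and w = "\<lambda>x. 2 * norm (f x)"])
    show "integrable \<mu> (\<lambda>x. (2 * norm (f x))\<^sup>2)"
      using f by (simp add: square_integrable_def power_mult_distrib)
  qed (use F simple in auto)
qed

section \<open>The partial sums of squared Fourier coefficients\<close>

text \<open>Up to the factor \<open>card D\<close> the mask is the restriction of an entire function
  with nonzero value at 0. Either this function is constant and has no zeros, or its zeros in a
  compact set are finite in number.\<close>

lemma finite_mask_zeros:
  assumes "finite D" "D \<noteq> {}"
  shows "finite {u\<in>{-A..A}. mask D u = 0}"
proof -
  define f where "f z = (\<Sum>d\<in>D. exp (- 2 * of_real pi * \<i> * of_int d * z))" for z :: complex
  have f_real: "f (of_real u) = of_nat (card D) * mask D u" for u
    using assms by (simp add: f_def mask_def echar_def cis_conv_exp mult_ac)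
  have "finite {z\<in>complex_of_real ` {-A..A}. f z = 0}"
  proof (cases "f constant_on UNIV")
    case True
    moreover have "f 0 \<noteq> 0" using assms by (simp add: f_def)
    ultimately have "f z \<noteq> 0" for z by (metis constant_on_def UNIV_I)
    then show ?thesis by simp
  next
    case False
    show ?thesis
    proof (rule holomorphic_compact_finite_zeros[where S = UNIV])
      show "f holomorphic_on UNIV" unfolding f_def by (intro holomorphic_intros)
      show "compact (complex_of_real ` {-A..A})"
        by (intro compact_continuous_image continuous_intros) simp
    qed (use False in auto)
  qed
  moreover have "complex_of_real ` {u\<in>{-A..A}. mask D u = 0} \<subseteq> {z\<in>complex_of_real ` {-A..A}. f z = 0}"
    by (auto simp: f_real)
  ultimately have "finite (complex_of_real ` {u\<in>{-A..A}. mask D u = 0})" using finite_subset by blast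
  then show ?thesis by (rule finite_imageD) (simp add: inj_on_def)
qed

lemma mask_add_int: "mask D (u + of_int n) = mask D u"
proof -
  have "echar (of_int d * (u + of_int n)) = echar (of_int d * u)" for d :: int
    using echar_of_int[of "d * n"] by (simp add: distrib_left echar_add del: echar_of_int)
  then show ?thesis by (simp add: mask_def)
qed

lemma continuous_on_mask: "continuous_on S (mask D)"
  unfolding mask_def divide_inverse by (intro continuous_intros)

lemma Gcd_mult_in_Ints:
  fixes y :: real and D :: "int set"
  assumes "finite D" "\<And>d. d \<in> D \<Longrightarrow> of_int d * y \<in> \<int>"
  shows "of_int (Gcd D) * y \<in> \<int>"
  using assms
proof (induction D rule: finite_induct)
  case (insert d D)
  obtain u v where uv: "u * d + v * Gcd D = gcd d (Gcd D)" using bezout_int by blast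
  have "of_int (Gcd (insert d D)) * y = of_int u * (of_int d * y) + of_int v * (of_int (Gcd D) * y)"
    by (simp flip: uv add: algebra_simps)
  then have eq: "of_int (Gcd (insert d D)) * y = of_int u * (of_int d * y) + of_int v * (of_int (Gcd D) * y)" .
  have "of_int d * y \<in> \<int>" "of_int (Gcd D) * y \<in> \<int>" using insert by auto
  then show ?case unfolding eq using Ints_add Ints_mult Ints_of_int by metis
qed simp

text \<open>Equality case of the triangle inequality: all summands equal the normalised sum.\<close>

lemma norm_mask_eq_1_imp_Ints:
  assumes D: "finite D" "0 \<in> D" "Gcd D = 1" and y: "norm (mask D y) = 1"
  shows "y \<in> \<int>"
proof -
  define w where "w = mask D y"
  have N: "card D > 0" using D by (auto simp: card_gt_0_iff)
  have ww: "w * cnj w = 1" using y complex_norm_square[of w] by (simp add: w_def)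
  have S: "(\<Sum>d\<in>D. echar (of_int d * y)) = of_nat (card D) * w" using N by (simp add: w_def mask_def)
  have e1: "echar v * cnj (echar v) = 1" for v using complex_norm_square[of "echar v"] by simp
  have "of_real (\<Sum>d\<in>D. (norm (echar (of_int d * y) - w))\<^sup>2) =
      (\<Sum>d\<in>D. (echar (of_int d * y) - w) * cnj (echar (of_int d * y) - w))"
    by (simp only: of_real_sum complex_norm_square)
  also have "\<dots> = (\<Sum>d\<in>D. 2 - echar (of_int d * y) * cnj w - w * cnj (echar (of_int d * y)))"
  proof (rule sum.cong)
    fix d
    show "(echar (of_int d * y) - w) * cnj (echar (of_int d * y) - w) =
        2 - echar (of_int d * y) * cnj w - w * cnj (echar (of_int d * y))"
      using e1[of "of_int d * y"] ww by (simp add: left_diff_distrib right_diff_distrib)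
  qed simp
  also have "\<dots> = 2 * of_nat (card D) - (\<Sum>d\<in>D. echar (of_int d * y)) * cnj w
      - w * cnj (\<Sum>d\<in>D. echar (of_int d * y))"
    by (simp add: sum_subtractf sum_distrib_left sum_distrib_right)
  also have "\<dots> = 0"
    unfolding S using ww by (simp add: mult.assoc mult.left_commute)
  finally have "(\<Sum>d\<in>D. (norm (echar (of_int d * y) - w))\<^sup>2) = 0" by (simp only: of_real_eq_0_iff)
  then have eq: "echar (of_int d * y) = w" if "d \<in> D" for d
    using D(1) that by (simp add: sum_nonneg_eq_0_iff)
  \<comment> \<open>The element 0 of \<open>D\<close> contributes the summand 1, which fixes the
    common value.\<close>
  have "w = 1" using eq[OF D(2)] by simp
  then have "of_int d * y \<in> \<int>" if "d \<in> D" for d using eq[OF that] echar_eq_1_iff by simp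
  then show ?thesis using Gcd_mult_in_Ints[OF D(1), of y] D(3) by simp
qed

text \<open>The finite stages of \<open>Lambda\<close>. Here n = 0 is allowed: the empty sum
  \<open>{0}\<close> is the base of the recursions.\<close>

definition partial_spectrum :: "nat \<Rightarrow> int set \<Rightarrow> nat \<Rightarrow> int set" where
  "partial_spectrum b C n = (\<Sum>j<n. (int b ^ j) *o C)"

lemma partial_spectrum_eq:
  "partial_spectrum b C n = {\<Sum>j<n. int b ^ j * c j | c. \<forall>j<n. c j \<in> C}"
proof -
  have "partial_spectrum b C n = {sum s {..<n} |s. \<forall>j\<in>{..<n}. s j \<in> (int b ^ j) *o C}"
    unfolding partial_spectrum_def by (rule set_sum_alt) simp
  also have "\<dots> = {\<Sum>j<n. int b ^ j * c j | c. \<forall>j<n. c j \<in> C}"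
  proof (intro equalityI subsetI)
    fix x assume "x \<in> {sum s {..<n} |s. \<forall>j\<in>{..<n}. s j \<in> (int b ^ j) *o C}"
    then obtain s where s: "x = sum s {..<n}" "\<And>j. j < n \<Longrightarrow> s j \<in> (int b ^ j) *o C" by auto
    have "\<forall>j. \<exists>c. j < n \<longrightarrow> c \<in> C \<and> s j = int b ^ j * c" using s(2) unfolding elt_set_times_def by blast
    then obtain c where "\<And>j. j < n \<Longrightarrow> c j \<in> C \<and> s j = int b ^ j * c j" by metis
    then show "x \<in> {\<Sum>j<n. int b ^ j * c j | c. \<forall>j<n. c j \<in> C}" using s(1) by (auto intro!: exI[of _ c] sum.cong)
  next
    fix x assume "x \<in> {\<Sum>j<n. int b ^ j * c j | c. \<forall>j<n. c j \<in> C}"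
    then obtain c where "x = (\<Sum>j<n. int b ^ j * c j)" "\<forall>j<n. c j \<in> C" by blast
    then show "x \<in> {sum s {..<n} |s. \<forall>j\<in>{..<n}. s j \<in> (int b ^ j) *o C}"
      by (auto simp: elt_set_times_def intro!: exI[of _ "\<lambda>j. int b ^ j * c j"])
  qed
  finally show ?thesis .
qed

lemma partial_spectrum_0 [simp]: "partial_spectrum b C 0 = {0}"
  by (simp add: partial_spectrum_eq)

text \<open>Splits off the least significant digit rather than the leading one, since this is the
  digit exposed by the division by \<open>b\<close> in the functional equation of the
  transform.\<close>

lemma partial_spectrum_Suc:
  "partial_spectrum b C (Suc n) = (\<lambda>(c, l). c + int b * l) ` (C \<times> partial_spectrum b C n)"
proof (intro equalityI subsetI)
  fix x assume "x \<in> partial_spectrum b C (Suc n)"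
  then obtain c where c: "x = (\<Sum>j<Suc n. int b ^ j * c j)" "\<forall>j<Suc n. c j \<in> C"
    by (auto simp only: partial_spectrum_eq mem_Collect_eq)
  have "x = c 0 + int b * (\<Sum>j<n. int b ^ j * c (Suc j))"
    unfolding c(1) sum.lessThan_Suc_shift by (simp add: sum_distrib_left mult_ac)
  moreover have "c 0 \<in> C" "(\<Sum>j<n. int b ^ j * c (Suc j)) \<in> partial_spectrum b C n"
    using c(2) by (auto simp: partial_spectrum_eq)
  ultimately show "x \<in> (\<lambda>(c, l). c + int b * l) ` (C \<times> partial_spectrum b C n)" by force
next
  fix x assume "x \<in> (\<lambda>(c, l). c + int b * l) ` (C \<times> partial_spectrum b C n)"
  then obtain c0 c where c: "x = c0 + int b * (\<Sum>j<n. int b ^ j * c j)" "c0 \<in> C" "\<forall>j<n. c j \<in> C"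
    by (auto simp: partial_spectrum_eq)
  have "x = (\<Sum>j<Suc n. int b ^ j * case_nat c0 c j)"
    unfolding c(1) sum.lessThan_Suc_shift by (simp add: sum_distrib_left mult_ac)
  moreover have "\<forall>j<Suc n. case_nat c0 c j \<in> C" using c by (auto split: nat.split)
  ultimately show "x \<in> partial_spectrum b C (Suc n)"
    by (auto simp only: partial_spectrum_eq mem_Collect_eq)
qed

text \<open>The assumptions \<open>columns\<close> and \<open>rows\<close> are the unitarity
  relations of the triple with digit set tC, written as vanishing exponential sums.\<close>

locale hadamard_pair =
  fixes b t :: nat and D C :: "int set" and \<mu> :: "real measure"
  assumes b: "b > 2" and D: "finite D" "0 \<in> D" "Gcd D = 1"
    and C: "finite C" "0 \<in> C" "C \<subseteq> {0..int b - 2}" "card D = card C"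
    and t: "t \<ge> 1" "coprime t b"
    and columns: "\<And>c c'. c \<in> C \<Longrightarrow> c' \<in> C \<Longrightarrow> c \<noteq> c' \<Longrightarrow>
      (\<Sum>d\<in>D. echar (real_of_int (int t * ((c - c') * d)) / b)) = 0"
    and rows: "\<And>d d'. d \<in> D \<Longrightarrow> d' \<in> D \<Longrightarrow> d \<noteq> d' \<Longrightarrow>
      (\<Sum>c\<in>C. echar (real_of_int (int t * (c * (d - d'))) / b)) = 0"
    and \<mu>: "invariant_measure b D \<mu>"
begin

lemma b1: "b > 1" and D_ne: "D \<noteq> {}"
  using b D by auto

sublocale real_distribution \<mu>
  by (rule invariant_measure_real_distribution[OF b1 D(1) D_ne \<mu>])

abbreviation "F \<equiv> fourier \<mu>"
abbreviation "m \<equiv> mask D"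

definition branch :: "int \<Rightarrow> real \<Rightarrow> real" where
  "branch c x = (x + real t * of_int c) / b"

lemma F_eq: "F x = m (x / b) * F (x / b)"
  by (rule fourier_invariant_measure[OF b1 D(1) D_ne \<mu>])

lemma F_0: "F 0 = 1"
  by (simp add: fourier_eq_char char_zero)

lemma F_uminus: "F (- x) = cnj (F x)"
  proof -
  have "F (- x) = (\<integral>y. cnj (echar (x * y)) \<partial>\<mu>)" by (simp only: fourier_def cnj_echar mult_minus_left)
  then show ?thesis by (simp add: fourier_def Bochner_Integration.integral_cnj)
qed

lemma continuous_on_F: "continuous_on S F"
  unfolding fourier_eq_char
  by (intro continuous_at_imp_continuous_on ballI continuous_at_compose[OF _ isCont_char, unfolded comp_def]
      continuous_intros)

lemma digits_inj:
  assumes "c \<in> C" "c' \<in> C" "int b dvd c - c'"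
  shows "c = c'"
proof (rule ccontr)
  assume "c \<noteq> c'"
  then have "\<bar>int b\<bar> \<le> \<bar>c - c'\<bar>" using assms(3) by (intro dvd_imp_le_int) auto
  moreover have "c \<in> {0..int b - 2}" "c' \<in> {0..int b - 2}" using assms(1,2) C(3) by blast+
  ultimately show False by auto
qed

lemma mask_digit_difference:
  assumes "c \<in> C" "c' \<in> C" "c \<noteq> c'"
  shows "m (of_int n + real t * of_int (c - c') / b) = 0"
proof -
  have "m (real t * of_int (c - c') / b) = 0"
    unfolding mask_def using columns[OF assms]
    by (simp add: mult_ac)
  then show ?thesis using mask_add_int[of D "real t * of_int (c - c') / b" n] by (simp add: add.commute)
qed

text \<open>Expanding the squared modulus gives a double sum over \<open>D\<close>; summing over
  \<open>C\<close> removes its off-diagonal part by the orthogonality of rows. The squared masks are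
  thus transition probabilities for the branches.\<close>

lemma sum_norm_mask_branch: "(\<Sum>c\<in>C. (norm (m (branch c x)))\<^sup>2) = 1"
proof -
  define N where "N = card D"
  have N: "N > 0" using D D_ne by (simp add: N_def card_gt_0_iff)
  have sq: "complex_of_real ((norm (m u))\<^sup>2) = (\<Sum>d\<in>D. \<Sum>d'\<in>D. echar (of_int (d - d') * u)) / (of_nat N)\<^sup>2" for u
  proof -
    have "complex_of_real ((norm (m u))\<^sup>2) = m u * cnj (m u)" by (rule complex_norm_square)
    also have "\<dots> = (\<Sum>d\<in>D. echar (of_int d * u)) * (\<Sum>d'\<in>D. echar (- (of_int d' * u))) / (of_nat N)\<^sup>2"
      by (simp add: mask_def N_def cnj_echar power2_eq_square)
    also have "(\<Sum>d\<in>D. echar (of_int d * u)) * (\<Sum>d'\<in>D. echar (- (of_int d' * u))) =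
        (\<Sum>d\<in>D. \<Sum>d'\<in>D. echar (of_int (d - d') * u))"
      unfolding sum_product by (simp flip: echar_add add: left_diff_distrib)
    finally show ?thesis .
  qed
  have "complex_of_real (\<Sum>c\<in>C. (norm (m (branch c x)))\<^sup>2) =
      (\<Sum>c\<in>C. \<Sum>d\<in>D. \<Sum>d'\<in>D. echar (of_int (d - d') * branch c x)) / (of_nat N)\<^sup>2"
    by (simp add: sq sum_divide_distrib del: of_real_power)
  also have "(\<Sum>c\<in>C. \<Sum>d\<in>D. \<Sum>d'\<in>D. echar (of_int (d - d') * branch c x)) =
      (\<Sum>d\<in>D. \<Sum>d'\<in>D. \<Sum>c\<in>C. echar (of_int (d - d') * branch c x))"
    by (subst sum.swap) (rule sum.cong[OF refl], rule sum.swap)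
  also have "\<dots> = (\<Sum>d\<in>D. \<Sum>d'\<in>D. if d = d' then of_nat N else 0)"
  proof (intro sum.cong refl)
    fix d d' assume d: "d \<in> D" "d' \<in> D"
    have "of_int (d - d') * branch c x = of_int (d - d') * x / b + of_int (int t * (c * (d - d'))) / b" for c
      unfolding branch_def using b by (simp add: field_simps)
    then have fac: "(\<Sum>c\<in>C. echar (of_int (d - d') * branch c x)) =
        echar (of_int (d - d') * x / b) * (\<Sum>c\<in>C. echar (of_int (int t * (c * (d - d'))) / b))"
      by (simp only: echar_add sum_distrib_left)
    then show "(\<Sum>c\<in>C. echar (of_int (d - d') * branch c x)) = (if d = d' then of_nat N else 0)"
    proof (cases "d = d'")
      case True
      then show ?thesis using C(4) by (simp add: N_def)
    next
      case False
      show ?thesis unfolding fac rows[OF d False] using False by simp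
    qed
  qed
  also have "\<dots> = (of_nat N)\<^sup>2" using D(1) by (simp add: N_def power2_eq_square)
  finally have "complex_of_real (\<Sum>c\<in>C. (norm (m (branch c x)))\<^sup>2) = complex_of_real 1" using N by simp
  then show ?thesis by (simp only: of_real_eq_iff)
qed

lemma finite_partial_spectrum: "finite (partial_spectrum b C n)"
  by (induction n) (simp_all add: partial_spectrum_Suc C(1))

lemma partial_spectrum_mono: "n \<le> n' \<Longrightarrow> partial_spectrum b C n \<subseteq> partial_spectrum b C n'"
proof (rule lift_Suc_mono_le[of "partial_spectrum b C"])
  show "partial_spectrum b C n \<subseteq> partial_spectrum b C (Suc n)" for n
  proof (induction n)
    case 0
    have "(\<lambda>(c, l). c + int b * l) (0, 0) \<in> (\<lambda>(c, l). c + int b * l) ` (C \<times> partial_spectrum b C 0)"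
      using C(2) by (intro imageI) simp
    then show ?case by (simp only: partial_spectrum_Suc) simp
  next
    case (Suc n)
    then show ?case unfolding partial_spectrum_Suc[of b C "Suc n"] partial_spectrum_Suc[of b C n]
      by (intro image_mono) auto
  qed
qed simp

lemma Lambda_eq: "Lambda b C = (\<Union>n. partial_spectrum b C n)"
proof
  show "Lambda b C \<subseteq> (\<Union>n. partial_spectrum b C n)"
    unfolding Lambda_def partial_spectrum_def by blast
  have "partial_spectrum b C n \<subseteq> Lambda b C" for n
  proof -
    have "partial_spectrum b C n \<subseteq> partial_spectrum b C (Suc n)" by (rule partial_spectrum_mono) simp
    also have "\<dots> \<subseteq> Lambda b C" unfolding Lambda_def partial_spectrum_def by (rule UN_upper) simp
    finally show ?thesis .
  qed
  then show "(\<Union>n. partial_spectrum b C n) \<subseteq> Lambda b C" by blast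
qed

lemma inj_on_digit_pair: "inj_on (\<lambda>(c, l). c + int b * l) (C \<times> UNIV)"
proof (rule inj_onI, clarify)
  fix c l c' l' assume c: "c \<in> C" "c' \<in> C" and eq: "c + int b * l = c' + int b * l'"
  have "c - c' = int b * (l' - l)" using eq by (simp add: algebra_simps)
  then have "c = c'" using digits_inj[OF c] by simp
  then show "c = c' \<and> l = l'" using eq b by simp
qed

text \<open>Orthogonality is detected at the first digit in which the two frequencies differ.\<close>

lemma F_difference_eq_0:
  assumes "l \<in> partial_spectrum b C n" "l' \<in> partial_spectrum b C n" "l \<noteq> l'"
  shows "F (real t * of_int (l - l')) = 0"
  using assms
proof (induction n arbitrary: l l')
  case (Suc n)
  obtain c k where l: "l = c + int b * k" "c \<in> C" "k \<in> partial_spectrum b C n"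
    using Suc.prems(1) by (auto simp: partial_spectrum_Suc)
  obtain c' k' where l': "l' = c' + int b * k'" "c' \<in> C" "k' \<in> partial_spectrum b C n"
    using Suc.prems(2) by (auto simp: partial_spectrum_Suc)
  have y: "real t * of_int (l - l') / b = of_int (int t * (k - k')) + real t * of_int (c - c') / b"
    unfolding l l' using b by (simp add: field_simps)
  show ?case
  proof (cases "c = c'")
    case True
    then have "k \<noteq> k'" using Suc.prems(3) l l' by auto
    then have "F (real t * of_int (k - k')) = 0" using Suc.IH l l' by blast
    then show ?thesis using F_eq[of "real t * of_int (l - l')"] y True by simp
  next
    case False
    show ?thesis
      unfolding F_eq[of "real t * of_int (l - l')"] y mask_digit_difference[OF l(2) l'(2) False] by simp
  qed
qed simp

text \<open>The partial sums of the Jorgensen-Pedersen function: the squared norm of the projection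
  of the exponential with frequency -x onto the first frequencies.\<close>

definition Q :: "nat \<Rightarrow> real \<Rightarrow> real" where
  "Q n x = (\<Sum>l\<in>partial_spectrum b C n. (norm (F (x + real t * of_int l)))\<^sup>2)"

lemma Q_0: "Q 0 x = (norm (F x))\<^sup>2"
  by (simp add: Q_def)

text \<open>The mask has period 1 and t l is an integer, so the factor split off by the functional
  equation depends on the lowest digit only. One more digit is one application of the transfer
  operator of the weighted branches.\<close>

lemma Q_Suc: "Q (Suc n) x = (\<Sum>c\<in>C. (norm (m (branch c x)))\<^sup>2 * Q n (branch c x))"
proof -
  have "Q (Suc n) x = (\<Sum>(c, l)\<in>C \<times> partial_spectrum b C n.
      (norm (F (x + real t * of_int (c + int b * l))))\<^sup>2)"
  proof -
    have "inj_on (\<lambda>(c, l). c + int b * l) (C \<times> partial_spectrum b C n)"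
      by (rule inj_on_subset[OF inj_on_digit_pair]) auto
    then show ?thesis unfolding Q_def partial_spectrum_Suc
      by (simp add: sum.reindex comp_def case_prod_unfold)
  qed
  also have "\<dots> = (\<Sum>c\<in>C. \<Sum>l\<in>partial_spectrum b C n. (norm (F (x + real t * of_int (c + int b * l))))\<^sup>2)"
    by (simp add: sum.cartesian_product)
  also have "\<dots> = (\<Sum>c\<in>C. (norm (m (branch c x)))\<^sup>2 * Q n (branch c x))"
    unfolding Q_def sum_distrib_left
  proof (intro sum.cong refl)
    fix c l
    have y: "(x + real t * of_int (c + int b * l)) / b = branch c x + real t * of_int l"
      unfolding branch_def using b by (simp add: field_simps)
    have "m (branch c x + real t * of_int l) = m (branch c x)"
      using mask_add_int[of D "branch c x" "int t * l"] by simp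
    then show "(norm (F (x + real t * of_int (c + int b * l))))\<^sup>2 =
        (norm (m (branch c x)))\<^sup>2 * (norm (F (branch c x + real t * of_int l)))\<^sup>2"
      using F_eq[of "x + real t * of_int (c + int b * l)"] unfolding y
      by (simp add: norm_mult power_mult_distrib)
  qed
  finally show ?thesis .
qed

lemma Q_mono: "n \<le> n' \<Longrightarrow> Q n x \<le> Q n' x"
  unfolding Q_def by (intro sum_mono2 finite_partial_spectrum partial_spectrum_mono) auto

lemma continuous_on_Q: "continuous_on S (Q n)"
  unfolding Q_def
  by (intro continuous_intros continuous_on_compose2[OF continuous_on_F[of UNIV]]) auto

lemma integrable_echar: "integrable \<mu> (\<lambda>x. echar (u * x))"
  by (rule integrable_const_bound[where B = 1]) auto

lemma square_integrable_echar: "square_integrable \<mu> (\<lambda>x. echar (u * x))"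
  by (simp add: square_integrable_def)

lemma L2_inner_echar: "L2_inner \<mu> (\<lambda>x. echar (u * x)) (\<lambda>x. echar (v * x)) = F (u - v)"
  unfolding L2_inner_def fourier_def cnj_echar echar_add[symmetric] by (simp add: left_diff_distrib)

text \<open>Orthogonality leaves only the diagonal of the double sum. The coefficients are arbitrary
  because two choices matter: Fourier coefficients give the best approximation, and for vanishing
  \<open>F (u - s)\<close> no choice brings the distance below 1.\<close>

lemma L2_distance_echar:
  assumes S: "finite S" "\<forall>s\<in>S. \<forall>s'\<in>S. s \<noteq> s' \<longrightarrow> F (s - s') = 0"
  shows "complex_of_real (\<integral>x. (norm (echar (u * x) - (\<Sum>s\<in>S. a s * echar (s * x))))\<^sup>2 \<partial>\<mu>) =
     1 - (\<Sum>s\<in>S. cnj (a s) * F (u - s)) - (\<Sum>s\<in>S. a s * cnj (F (u - s))) + (\<Sum>s\<in>S. (norm (a s))\<^sup>2)"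
proof -
  have mult: "echar (v * x) * cnj (echar (w * x)) = echar ((v - w) * x)" for v w x
    by (simp add: cnj_echar left_diff_distrib flip: echar_add)
  have pt: "complex_of_real ((norm (echar (u * x) - (\<Sum>s\<in>S. a s * echar (s * x))))\<^sup>2) =
      echar (0 * x) - (\<Sum>s\<in>S. cnj (a s) * echar ((u - s) * x)) - (\<Sum>s\<in>S. a s * echar ((s - u) * x))
       + (\<Sum>s\<in>S. \<Sum>s'\<in>S. a s * cnj (a s') * echar ((s - s') * x))" for x
  proof -
    have "complex_of_real ((norm (echar (u * x) - (\<Sum>s\<in>S. a s * echar (s * x))))\<^sup>2) =
        echar (u * x) * cnj (echar (u * x)) - echar (u * x) * cnj (\<Sum>s\<in>S. a s * echar (s * x))
        - (\<Sum>s\<in>S. a s * echar (s * x)) * cnj (echar (u * x))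
        + (\<Sum>s\<in>S. a s * echar (s * x)) * cnj (\<Sum>s\<in>S. a s * echar (s * x))"
      by (simp only: complex_norm_square complex_cnj_diff algebra_simps)
    also have "echar (u * x) * cnj (echar (u * x)) = echar (0 * x)" unfolding mult by simp
    also have "echar (u * x) * cnj (\<Sum>s\<in>S. a s * echar (s * x)) = (\<Sum>s\<in>S. cnj (a s) * echar ((u - s) * x))"
      by (simp add: sum_distrib_left mult.left_commute mult)
    also have "(\<Sum>s\<in>S. a s * echar (s * x)) * cnj (echar (u * x)) = (\<Sum>s\<in>S. a s * echar ((s - u) * x))"
      by (simp add: sum_distrib_right mult.assoc mult)
    also have "(\<Sum>s\<in>S. a s * echar (s * x)) * cnj (\<Sum>s\<in>S. a s * echar (s * x)) =
        (\<Sum>s\<in>S. \<Sum>s'\<in>S. a s * cnj (a s') * (echar (s * x) * cnj (echar (s' * x))))"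
      by (simp add: sum_product mult_ac)
    finally show ?thesis unfolding mult .
  qed
  have "complex_of_real (\<integral>x. (norm (echar (u * x) - (\<Sum>s\<in>S. a s * echar (s * x))))\<^sup>2 \<partial>\<mu>) =
      F 0 - (\<Sum>s\<in>S. cnj (a s) * F (u - s)) - (\<Sum>s\<in>S. a s * F (s - u))
       + (\<Sum>s\<in>S. \<Sum>s'\<in>S. a s * cnj (a s') * F (s - s'))"
    unfolding integral_complex_of_real[symmetric] pt fourier_def
    by (simp add: integrable_echar Bochner_Integration.integrable_sum del: mult_zero_left)
  also have "(\<Sum>s\<in>S. \<Sum>s'\<in>S. a s * cnj (a s') * F (s - s')) = (\<Sum>s\<in>S. \<Sum>s'\<in>S. if s = s' then complex_of_real ((norm (a s))\<^sup>2) else 0)"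
    by (intro sum.cong refl) (use S(2) in \<open>auto simp: F_0 complex_norm_square simp del: of_real_power\<close>)
  also have "\<dots> = (\<Sum>s\<in>S. complex_of_real ((norm (a s))\<^sup>2))" using S(1) by (simp add: of_real_sum)
  also have "(\<Sum>s\<in>S. a s * F (s - u)) = (\<Sum>s\<in>S. a s * cnj (F (u - s)))"
    using F_uminus[of "u - s" for s] by simp
  finally show ?thesis by (simp add: F_0)
qed

abbreviation frequencies :: "int set \<Rightarrow> real set" where
  "frequencies S \<equiv> (\<lambda>s. real t * real_of_int s) ` S"

lemma inj_scale: "inj_on (\<lambda>s. real t * real_of_int s) S"
  using t by (auto simp: inj_on_def)

lemma frequencies_orthogonal:
  assumes "s \<in> frequencies (Lambda b C)" "s' \<in> frequencies (Lambda b C)" "s \<noteq> s'"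
  shows "F (s - s') = 0"
proof -
  obtain l l' n n' where l: "s = real t * of_int l" "s' = real t * of_int l'"
    "l \<in> partial_spectrum b C n" "l' \<in> partial_spectrum b C n'"
    using assms by (auto simp: Lambda_eq)
  then have "l \<in> partial_spectrum b C (max n n')" "l' \<in> partial_spectrum b C (max n n')" "l \<noteq> l'"
    using partial_spectrum_mono[of n "max n n'"] partial_spectrum_mono[of n' "max n n'"] assms by auto
  then show ?thesis using F_difference_eq_0 l by (simp flip: right_diff_distrib of_int_diff)
qed

text \<open>The frequency is -x because its coefficients \<open>F (- x - s)\<close> are the
  conjugates of the values \<open>F (x + s)\<close> that enter \<open>Q\<close>.\<close>

lemma L2_distance_partial_spectrum:
  "(\<integral>y. (norm (echar (- x * y) -
      (\<Sum>s\<in>frequencies (partial_spectrum b C n). F (- x - s) * echar (s * y))))\<^sup>2 \<partial>\<mu>) = 1 - Q n x"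
proof -
  let ?S = "frequencies (partial_spectrum b C n)"
  have sub: "?S \<subseteq> frequencies (Lambda b C)" unfolding Lambda_eq by (intro image_mono) auto
  have sq: "cnj (F v) * F v = complex_of_real ((norm (F v))\<^sup>2)"
      "F v * cnj (F v) = complex_of_real ((norm (F v))\<^sup>2)" for v
    by (simp_all only: complex_norm_square mult.commute)
  have fin: "finite ?S" by (simp add: finite_partial_spectrum)
  have orth: "\<forall>s\<in>?S. \<forall>s'\<in>?S. s \<noteq> s' \<longrightarrow> F (s - s') = 0"
    using frequencies_orthogonal[OF subsetD[OF sub] subsetD[OF sub]] by (intro ballI impI) assumption
  from L2_distance_echar[OF fin orth, of "- x" "\<lambda>s. F (- x - s)"]
  have "complex_of_real (\<integral>y. (norm (echar (- x * y) - (\<Sum>s\<in>?S. F (- x - s) * echar (s * y))))\<^sup>2 \<partial>\<mu>) =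
      1 - complex_of_real (\<Sum>s\<in>?S. (norm (F (- x - s)))\<^sup>2)"
    unfolding sq by (simp only: of_real_sum diff_add_cancel)
  also have "(\<Sum>s\<in>?S. (norm (F (- x - s)))\<^sup>2) = (\<Sum>s\<in>?S. (norm (F (x + s)))\<^sup>2)"
    by (intro sum.cong refl) (metis F_uminus complex_mod_cnj minus_add_distrib uminus_add_conv_diff add.commute)
  also have "\<dots> = Q n x" unfolding Q_def by (subst sum.reindex[OF inj_scale]) simp
  finally have "complex_of_real (\<integral>y. (norm (echar (- x * y) - (\<Sum>s\<in>?S. F (- x - s) * echar (s * y))))\<^sup>2 \<partial>\<mu>)
    = complex_of_real (1 - Q n x)" by simp
  then show ?thesis by (simp only: of_real_eq_iff)
qed

lemma Q_le_1: "Q n x \<le> 1"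
proof -
  have "1 - Q n x \<ge> 0" unfolding L2_distance_partial_spectrum[symmetric] by (rule Bochner_Integration.integral_nonneg) simp
  then show ?thesis by simp
qed

end

section \<open>Spectra and integer cycles\<close>

text \<open>A nonempty invariant subset of least cardinality cannot be mapped into a proper part of
  itself.\<close>

lemma invariant_subset_surj:
  assumes "finite Z" "Z \<noteq> {}" "g ` Z \<subseteq> Z"
  shows "\<exists>X\<subseteq>Z. X \<noteq> {} \<and> g ` X = X"
proof -
  let ?P = "\<lambda>X. X \<subseteq> Z \<and> X \<noteq> {} \<and> g ` X \<subseteq> X"
  obtain X where X: "?P X" and min: "\<And>Y. ?P Y \<Longrightarrow> card X \<le> card Y"
    using ex_has_least_nat[of ?P Z card] assms by blast
  have fin: "finite X" using X assms(1) finite_subset by blast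
  have "?P (g ` X)" using X by blast
  then have "card X \<le> card (g ` X)" by (rule min)
  then have "g ` X = X" using X fin by (intro card_seteq) auto
  then show ?thesis using X by blast
qed

context hadamard_pair
begin

section \<open>The limit of the partial sums and its minima\<close>

definition Q_lim :: "real \<Rightarrow> real" where
  "Q_lim x = lim (\<lambda>n. Q n x)"

lemma Q_tendsto: "(\<lambda>n. Q n x) \<longlonglongrightarrow> Q_lim x"
proof -
  have "convergent (\<lambda>n. Q n x)"
  proof (rule Bseq_mono_convergent)
    have "Q n x \<ge> 0" for n by (simp add: Q_def sum_nonneg)
    then show "Bseq (\<lambda>n. Q n x)" by (intro BseqI'[where K = 1]) (simp add: Q_le_1)
  qed (use Q_mono in auto)
  then show ?thesis by (simp add: Q_lim_def convergent_LIMSEQ_iff)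
qed

lemma Q_le_lim: "Q n x \<le> Q_lim x"
  by (rule incseq_le[OF _ Q_tendsto]) (simp add: incseq_def Q_mono)

lemma Q_lim_le_1: "Q_lim x \<le> 1"
  by (rule LIMSEQ_le_const2[OF Q_tendsto]) (auto intro: Q_le_1)

lemma norm_F_le_Q_lim: "(norm (F x))\<^sup>2 \<le> Q_lim x"
  using Q_le_lim[of 0 x] by (simp add: Q_0)

lemma Q_lim_nonneg: "Q_lim x \<ge> 0"
  by (rule order_trans[OF _ norm_F_le_Q_lim]) simp

lemma Q_lim_eq: "Q_lim x = (\<Sum>c\<in>C. (norm (m (branch c x)))\<^sup>2 * Q_lim (branch c x))"
proof (rule LIMSEQ_unique)
  show "(\<lambda>n. Q (Suc n) x) \<longlonglongrightarrow> Q_lim x" by (rule LIMSEQ_Suc[OF Q_tendsto])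
  show "(\<lambda>n. Q (Suc n) x) \<longlonglongrightarrow> (\<Sum>c\<in>C. (norm (m (branch c x)))\<^sup>2 * Q_lim (branch c x))"
    unfolding Q_Suc by (intro tendsto_intros Q_tendsto)
qed

text \<open>As a supremum of continuous functions \<open>Q_lim\<close> is lower semicontinuous. For
  a limit \<open>z\<close> of a minimising sequence, continuity bounds each \<open>Q n z\<close> by
  the infimum, and then \<open>n\<close> tends to infinity.\<close>

lemma Q_lim_attains_min:
  assumes "K \<noteq> {}" "compact K"
  shows "\<exists>z\<in>K. \<forall>x\<in>K. Q_lim z \<le> Q_lim x"
proof -
  define \<alpha> where "\<alpha> = Inf (Q_lim ` K)"
  have bdd: "bdd_below (Q_lim ` K)" using Q_lim_nonneg by (intro bdd_belowI[of _ 0]) auto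
  have "\<exists>x\<in>K. Q_lim x < \<alpha> + 1 / real (Suc k)" for k
    using cInf_lessD[of "Q_lim ` K" "\<alpha> + 1 / real (Suc k)"] assms(1) by (auto simp: \<alpha>_def)
  then obtain x where x: "\<And>k. x k \<in> K" "\<And>k. Q_lim (x k) < \<alpha> + 1 / real (Suc k)" by metis
  obtain z r where z: "z \<in> K" "strict_mono (r :: nat \<Rightarrow> nat)" "(x \<circ> r) \<longlonglongrightarrow> z"
    using assms(2) x(1) unfolding compact_def by blast
  have "Q n z \<le> \<alpha>" for n
  proof (rule LIMSEQ_le)
    have "isCont (Q n) z" using continuous_on_Q[of UNIV n] by (simp add: continuous_on_eq_continuous_at)
    then show "(\<lambda>k. Q n ((x \<circ> r) k)) \<longlonglongrightarrow> Q n z" using z(3) by (rule isCont_tendsto_compose)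
    have "(\<lambda>k. \<alpha> + 1 / real (Suc k)) \<longlonglongrightarrow> \<alpha> + 0"
      by (intro tendsto_intros) (use LIMSEQ_inverse_real_of_nat in \<open>simp add: inverse_eq_divide\<close>)
    then have "(\<lambda>k. \<alpha> + 1 / real (Suc k)) \<longlonglongrightarrow> \<alpha>" by simp
    from LIMSEQ_subseq_LIMSEQ[OF this z(2)]
    show "(\<lambda>k. \<alpha> + 1 / real (Suc (r k))) \<longlonglongrightarrow> \<alpha>" by (simp only: comp_def)
    have "Q n ((x \<circ> r) k) \<le> \<alpha> + 1 / real (Suc (r k))" for k
      using Q_le_lim[of n "x (r k)"] x(2)[of "r k"] by simp
    then show "\<exists>N. \<forall>k\<ge>N. Q n ((x \<circ> r) k) \<le> \<alpha> + 1 / real (Suc (r k))" by blast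
  qed
  then have "Q_lim z \<le> \<alpha>" by (intro LIMSEQ_le_const2[OF Q_tendsto]) auto
  moreover have "\<alpha> \<le> Q_lim x" if "x \<in> K" for x unfolding \<alpha>_def using bdd that by (intro cInf_lower) auto
  ultimately show ?thesis using z(1) by (meson order_trans)
qed

text \<open>The points of a compact interval where \<open>Q_lim\<close> is minimal are preserved by every branch of
  positive weight. Going down the branch of digit \<open>0\<close> leads to the origin, where \<open>Q_lim\<close> is \<open>1\<close>, so
  such a point must meet a zero of the mask after boundedly many steps.\<close>

lemma minimal_set_properties:
  assumes "Q_lim x0 < 1"
  shows "\<exists>Z. finite Z \<and> Z \<noteq> {} \<and> 0 \<notin> Z \<and> (\<forall>x\<in>Z. \<forall>c\<in>C. m (branch c x) \<noteq> 0 \<longrightarrow> branch c x \<in> Z)"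
proof -
  \<comment> \<open>The interval has to contain \<open>x0\<close> and to be preserved by all
    branches. As digits are at most b - 2, the latter follows from A \<ge> t.\<close>
  define A where "A = max \<bar>x0\<bar> (real t)"
  define K where "K = {-A..A}"
  have A: "A \<ge> real t" "A > 0" "A \<ge> 0" using t by (auto simp: A_def)
  have x0: "x0 \<in> K" by (auto simp: K_def A_def)
  then have "K \<noteq> {}" by blast
  then obtain z where z: "z \<in> K" "\<And>x. x \<in> K \<Longrightarrow> Q_lim z \<le> Q_lim x"
    using Q_lim_attains_min[of K] by (auto simp: K_def)
  define \<alpha> where "\<alpha> = Q_lim z"
  have \<alpha>: "\<alpha> < 1" unfolding \<alpha>_def using z(2)[OF x0] assms by linarith
  define Z where "Z = {x\<in>K. Q_lim x = \<alpha>}"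
  have branch_K: "branch c x \<in> K" if "x \<in> K" "c \<in> C" for x c
  proof -
    have c: "0 \<le> c" "c \<le> int b - 2" using that C(3) by auto
    then have rc: "0 \<le> real_of_int c" "real_of_int c \<le> real b - 2" by linarith+
    have tc: "0 \<le> real t * of_int c" "real t * of_int c \<le> A * (real b - 2)"
      using rc A by (auto intro!: mult_mono)
    have "- (A * b) \<le> - A" using A b by simp
    also have "- A \<le> x + real t * of_int c" using that tc by (auto simp: K_def)
    finally have lo: "- A * b \<le> x + real t * of_int c" by simp
    have "x + real t * of_int c \<le> A + A * (real b - 2)" using that tc by (intro add_mono) (auto simp: K_def)
    also have "\<dots> \<le> A * b" using A by (simp add: algebra_simps)
    finally show ?thesis using lo b unfolding K_def branch_def by (simp add: pos_le_divide_eq pos_divide_le_eq)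
  qed
  have inv: "branch c x \<in> Z" if x: "x \<in> Z" and c: "c \<in> C" and nz: "m (branch c x) \<noteq> 0" for x c
  proof -
    have ge: "Q_lim (branch c' x) - \<alpha> \<ge> 0" if "c' \<in> C" for c'
      using z(2)[OF branch_K[OF _ that]] x by (simp add: \<alpha>_def Z_def)
    \<comment> \<open>The weights sum to 1, so the minimum at \<open>x\<close> is an average of
      values that are no smaller; every branch of positive weight attains it.\<close>
    have "(\<Sum>c\<in>C. (norm (m (branch c x)))\<^sup>2 * (Q_lim (branch c x) - \<alpha>)) = Q_lim x - \<alpha> * 1"
      unfolding right_diff_distrib sum_subtractf Q_lim_eq[of x, symmetric]
      unfolding sum_distrib_right[symmetric] sum_norm_mask_branch by simp
    also have "\<dots> = 0" using x by (simp add: Z_def)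
    finally have "(norm (m (branch c x)))\<^sup>2 * (Q_lim (branch c x) - \<alpha>) = 0"
      using ge c C(1) by (subst (asm) sum_nonneg_eq_0_iff) auto
    then show ?thesis using nz branch_K[OF _ c] x by (auto simp: Z_def)
  qed
  have K_div: "x / real b ^ k \<in> K" if "x \<in> K" for x k
  proof -
    have "\<bar>x\<bar> / real b ^ k \<le> A / 1" using that b A by (intro frac_le) (auto simp: K_def)
    then have "\<bar>x / real b ^ k\<bar> \<le> A" by simp
    then show ?thesis unfolding K_def atLeastAtMost_iff by linarith
  qed
  obtain \<delta> where \<delta>: "\<delta> > 0" "\<And>u. \<bar>u\<bar> < \<delta> \<Longrightarrow> m u \<noteq> 0"
  proof -
    have "isCont m 0" using continuous_on_mask[of UNIV D] by (simp add: continuous_on_eq_continuous_at)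
    moreover have "m 0 \<noteq> 0" using mask_0[OF b1 D(1) D_ne] by simp
    ultimately obtain e where "e > 0" "\<And>u. dist 0 u < e \<Longrightarrow> m u \<noteq> 0"
      using continuous_at_avoid[of 0 m 0] by auto
    then show ?thesis using that[of e] by (simp add: dist_real_def)
  qed
  obtain n0 where n0: "\<And>k x. k \<ge> n0 \<Longrightarrow> x \<in> K \<Longrightarrow> m (x / real b ^ k) \<noteq> 0"
  proof -
    \<comment> \<open>From this exponent on, division carries all of \<open>K\<close> into the
      neighbourhood of 0 where the mask does not vanish.\<close>
    obtain n0 where n0: "A / \<delta> < real b ^ n0" using real_arch_pow[of "real b" "A / \<delta>"] b by auto
    have "m (x / real b ^ k) \<noteq> 0" if "k \<ge> n0" "x \<in> K" for k x
    proof (rule \<delta>(2))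
      have "real b ^ n0 \<le> real b ^ k" using that b by (intro power_increasing) auto
      then have "A < \<delta> * real b ^ k" using n0 \<delta>(1) by (simp add: pos_divide_less_eq) (smt (verit) mult.commute mult_left_mono)
      moreover have "\<bar>x\<bar> \<le> A" using that by (auto simp: K_def)
      ultimately show "\<bar>x / real b ^ k\<bar> < \<delta>" using b by (simp add: abs_divide pos_divide_less_eq)
    qed
    then show ?thesis using that by blast
  qed
  have zero: "\<exists>k\<le>n0. m (x / real b ^ k) = 0" if x: "x \<in> Z" for x
  proof (rule ccontr)
    assume "\<not> (\<exists>k\<le>n0. m (x / real b ^ k) = 0)"
    then have nz: "m (x / real b ^ k) \<noteq> 0" for k
      using n0[of k x] x by (cases "k \<le> n0") (auto simp: Z_def)
    have mem: "x / real b ^ k \<in> Z" for k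
    proof (induction k)
      case 0
      then show ?case using x by simp
    next
      case (Suc k)
      have "branch 0 (x / real b ^ k) = x / real b ^ Suc k" by (simp add: branch_def)
      then show ?case using inv[OF Suc C(2)] nz[of "Suc k"] by simp
    qed
    have "(norm (F (x / real b ^ k)))\<^sup>2 \<le> \<alpha>" for k
      using norm_F_le_Q_lim[of "x / real b ^ k"] mem[of k] by (simp add: Z_def)
    moreover have "(\<lambda>k. (norm (F (x / real b ^ k)))\<^sup>2) \<longlonglongrightarrow> (norm (1::complex))\<^sup>2"
      by (intro tendsto_intros fourier_invariant_measure_tendsto[OF b1 D(1) D_ne \<mu>])
    ultimately have "(norm (1::complex))\<^sup>2 \<le> \<alpha>" by (intro LIMSEQ_le_const2) auto
    then show False using \<alpha> by simp
  qed
  \<comment> \<open>\<open>Z\<close> is covered by finitely many rescaled copies of the finite zero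
    set of the mask in the interval.\<close>
  have "Z \<subseteq> (\<Union>k\<le>n0. (\<lambda>u. real b ^ k * u) ` {u\<in>{-A..A}. m u = 0})"
  proof
    fix x assume x: "x \<in> Z"
    then obtain k where k: "k \<le> n0" "m (x / real b ^ k) = 0" using zero by blast
    have "x / real b ^ k \<in> {u\<in>{-A..A}. m u = 0}" using K_div[of x k] x k by (auto simp: Z_def K_def)
    moreover have "x = real b ^ k * (x / real b ^ k)" using b by simp
    ultimately show "x \<in> (\<Union>k\<le>n0. (\<lambda>u. real b ^ k * u) ` {u\<in>{-A..A}. m u = 0})" using k(1) by blast
  qed
  then have "finite Z" by (rule finite_subset) (intro finite_UN_I finite_imageI finite_mask_zeros D(1) D_ne, simp)
  moreover have "z \<in> Z" using z(1) by (simp add: Z_def \<alpha>_def)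
  moreover have "0 \<notin> Z" using norm_F_le_Q_lim[of 0] \<alpha> by (auto simp: F_0 Z_def)
  ultimately show ?thesis using inv by blast
qed

lemma power_minus_one_mult_Ints:
  fixes y :: real
  assumes "(real b ^ q - 1) * y \<in> \<int>"
  shows "(real b ^ (q * k) - 1) * y \<in> \<int>"
proof -
  have "int b ^ q - 1 dvd (int b ^ q) ^ k - 1"
    using power_diff_1_eq[of "int b ^ q" k] by auto
  then obtain w where w: "int b ^ (q * k) - 1 = (int b ^ q - 1) * w" by (auto simp: power_mult)
  have "real_of_int (int b ^ (q * k) - 1) = real_of_int ((int b ^ q - 1) * w)" using w by simp
  then have "real b ^ (q * k) - 1 = of_int w * (real b ^ q - 1)" by simp
  then have "(real b ^ (q * k) - 1) * y = of_int w * ((real b ^ q - 1) * y)" by (simp only: mult.assoc)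
  then show ?thesis using Ints_mult[OF Ints_of_int assms, of w] by (simp only:)
qed

text \<open>Points of a finite forward-invariant set are periodic modulo \<open>1\<close> under multiplication by \<open>b\<close>,
  so their denominators are coprime to \<open>b\<close>. This makes the branch that stays in the set unique, and
  its weight is therefore \<open>1\<close>.\<close>

lemma integer_cycle_of_finite_invariant_set:
  assumes Z: "finite Z" "Z \<noteq> {}" "0 \<notin> Z"
    and inv: "\<And>x c. x \<in> Z \<Longrightarrow> c \<in> C \<Longrightarrow> m (branch c x) \<noteq> 0 \<Longrightarrow> branch c x \<in> Z"
  shows "\<exists>X f. integer_cycle b C t X f"
proof -
  have "\<exists>c\<in>C. m (branch c x) \<noteq> 0" for x
  proof (rule ccontr)
    assume "\<not> (\<exists>c\<in>C. m (branch c x) \<noteq> 0)"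
    then have "(\<Sum>c\<in>C. (norm (m (branch c x)))\<^sup>2) = 0" by (intro sum.neutral) auto
    then show False using sum_norm_mask_branch[of x] by simp
  qed
  then obtain dig where dig: "\<And>x. dig x \<in> C" "\<And>x. m (branch (dig x) x) \<noteq> 0" by metis
  define g where "g x = branch (dig x) x" for x
  have gZ: "g x \<in> Z" if "x \<in> Z" for x unfolding g_def by (intro inv that dig)
  have bg: "real b * g x = x + of_int (int t * dig x)" for x
    using b by (simp add: g_def branch_def)
  have iter: "real b ^ n * (g ^^ n) x - x \<in> \<int>" for n x
  proof (induction n)
    case (Suc n)
    have "real b ^ Suc n * (g ^^ Suc n) x - x =
        (real b ^ n * (g ^^ n) x - x) + real b ^ n * of_int (int t * dig ((g ^^ n) x))"
    proof -
      have "real b ^ Suc n * (g ^^ Suc n) x = real b ^ n * (real b * g ((g ^^ n) x))" by simp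
      then show ?thesis unfolding bg by (simp add: distrib_left)
    qed
    also have "\<dots> = (real b ^ n * (g ^^ n) x - x) + of_int (int b ^ n * (int t * dig ((g ^^ n) x)))" by simp
    also have "\<dots> \<in> \<int>" by (rule Ints_add[OF Suc Ints_of_int])
    finally show ?case .
  qed simp
  have rational: "\<exists>q\<ge>1. (real b ^ q - 1) * x \<in> \<int>" if x: "x \<in> Z" for x
  proof -
    have "(g ^^ n) x \<in> Z" for n using x gZ by (induction n) auto
    then have "range (\<lambda>n. (g ^^ n) x) \<subseteq> Z" by blast
    \<comment> \<open>Two equal iterates \<open>u\<close> at times i < j make b^i u and b^j u both
      congruent to \<open>x\<close> modulo 1; eliminating \<open>u\<close> shows that b^(j-i) - 1
      clears the denominator of \<open>x\<close>.\<close>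
    then have "\<not> inj (\<lambda>n. (g ^^ n) x)" using Z(1) by (meson finite_subset finite_imageD infinite_UNIV_nat)
    then obtain i j where ij: "i < j" "(g ^^ i) x = (g ^^ j) x"
      unfolding inj_def by (metis linorder_neqE_nat)
    define u where "u = (g ^^ i) x"
    have i: "real b ^ i * u - x \<in> \<int>" using iter[of i x] by (simp add: u_def)
    have j: "real b ^ j * u - x \<in> \<int>" using iter[of j x] ij by (simp add: u_def)
    have "real b ^ j = real b ^ (j - i) * real b ^ i" using ij by (simp flip: power_add)
    then have "(real b ^ (j - i) - 1) * x =
        (real b ^ j * u - x) - of_int (int b ^ (j - i)) * (real b ^ i * u - x)"
      by (simp add: algebra_simps)
    also have "\<dots> \<in> \<int>" by (intro Ints_diff Ints_mult[OF Ints_of_int] i j)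
    finally show ?thesis using ij by (intro exI[of _ "j - i"]) auto
  qed
  have unique: "c = c'" if x: "branch c x \<in> Z" "branch c' x \<in> Z" and c: "c \<in> C" "c' \<in> C" for x c c'
  proof -
    obtain q where q: "q \<ge> 1" "(real b ^ q - 1) * branch c x \<in> \<int>" using rational[OF x(1)] by blast
    obtain q' where q': "q' \<ge> 1" "(real b ^ q' - 1) * branch c' x \<in> \<int>" using rational[OF x(2)] by blast
    have "(real b ^ (q * q') - 1) * branch c x \<in> \<int>" "(real b ^ (q * q') - 1) * branch c' x \<in> \<int>"
      using power_minus_one_mult_Ints[OF q(2), of q'] power_minus_one_mult_Ints[OF q'(2), of q]
      by (simp_all add: mult.commute)
    then have "(real b ^ (q * q') - 1) * branch c x - (real b ^ (q * q') - 1) * branch c' x \<in> \<int>"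
      by (rule Ints_diff)
    then obtain k where k: "(real b ^ (q * q') - 1) * branch c x - (real b ^ (q * q') - 1) * branch c' x = of_int k"
      by (auto elim: Ints_cases)
    \<comment> \<open>With the common exponent q q', the difference of the two branches becomes an
      integer identity. Read modulo \<open>b\<close> it says that \<open>b\<close> divides t (c -
      c').\<close>
    have "(real b ^ (q * q') - 1) * (real t * of_int (c - c')) =
        real b * ((real b ^ (q * q') - 1) * branch c x - (real b ^ (q * q') - 1) * branch c' x)"
      unfolding branch_def using b by (simp add: field_simps)
    also have "\<dots> = real b * of_int k" unfolding k ..
    finally have "real_of_int ((int b ^ (q * q') - 1) * (int t * (c - c'))) = real_of_int (int b * k)" by simp
    then have eq: "(int b ^ (q * q') - 1) * (int t * (c - c')) = int b * k" by (simp only: of_int_eq_iff)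
    have "q * q' > 0" using q q' by auto
    then have "int b dvd int b ^ (q * q')" by (intro dvd_power) auto
    then have "int b dvd int b ^ (q * q') * (int t * (c - c')) - int b * k" by (intro dvd_diff dvd_mult2) auto
    also have "int b ^ (q * q') * (int t * (c - c')) - int b * k = int t * (c - c')"
      using eq by (simp add: algebra_simps)
    finally have "int b dvd int t * (c - c')" .
    then have "int b dvd c - c'" using t(2) by (simp add: coprime_dvd_mult_right_iff coprime_commute)
    then show ?thesis by (rule digits_inj[OF c])
  qed
  have integer: "g x \<in> \<int>" if x: "x \<in> Z" for x
  proof -
    have "(norm (m (branch c x)))\<^sup>2 = 0" if "c \<in> C - {dig x}" for c
      using unique[of c x "dig x"] inv[OF x] gZ[OF x] dig(1) that by (auto simp: g_def)
    then have "(\<Sum>c\<in>C - {dig x}. (norm (m (branch c x)))\<^sup>2) = 0" by (intro sum.neutral) blast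
    then have "(norm (m (g x)))\<^sup>2 = 1"
      using sum_norm_mask_branch[of x] sum.remove[OF C(1) dig(1)[of x], of "\<lambda>c. (norm (m (branch c x)))\<^sup>2"]
      by (simp add: g_def)
    then have "norm (m (g x)) = 1" by (simp add: power2_eq_1_iff) (smt (verit) norm_ge_zero)
    then show ?thesis by (rule norm_mask_eq_1_imp_Ints[OF D])
  qed
  \<comment> \<open>Only images under \<open>g\<close> are known to be integers, so a subset is
    chosen that \<open>g\<close> maps onto itself.\<close>
  obtain Y where Y: "Y \<subseteq> Z" "Y \<noteq> {}" "g ` Y = Y"
    using invariant_subset_surj[OF Z(1,2), of g] gZ by blast
  have Y_int: "of_int \<lfloor>y\<rfloor> = y" if y: "y \<in> Y" for y
  proof -
    have "y \<in> g ` Y" using y Y(3) by simp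
    then obtain x where "x \<in> Y" "y = g x" by blast
    then have "y \<in> \<int>" using integer[of x] Y(1) by auto
    then show ?thesis by (auto elim: Ints_cases)
  qed
  define f where "f n = \<lfloor>g (of_int n)\<rfloor>" for n
  have "integer_cycle b C t (floor ` Y) f"
    unfolding integer_cycle_def
  proof (intro conjI ballI)
    show "finite (floor ` Y)" using Y(1) Z(1) finite_subset by blast
    show "floor ` Y \<noteq> {}" using Y(2) by simp
    show "0 \<notin> floor ` Y"
    proof
      assume "0 \<in> floor ` Y"
      then obtain y where "y \<in> Y" "\<lfloor>y\<rfloor> = 0" by auto
      then have "y = 0" using Y_int by force
      then show False using \<open>y \<in> Y\<close> Y(1) Z(3) by blast
    qed
    have "f ` floor ` Y = floor ` g ` Y"
      unfolding f_def image_image by (intro image_cong refl) (simp only: Y_int)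
    then show "f ` floor ` Y = floor ` Y" unfolding Y(3) .
    fix n assume "n \<in> floor ` Y"
    then obtain y where y: "y \<in> Y" "n = \<lfloor>y\<rfloor>" by blast
    have yn: "y = of_int n" unfolding y(2) using Y_int[OF y(1)] by (rule sym)
    have "g y \<in> Y" using Y(3) y(1) by blast
    then have "real_of_int (f n) = g y" unfolding f_def yn[symmetric] by (rule Y_int)
    then have "real_of_int (int b * f n) = real_of_int (n + int t * dig y)" using bg[of y] yn by simp
    then have "int b * f n = n + int t * dig y" by (simp only: of_int_eq_iff)
    then show "\<exists>c\<in>C. int b * f n = n + int t * c" using dig(1) by blast
  qed
  then show ?thesis by blast
qed

section \<open>Spectrality as the absence of integer cycles\<close>

lemma is_spectrum_iff_basis:
  "is_spectrum \<mu> (frequencies (Lambda b C)) \<longleftrightarrow>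
     L2_orthonormal_basis \<mu> (frequencies (Lambda b C)) (\<lambda>l x. echar (l * x))"
proof -
  have "(\<lambda>l x. exp (- 2 * complex_of_real pi * \<i> * complex_of_real (l * x))) = (\<lambda>l x. echar (l * x))"
    by (intro ext) (simp add: echar_def cis_conv_exp mult_ac)
  moreover have "countable (frequencies (Lambda b C))" by simp
  ultimately show ?thesis unfolding is_spectrum_def by simp
qed

lemma no_integer_cycle_imp_spectrum:
  assumes R: "AE x in \<mu>. \<bar>x\<bar> \<le> R" and no: "\<nexists>X f. integer_cycle b C t X f"
  shows "is_spectrum \<mu> (frequencies (Lambda b C))"
proof -
  let ?I = "frequencies (Lambda b C)" and ?e = "\<lambda>l x. echar (l * x)"
  have Q1: "Q_lim x = 1" for x
  proof (rule ccontr)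
    assume "Q_lim x \<noteq> 1"
    then have "Q_lim x < 1" using Q_lim_le_1[of x] by simp
    then show False using minimal_set_properties integer_cycle_of_finite_invariant_set no by metis
  qed
  have exps: "(\<lambda>x. echar (\<xi> * x)) \<in> L2_span_closure \<mu> ?I ?e" for \<xi>
    unfolding L2_span_closure_def
  proof (intro CollectI conjI allI impI)
    show "square_integrable \<mu> (\<lambda>x. echar (\<xi> * x))" by (rule square_integrable_echar)
    fix \<epsilon> :: real assume \<epsilon>: "\<epsilon> > 0"
    have "(\<lambda>n. Q n (- \<xi>)) \<longlonglongrightarrow> 1" using Q_tendsto[of "- \<xi>"] Q1 by simp
    then have "\<forall>\<^sub>F n in sequentially. Q n (- \<xi>) > 1 - \<epsilon>" by (rule order_tendstoD) (use \<epsilon> in simp)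
    then obtain n where n: "Q n (- \<xi>) > 1 - \<epsilon>" by (auto dest: eventually_happens)
    let ?S = "frequencies (partial_spectrum b C n)"
    have "finite ?S" by (intro finite_imageI finite_partial_spectrum)
    moreover have "?S \<subseteq> ?I" unfolding Lambda_eq by (intro image_mono) auto
    moreover have "(\<integral>x. (norm (echar (\<xi> * x) - (\<Sum>s\<in>?S. F (\<xi> - s) * echar (s * x))))\<^sup>2 \<partial>\<mu>) < \<epsilon>"
      using L2_distance_partial_spectrum[of "- \<xi>" n] n by simp
    ultimately show "\<exists>S a. finite S \<and> S \<subseteq> ?I \<and> (\<integral>x. (norm (echar (\<xi> * x) - (\<Sum>s\<in>S. a s * echar (s * x))))\<^sup>2 \<partial>\<mu>) < \<epsilon>"
      by (intro exI[of _ ?S] exI[of _ "\<lambda>s. F (\<xi> - s)"] conjI)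
  qed
  show ?thesis
    unfolding is_spectrum_iff_basis L2_orthonormal_basis_def
  proof (intro conjI ballI allI impI)
    fix l assume l: "l \<in> ?I"
    show "square_integrable \<mu> (\<lambda>x. echar (l * x))" by (rule square_integrable_echar)
    fix l' assume l': "l' \<in> ?I"
    show "L2_inner \<mu> (\<lambda>x. echar (l * x)) (\<lambda>x. echar (l' * x)) = of_bool (l = l')"
      unfolding L2_inner_echar using frequencies_orthogonal[OF l l'] by (cases "l = l'") (simp_all add: F_0)
  next
    fix f :: "real \<Rightarrow> complex" and \<epsilon> :: real
    assume f: "square_integrable \<mu> f" and \<epsilon>: "\<epsilon> > 0"
    have "f \<in> L2_span_closure \<mu> ?I ?e"
      by (rule exponentials_dense_L2[OF real_distribution_axioms R _ exps f]) (simp add: square_integrable_echar)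
    moreover have "\<epsilon>\<^sup>2 > 0" using \<epsilon> by simp
    ultimately obtain S a where S: "finite S" "S \<subseteq> ?I"
      "(\<integral>x. (norm (f x - (\<Sum>s\<in>S. a s * echar (s * x))))\<^sup>2 \<partial>\<mu>) < \<epsilon>\<^sup>2"
      unfolding L2_span_closure_def by blast
    have "L2_norm \<mu> (\<lambda>x. f x - (\<Sum>s\<in>S. a s * echar (s * x))) < sqrt (\<epsilon>\<^sup>2)"
      unfolding L2_norm_def by (rule real_sqrt_less_mono[OF S(3)])
    then show "\<exists>S a. finite S \<and> S \<subseteq> ?I \<and> L2_norm \<mu> (\<lambda>x. f x - (\<Sum>s\<in>S. a s * echar (s * x))) < \<epsilon>"
      using S(1,2) \<epsilon> by auto
  qed
qed

text \<open>If \<open>x\<close> lies on a cycle then \<open>-x\<close> has a \<open>b\<close>-adic expansion with infinitely many nonzero digits,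
  so it differs from every frequency at some digit.\<close>

lemma F_cycle_eq_0:
  assumes cyc: "integer_cycle b C t X f" and "x \<in> X"
  shows "F (of_int x) = 0"
  using assms(2)
\<comment> \<open>A digit 0 means x = b f(x) and shrinks the modulus, so the descent must meet a
  nonzero digit, where the mask factor vanishes.\<close>
proof (induction "nat \<bar>x\<bar>" arbitrary: x rule: less_induct)
  case less
  obtain c where c: "c \<in> C" "int b * f x = x + int t * c" using cyc less.prems by (auto simp: integer_cycle_def)
  have fx: "f x \<in> X" using cyc less.prems by (auto simp: integer_cycle_def)
  have "real b * of_int (f x) = of_int x + real t * of_int c" using arg_cong[OF c(2), of real_of_int] by simp
  then have y: "of_int x / real b = of_int (f x) + real t * of_int (0 - c) / b" using b by (simp add: field_simps)
  show ?case
  proof (cases "c = 0")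
    case True
    have x: "x \<noteq> 0" using cyc less.prems by (auto simp: integer_cycle_def)
    have xb: "x = int b * f x" using c True by simp
    then have "f x \<noteq> 0" using x by auto
    then have "\<bar>f x\<bar> < \<bar>x\<bar>" using b by (subst (2) xb) (simp add: abs_mult)
    then have "F (of_int (f x)) = 0" using less.hyps fx by simp
    then show ?thesis using F_eq[of "of_int x"] y True by simp
  next
    case False
    then show ?thesis
      unfolding F_eq[of "of_int x"] y using mask_digit_difference[OF C(2) c(1), of "f x"] by simp
  qed
qed

text \<open>The digits of \<open>l\<close> are compared with those of the cycle: the first
  disagreement annihilates a mask factor, and agreement in all \<open>n\<close> digits leaves
  another point of the cycle with frequency shift 0.\<close>

lemma F_cycle_add_spectrum_eq_0:
  assumes cyc: "integer_cycle b C t X f" and "x \<in> X" "l \<in> partial_spectrum b C n"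
  shows "F (of_int x + real t * of_int l) = 0"
  using assms(2,3)
proof (induction n arbitrary: x l)
  case 0
  then show ?case using F_cycle_eq_0[OF cyc] by simp
next
  case (Suc n)
  obtain c' k where l: "l = c' + int b * k" "c' \<in> C" "k \<in> partial_spectrum b C n"
    using Suc.prems(2) by (auto simp: partial_spectrum_Suc)
  obtain c where c: "c \<in> C" "int b * f x = x + int t * c" using cyc Suc.prems by (auto simp: integer_cycle_def)
  have fx: "f x \<in> X" using cyc Suc.prems by (auto simp: integer_cycle_def)
  have "real b * of_int (f x) = of_int x + real t * of_int c" using arg_cong[OF c(2), of real_of_int] by simp
  then have y: "(of_int x + real t * of_int l) / b =
      of_int (f x + int t * k) + real t * of_int (c' - c) / b"
    unfolding l(1) using b by (simp add: field_simps)
  show ?case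
  proof (cases "c' = c")
    case True
    then show ?thesis
      unfolding F_eq[of "of_int x + real t * of_int l"] y using Suc.IH[OF fx l(3)] by simp
  next
    case False
    show ?thesis
      unfolding F_eq[of "of_int x + real t * of_int l"] y mask_digit_difference[OF l(2) c(1) False] by simp
  qed
qed

text \<open>For \<open>x\<close> on a cycle, the exponential with frequency -x is orthogonal to the
  whole family, so every finite combination stays at distance at least 1 from it.\<close>

lemma spectrum_imp_no_integer_cycle:
  assumes sp: "is_spectrum \<mu> (frequencies (Lambda b C))"
  shows "\<not> integer_cycle b C t X f"
proof
  assume cyc: "integer_cycle b C t X f"
  then obtain x where x: "x \<in> X" by (auto simp: integer_cycle_def)
  note basis = sp[unfolded is_spectrum_iff_basis L2_orthonormal_basis_def]
  obtain S a where S: "finite S" "S \<subseteq> frequencies (Lambda b C)"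
    "L2_norm \<mu> (\<lambda>y. echar (- of_int x * y) - (\<Sum>s\<in>S. a s * echar (s * y))) < 1"
    using basis[THEN conjunct2, THEN conjunct2, rule_format, OF square_integrable_echar zero_less_one,
      of "- of_int x"] by blast
  have zero: "F (- of_int x - s) = 0" if s: "s \<in> S" for s
  proof -
    have "s \<in> frequencies (Lambda b C)" using s S(2) by blast
    then obtain l n where l: "s = real t * of_int l" "l \<in> partial_spectrum b C n"
      by (auto simp: Lambda_eq)
    have "F (- (of_int x + s)) = 0"
      unfolding F_uminus l(1) using F_cycle_add_spectrum_eq_0[OF cyc x l(2)] by simp
    then show ?thesis by simp
  qed
  have orth: "\<forall>s\<in>S. \<forall>s'\<in>S. s \<noteq> s' \<longrightarrow> F (s - s') = 0"
    using frequencies_orthogonal[OF subsetD[OF S(2)] subsetD[OF S(2)]] by (intro ballI impI) assumption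
  have "complex_of_real (\<integral>y. (norm (echar (- of_int x * y) - (\<Sum>s\<in>S. a s * echar (s * y))))\<^sup>2 \<partial>\<mu>) =
      complex_of_real (1 + (\<Sum>s\<in>S. (norm (a s))\<^sup>2))"
    unfolding L2_distance_echar[OF S(1) orth] using zero by simp
  then have "(\<integral>y. (norm (echar (- of_int x * y) - (\<Sum>s\<in>S. a s * echar (s * y))))\<^sup>2 \<partial>\<mu>) =
      1 + (\<Sum>s\<in>S. (norm (a s))\<^sup>2)" by (simp only: of_real_eq_iff)
  then show False using S(3) sum_nonneg[of S "\<lambda>s. (norm (a s))\<^sup>2"] unfolding L2_norm_def by simp
qed

lemma is_spectrum_iff_no_integer_cycle:
  assumes "AE x in \<mu>. \<bar>x\<bar> \<le> R"
  shows "is_spectrum \<mu> (frequencies (Lambda b C)) \<longleftrightarrow> (\<nexists>X f. integer_cycle b C t X f)"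
proof
  assume "is_spectrum \<mu> (frequencies (Lambda b C))"
  from spectrum_imp_no_integer_cycle[OF this] show "\<nexists>X f. integer_cycle b C t X f" by simp
next
  assume "\<nexists>X f. integer_cycle b C t X f"
  then show "is_spectrum \<mu> (frequencies (Lambda b C))" by (rule no_integer_cycle_imp_spectrum[OF assms])
qed

end

section \<open>Spectral eigenvalues\<close>

lemma sum_echar_conjugate:
  fixes g :: "'a \<Rightarrow> int" and b t :: nat
  assumes "finite A" "b > 0" "coprime t b" "(\<Sum>a\<in>A. echar (real_of_int (g a) / b)) = 0"
  shows "(\<Sum>a\<in>A. echar (real_of_int (int t * g a) / b)) = 0"
proof -
  define z where "z = echar (1 / b)"
  have zb: "z ^ b = 1" using assms(2) echar_of_int[of 1] by (simp add: z_def echar_power)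
  have z: "z ^ nat (n mod int b) = echar (real_of_int n / b)" for n
  proof -
    have "n = int b * (n div int b) + n mod int b" by simp
    then have "real_of_int n = real b * of_int (n div int b) + of_int (n mod int b)"
      by (metis of_int_add of_int_mult of_int_of_nat_eq)
    then have "real_of_int n / b = of_int (n div int b) + of_int (n mod int b) / b"
      using assms(2) by (simp add: add_divide_distrib)
    then have "echar (real_of_int n / b) = echar (of_int (n mod int b) / b)"
      by (simp add: echar_add)
    moreover have "real (nat (n mod int b)) = of_int (n mod int b)" using assms(2) by simp
    ultimately show ?thesis by (simp add: z_def echar_power)
  qed
  have "(\<Sum>a\<in>A. z ^ nat (g a mod int b)) = 0" using assms(4) by (simp add: z)
  then have "(\<Sum>a\<in>A. z ^ (t * nat (g a mod int b))) = 0"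
    by (rule sum_powers_root_of_unity_conjugate[OF zb assms(2,1) _ assms(3)])
  moreover have "z ^ (t * nat (n mod int b)) = echar (real_of_int (int t * n) / b)" for n
    unfolding mult.commute[of t] power_mult z echar_power by simp
  ultimately show ?thesis by simp
qed

lemma hadamard_triple_entries:
  assumes "n > 0"
  shows "cnj (1 / complex_of_real (sqrt (real n)) * exp (- 2 * complex_of_real pi * \<i> * of_int x / of_nat b)) *
      (1 / complex_of_real (sqrt (real n)) * exp (- 2 * complex_of_real pi * \<i> * of_int y / of_nat b)) =
    echar (real_of_int (y - x) / b) / of_nat n"
proof -
  have e: "exp (- 2 * complex_of_real pi * \<i> * of_int x / of_nat b) = echar (real_of_int x / b)" for x
    by (simp add: echar_def cis_conv_exp mult_ac)
  have s: "complex_of_real (sqrt (real n)) * complex_of_real (sqrt (real n)) = of_nat n"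
    by (simp flip: of_real_mult)
  have "echar (real_of_int (y - x) / b) = cnj (echar (real_of_int x / b)) * echar (real_of_int y / b)"
    by (simp add: cnj_echar diff_divide_distrib flip: echar_add)
  then show ?thesis unfolding e s[symmetric] by simp
qed

lemma canonical_hadamard_tripleD:
  assumes "canonical_hadamard_triple b D C"
  shows "b > 2" "finite D" "0 \<in> D" "Gcd D = 1" "finite C" "0 \<in> C" "C \<subseteq> {0..int b - 2}"
    "card D = card C" "card D < b"
  using assms unfolding canonical_hadamard_triple_def integral_hadamard_triple_def by blast+

lemma hadamard_pair_canonical:
  assumes H: "canonical_hadamard_triple b D C" and t: "t \<ge> 1" "coprime t b"
  shows "hadamard_pair b t D C (self_similar_measure b D)"
proof -
  note props = canonical_hadamard_tripleD[OF H]
  have U: "unitary_matrix D C (\<lambda>d c. 1 / complex_of_real (sqrt (card D)) *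
              exp (- 2 * complex_of_real pi * \<i> * of_int (c * d) / of_nat b))"
    using H unfolding canonical_hadamard_triple_def integral_hadamard_triple_def by (elim conjE)
  note b = props(1) and D = props(2-4) and C = props(5-7) and card = props(8)
  have N: "card D > 0" using D by (auto simp: card_gt_0_iff)
  have col: "(\<Sum>d\<in>D. echar (real_of_int ((c - c') * d) / b)) = 0" if c: "c \<in> C" "c' \<in> C" "c \<noteq> c'" for c c'
  proof -
    have "(\<Sum>d\<in>D. echar (real_of_int (c * d - c' * d) / b) / of_nat (card D)) = of_bool (c = c')"
      using U[unfolded unitary_matrix_def, THEN conjunct1, rule_format, OF c(2,1)]
      unfolding hadamard_triple_entries[OF N] by (simp only: eq_commute[of c' c])
    then show ?thesis using N c(3) by (simp add: left_diff_distrib flip: sum_divide_distrib)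
  qed
  have row: "(\<Sum>c\<in>C. echar (real_of_int (c * (d - d')) / b)) = 0" if d: "d \<in> D" "d' \<in> D" "d \<noteq> d'" for d d'
  proof -
    have "(\<Sum>c\<in>C. echar (real_of_int (c * d - c * d') / b) / of_nat (card D)) = of_bool (d = d')"
      using U[unfolded unitary_matrix_def, THEN conjunct2, rule_format, OF d(1,2)]
      unfolding trans[OF mult.commute hadamard_triple_entries[OF N]] .
    then show ?thesis using N d(3) by (simp add: right_diff_distrib flip: sum_divide_distrib)
  qed
  show ?thesis
  proof
    show "b > 2" "finite D" "0 \<in> D" "Gcd D = 1" "finite C" "0 \<in> C" "C \<subseteq> {0..int b - 2}" "card D = card C"
      "t \<ge> 1" "coprime t b"
      by fact+
    show "(\<Sum>d\<in>D. echar (real_of_int (int t * ((c - c') * d)) / b)) = 0" if "c \<in> C" "c' \<in> C" "c \<noteq> c'" for c c'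
      by (rule sum_echar_conjugate[OF D(1) _ t(2) col[OF that]]) (use b in simp)
    show "(\<Sum>c\<in>C. echar (real_of_int (int t * (c * (d - d'))) / b)) = 0" if "d \<in> D" "d' \<in> D" "d \<noteq> d'" for d d'
      by (rule sum_echar_conjugate[OF C(1) _ t(2) row[OF that]]) (use b in simp)
    show "invariant_measure b D (self_similar_measure b D)"
    proof (rule self_similar_measure_props(1))
      show "b > 1" "D \<noteq> {}" using b D(2) by auto
    qed (rule D(1))
  qed
qed

lemma spectral_eigenvalue_iff_no_integer_cycle:
  assumes "canonical_hadamard_triple b D C" "t \<ge> 1" "coprime t b"
  shows "spectral_eigenvalue b D C t \<longleftrightarrow> (\<nexists>X f. integer_cycle b C t X f)"
proof -
  interpret hadamard_pair b t D C "self_similar_measure b D"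
    by (rule hadamard_pair_canonical[OF assms])
  obtain R where "AE x in self_similar_measure b D. \<bar>x\<bar> \<le> R"
    using self_similar_measure_props(2)[OF b1 D(1) D_ne] by blast
  from is_spectrum_iff_no_integer_cycle[OF this] show ?thesis
    unfolding spectral_eigenvalue_def using assms(2) by (simp only: simp_thms)
qed

section \<open>Infinite families of eigenvalues\<close>

lemma primitively_spectral_eigenvalueI:
  assumes "canonical_hadamard_triple b D C" "t \<ge> 1" "coprime t b"
    "\<And>X f. \<not> integer_cycle b C t X f"
  shows "primitively_spectral_eigenvalue b D C t"
  unfolding primitively_spectral_eigenvalue_def spectral_eigenvalue_iff_no_integer_cycle[OF assms(1-3)]
  using assms(3,4) by (simp add: coprime_imp_gcd_eq_1)

text \<open>The conjecture is applied to the base \<alpha>. Where \<alpha> is a primitive root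
  modulo \<open>p\<close>, passing to its power \<open>b\<close> divides the order by at most
  \<open>2 ^ k\<close>, which is the loss the residue count tolerates.\<close>

lemma infinite_eigenvalues_artin_power:
  assumes H: "canonical_hadamard_triple b D C" and artin: artin_conjecture
    and \<alpha>: "\<alpha> > 1" "\<not> is_square \<alpha>" and k: "2 ^ k * card C \<le> b" "b = \<alpha> ^ (2 ^ k)"
  shows "infinite {t. primitively_spectral_eigenvalue b D C t}"
proof -
  note b = canonical_hadamard_tripleD(1)[OF H] and C = canonical_hadamard_tripleD(7,5)[OF H]
  have "infinite {p::nat. prime p \<and> coprime p \<alpha> \<and> ord p \<alpha> = p - 1}"
    using artin \<alpha> by (simp add: artin_conjecture_def)
  then have "infinite ({p. prime p \<and> coprime p \<alpha> \<and> ord p \<alpha> = p - 1} - {..b\<^sup>2})"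
    by (rule Diff_infinite_finite[rotated]) simp
  then show ?thesis
  proof (rule infinite_super[rotated], intro subsetI CollectI)
    fix p assume "p \<in> {p. prime p \<and> coprime p \<alpha> \<and> ord p \<alpha> = p - 1} - {..b\<^sup>2}"
    then have p: "prime p" "coprime p \<alpha>" "ord p \<alpha> = p - 1" "p > b\<^sup>2" by auto
    have cop: "coprime p b" using p(2) k(2) by simp
    have "[\<alpha> ^ (2 ^ k * ord p b) = 1] (mod p)"
      using ord[of b p] by (simp add: power_mult flip: k(2))
    then have "p - 1 dvd 2 ^ k * ord p b" unfolding p(3)[symmetric] by (rule ord_divides[THEN iffD1])
    moreover have "ord p b > 0" using cop by (simp add: coprime_commute)
    ultimately have "p - 1 \<le> 2 ^ k * ord p b" by (intro dvd_imp_le) auto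
    then have "\<not> integer_cycle b C p X f" for X f
      by (rule no_integer_cycle_large_order[OF b C p(1) cop p(4) _ k(1)])
    then show "primitively_spectral_eigenvalue b D C p"
      using prime_ge_1_nat[OF p(1)] cop by (intro primitively_spectral_eigenvalueI[OF H])
  qed
qed

lemma infinite_eigenvalues_digit_sum:
  assumes H: "canonical_hadamard_triple b D C" and CC: "int b - 1 \<notin> C + C"
  shows "infinite {t. primitively_spectral_eigenvalue b D C t}"
proof -
  note b = canonical_hadamard_tripleD(1)[OF H] and C = canonical_hadamard_tripleD(7)[OF H]
  \<comment> \<open>The exponents start at 1, since exponent 0 would give t = 2, which need not be
    coprime to \<open>b\<close>.\<close>
  have "inj (\<lambda>n. b ^ Suc n + 1)" using b by (auto simp: inj_def simp del: power_Suc)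
  then have "infinite (range (\<lambda>n. b ^ Suc n + 1))" by (rule range_inj_infinite)
  then show ?thesis
  proof (rule infinite_super[rotated], intro subsetI CollectI)
    fix t assume "t \<in> range (\<lambda>n. b ^ Suc n + 1)"
    then obtain n where t: "t = b ^ Suc n + 1" by blast
    have "coprime t (b ^ Suc n)" unfolding t by (rule coprime_add_one_left)
    then have "coprime t b" by (simp only: coprime_power_right_iff) simp
    then show "primitively_spectral_eigenvalue b D C t"
      using no_integer_cycle_power_plus_one[OF b C CC, of "Suc n"]
      by (intro primitively_spectral_eigenvalueI[OF H]) (auto simp: t)
  qed
qed

lemma infinite_eigenvalues_prime_power:
  assumes H: "canonical_hadamard_triple b D C" and p: "prime p" "coprime p b" "p \<ge> b"
    and sp: "spectral_eigenvalue b D C (p ^ ell b p)"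
  shows "infinite {t. primitively_spectral_eigenvalue b D C t}"
proof -
  note b = canonical_hadamard_tripleD(1)[OF H] and C = canonical_hadamard_tripleD(7)[OF H]
  have p1: "p > 1" "p > 0" using p(1) prime_gt_1_nat prime_gt_0_nat by blast+
  note ell = ell_props[OF b p(1,2)]
  have no: "\<nexists>X f. integer_cycle b C (p ^ ell b p) X f"
    using sp p(2) p1(2) by (simp add: spectral_eigenvalue_iff_no_integer_cycle[OF H])
  have "inj (\<lambda>n. p ^ (ell b p + n))" using p1 by (auto simp: inj_def)
  then have "infinite (range (\<lambda>n. p ^ (ell b p + n)))" by (rule range_inj_infinite)
  then show ?thesis
  proof (rule infinite_super[rotated], intro subsetI CollectI)
    fix t assume "t \<in> range (\<lambda>n. p ^ (ell b p + n))"
    then obtain n where t: "t = p ^ (ell b p + n)" by blast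
    show "primitively_spectral_eigenvalue b D C t"
      using no_integer_cycle_prime_power[OF b C p ell _ no, of "ell b p + n"] p p1
      by (intro primitively_spectral_eigenvalueI[OF H]) (auto simp: t)
  qed
qed

theorem theorem1p8:
  fixes b :: nat and D C :: "int set"
  assumes "canonical_hadamard_triple b D C"
  shows "(artin_conjecture \<and> \<not> is_square b \<longrightarrow>
       infinite {t. primitively_spectral_eigenvalue b D C t}) \<and>
    (artin_conjecture \<and>
       (\<exists>(k::nat) (\<alpha>::nat). \<alpha> > 1 \<and> \<not> is_square \<alpha> \<and>
          2 ^ k * card C \<le> b \<and> b = \<alpha> ^ (2 ^ k)) \<longrightarrow>
       infinite {t. primitively_spectral_eigenvalue b D C t}) \<and>
    (int b - 1 \<notin> C + C \<longrightarrow>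
       infinite {t. primitively_spectral_eigenvalue b D C t}) \<and>
    ((\<exists>p::nat. prime p \<and> gcd p b = 1 \<and>
        int p > (int b - 1) * (int b - int (card C)) \<and>
        spectral_eigenvalue b D C (p ^ ell b p)) \<longrightarrow>
       infinite {t. primitively_spectral_eigenvalue b D C t})"
proof -
  have b: "b > 2" and card: "card C < b"
    using canonical_hadamard_tripleD(1,8,9)[OF assms] by auto
  have i: "infinite {t. primitively_spectral_eigenvalue b D C t}" if "artin_conjecture" "\<not> is_square b"
    \<comment> \<open>The case k = 0 with \<alpha> = b, where the size condition is just
      \<open>card C < b\<close>.\<close>
    using infinite_eigenvalues_artin_power[OF assms that(1) _ that(2), of 0] b card by simp
  have iv: "infinite {t. primitively_spectral_eigenvalue b D C t}"
    if p: "prime p" "gcd p b = 1" "int p > (int b - 1) * (int b - int (card C))"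
      "spectral_eigenvalue b D C (p ^ ell b p)" for p
  proof -
    \<comment> \<open>The factor \<open>int b - int (card C)\<close> is at least 1, so the bound
      places \<open>p\<close> above b - 1.\<close>
    have "(int b - 1) * 1 \<le> (int b - 1) * (int b - int (card C))"
      using b card by (intro mult_left_mono) auto
    from le_less_trans[OF this p(3)] have "p \<ge> b" by simp
    then show ?thesis
      using p(4) by (rule infinite_eigenvalues_prime_power[OF assms p(1) gcd_eq_1_imp_coprime[OF p(2)]])
  qed
  show ?thesis
  proof (intro conjI impI; (elim conjE exE)?)
    fix k \<alpha> assume "artin_conjecture" "\<alpha> > 1" "\<not> is_square \<alpha>" "2 ^ k * card C \<le> b" "b = \<alpha> ^ (2 ^ k)"
    then show "infinite {t. primitively_spectral_eigenvalue b D C t}"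
      by (rule infinite_eigenvalues_artin_power[OF assms])
  next
    fix p assume "prime p" "gcd p b = 1" "(int b - 1) * (int b - int (card C)) < int p"
      "spectral_eigenvalue b D C (p ^ ell b p)"
    then show "infinite {t. primitively_spectral_eigenvalue b D C t}" by (rule iv)
  next
    assume "int b - 1 \<notin> C + C"
    then show "infinite {t. primitively_spectral_eigenvalue b D C t}"
      by (rule infinite_eigenvalues_digit_sum[OF assms])
  next
    assume "artin_conjecture" "\<not> is_square b"
    then show "infinite {t. primitively_spectral_eigenvalue b D C t}" by (rule i)
  qed
qed

end
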